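(* The following asymptotic formulas hold as $B\to+\infty$. (1) Let $a\in\mathbb{Z}\setminus\{0\}$ be square-free and let $W\subset\mathbb{P}^3_{\mathbb{Q}}$ be given by the equation $t_0t_1t_2+t_3\cdot(t_0^2+a\cdot t_1^2)=0$. Then $$N(W^{norm},B)=\frac{\pi B^2}{4\zeta(2)}\cdot\left(4+\sum_{\substack{(\mu,\lambda)\in\mathbb{Z}^2_{\operatorname{prim}}\\ \mu\neq 0}}\frac{\gcd(a,\mu)}{\sqrt{f(\mu,\lambda)}}\right)+O\left(B^{3/2}(\log B)^2\right),$$ where $f(\mu,\lambda)=(\lambda^2+\mu^2)\left(\lambda^2\mu^2+(\mu^2+a\cdot\lambda^2)^2\right)$. (2) Let $W\subset\mathbb{P}^4_{\mathbb{Q}}$ be given by the equation $t_0^2t_2+t_1^2t_3+t_0t_1t_4=0$. Then $$N(W^{norm},B)=\frac{\pi B^3}{3\zeta(3)}\sum_{(\mu,\lambda)\in\mathbb{Z}^2_{\operatorname{prim}}}\frac{1}{\sqrt{f(\mu,\lambda)}}+O\left(B^2\log B\right),$$ where $f(\mu,\lambda)=(\lambda^2+\mu^2)(\lambda^2\mu^2+\mu^4+\lambda^4)$.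
   Context: For $n\ge 1$, $\mathbb{Z}^{n+1}_{\operatorname{prim}}=\{(t_0,\ldots,t_n)\in\mathbb{Z}^{n+1}\setminus\{(0,\ldots,0)\} : \gcd(t_0,\ldots,t_n)=1\}$. The height function $H\colon\mathbb{P}^n(\mathbb{Q})\to\mathbb{R}_{>0}$ is defined by $H(t_0:\ldots:t_n)=\sqrt{t_0^2+\ldots+t_n^2}$, where the representative $(t_0,\ldots,t_n)$ is chosen in $\mathbb{Z}^{n+1}_{\operatorname{prim}}$ (it is unique up to sign). For a geometrically integral projective variety $W\subset\mathbb{P}^n_{\mathbb{Q}}$, $W^{norm}\subset W$ denotes the locus of geometrically normal points of $W$, and for $B\in\mathbb{R}_{>0}$ the counting function is $$N(W^{norm},B)=\#\{t\in W^{norm}(\mathbb{Q}) : H(t)\le B\}.$$ $\zeta$ is the Riemann zeta function; $\gcd$ is taken to be positive. The variety $W$ (in part (1), the integer $a$) is fixed as $B\to+\infty$, so the implied constants may depend on it. *)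

theory Defs
  imports
    "HOL-Analysis.Analysis"
    "HOL-Library.Poly_Mapping"
    "HOL-Library.Landau_Symbols"
    "HOL-Algebra.Algebraic_Closure_Type"
    "HOL-Algebra.QuotRing"
begin

section \<open>Projective space over a field\<close>

text \<open>Coordinates are indexed by a finite type \<open>'n\<close>, so projective \<open>n\<close>-space uses an index
  type with \<open>n + 1\<close> elements. A point is the set of all its nonzero coordinate vectors.\<close>

definition proj_rel :: "(('k::field ^ 'n) \<times> ('k ^ 'n)) set" where
  "proj_rel = {(x, y). x \<noteq> 0 \<and> y \<noteq> 0 \<and> (\<exists>c. c \<noteq> 0 \<and> y = c *s x)}"

definition proj_space :: "('k::field ^ 'n) set set" where
  "proj_space = (UNIV - {0}) // proj_rel"


section \<open>Heights of rational points\<close>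

definition prim :: "(int ^ 'n::finite) set" where
  "prim = {z. z \<noteq> 0 \<and> Gcd (range (\<lambda>i. z $ i)) = 1}"

text \<open>The primitive representative is unique up to sign, so the choice does not matter.\<close>

definition height :: "(rat ^ 'n::finite) set \<Rightarrow> real" where
  "height t = (let z = (SOME z. z \<in> prim \<and> (\<chi> i. of_int (z $ i)) \<in> t)
               in sqrt (\<Sum>i\<in>UNIV. (real_of_int (z $ i))\<^sup>2))"


section \<open>Polynomials in several variables\<close>

type_synonym ('n, 'k) mpoly = "('n \<Rightarrow>\<^sub>0 nat) \<Rightarrow>\<^sub>0 'k"

definition mvar :: "'n \<Rightarrow> ('n, 'k::comm_ring_1) mpoly" where
  "mvar i = Poly_Mapping.single (Poly_Mapping.single i 1) 1"

definition mpoly_eval :: "('k::comm_ring_1 ^ 'n::finite) \<Rightarrow> ('n, 'k) mpoly \<Rightarrow> 'k" where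
  "mpoly_eval x G = (\<Sum>m\<in>Poly_Mapping.keys G.
     Poly_Mapping.lookup G m * (\<Prod>i\<in>UNIV. (x $ i) ^ Poly_Mapping.lookup m i))"

text \<open>The zero polynomial is homogeneous of every degree.\<close>

definition homogeneous :: "nat \<Rightarrow> ('n::finite, 'k::comm_ring_1) mpoly \<Rightarrow> bool" where
  "homogeneous d G \<longleftrightarrow>
     (\<forall>m\<in>Poly_Mapping.keys G. (\<Sum>i\<in>UNIV. Poly_Mapping.lookup m i) = d)"


section \<open>Fraction fields and integral closedness\<close>

definition frac_rel :: "('a, 'b) ring_scheme \<Rightarrow> (('a \<times> 'a) \<times> ('a \<times> 'a)) set" where
  "frac_rel R = {((a, b), (c, d)). a \<in> carrier R \<and> b \<in> carrier R - {\<zero>\<^bsub>R\<^esub>} \<and>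
     c \<in> carrier R \<and> d \<in> carrier R - {\<zero>\<^bsub>R\<^esub>} \<and> a \<otimes>\<^bsub>R\<^esub> d = c \<otimes>\<^bsub>R\<^esub> b}"

definition frac_class :: "('a, 'b) ring_scheme \<Rightarrow> 'a \<Rightarrow> 'a \<Rightarrow> ('a \<times> 'a) set" where
  "frac_class R a b = frac_rel R `` {(a, b)}"

text \<open>The field of fractions of a domain \<open>R\<close>.\<close>

definition frac_field :: "('a, 'b) ring_scheme \<Rightarrow> ('a \<times> 'a) set ring" where
  "frac_field R = \<lparr>
     carrier = (carrier R \<times> (carrier R - {\<zero>\<^bsub>R\<^esub>})) // frac_rel R,
     monoid.mult = (\<lambda>U V. \<Union>u\<in>U. \<Union>v\<in>V.
       frac_class R (fst u \<otimes>\<^bsub>R\<^esub> fst v) (snd u \<otimes>\<^bsub>R\<^esub> snd v)),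
     one = frac_class R \<one>\<^bsub>R\<^esub> \<one>\<^bsub>R\<^esub>,
     ring.zero = frac_class R \<zero>\<^bsub>R\<^esub> \<one>\<^bsub>R\<^esub>,
     add = (\<lambda>U V. \<Union>u\<in>U. \<Union>v\<in>V.
       frac_class R ((fst u \<otimes>\<^bsub>R\<^esub> snd v) \<oplus>\<^bsub>R\<^esub> (fst v \<otimes>\<^bsub>R\<^esub> snd u)) (snd u \<otimes>\<^bsub>R\<^esub> snd v))\<rparr>"

text \<open>Polynomials of HOL-Algebra are lists of coefficients starting with the leading one.\<close>

definition integral_over :: "('a, 'b) ring_scheme \<Rightarrow> 'a set \<Rightarrow> 'a \<Rightarrow> bool" where
  "integral_over L A x \<longleftrightarrow>
     (\<exists>p. Polynomials.polynomial L A p \<and> p \<noteq> [] \<and> hd p = \<one>\<^bsub>L\<^esub> \<and> ring.eval L p x = \<zero>\<^bsub>L\<^esub>)"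

text \<open>A subring \<open>A\<close> of a field \<open>L\<close> is integrally closed in its own field of fractions, which is
  realised inside \<open>L\<close> as the set of quotients of elements of \<open>A\<close>.\<close>

definition integrally_closed :: "('a, 'b) ring_scheme \<Rightarrow> 'a set \<Rightarrow> bool" where
  "integrally_closed L A \<longleftrightarrow>
     (\<forall>a\<in>A. \<forall>b\<in>A - {\<zero>\<^bsub>L\<^esub>}.
        integral_over L A (a \<otimes>\<^bsub>L\<^esub> inv\<^bsub>L\<^esub> b) \<longrightarrow> a \<otimes>\<^bsub>L\<^esub> inv\<^bsub>L\<^esub> b \<in> A)"


section \<open>Integral projective hypersurfaces and their local rings\<close>

text \<open>Everything in this section is meant for a homogeneous prime polynomial \<open>F\<close>, i.e. for an
  integral hypersurface. The local ring at \<open>x\<close> is the degree zero part of the localisation of the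
  homogeneous coordinate ring at the homogeneous prime of \<open>x\<close>, as a subring of the field of
  fractions of the homogeneous coordinate ring.\<close>

definition hom_coord_ring :: "('n, 'k::field) mpoly \<Rightarrow> ('n, 'k) mpoly set ring" where
  "hom_coord_ring F =
     ring_of_type_algebra Quot (genideal ring_of_type_algebra {F})"

definition residue_class :: "('n, 'k::field) mpoly \<Rightarrow> ('n, 'k) mpoly \<Rightarrow> ('n, 'k) mpoly set" where
  "residue_class F G =
     genideal ring_of_type_algebra {F} +>\<^bsub>ring_of_type_algebra\<^esub> G"

definition local_ring ::
  "('n::finite, 'k::field) mpoly \<Rightarrow> 'k ^ 'n \<Rightarrow> (('n, 'k) mpoly set \<times> ('n, 'k) mpoly set) set set"
where
  "local_ring F x =
     {frac_class (hom_coord_ring F) (residue_class F G) (residue_class F H) | G H d.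
        homogeneous d G \<and> homogeneous d H \<and> mpoly_eval x H \<noteq> 0}"

definition normal_at :: "('n::finite, 'k::field) mpoly \<Rightarrow> 'k ^ 'n \<Rightarrow> bool" where
  "normal_at F x \<longleftrightarrow> integrally_closed (frac_field (hom_coord_ring F)) (local_ring F x)"

text \<open>A rational point is geometrically normal if it is a normal point after base change to the
  algebraic closure.\<close>

definition geom_normal_at :: "('n::finite, 'k::field) mpoly \<Rightarrow> 'k ^ 'n \<Rightarrow> bool" where
  "geom_normal_at F x \<longleftrightarrow> normal_at (Poly_Mapping.map to_ac F) (\<chi> i. to_ac (x $ i))"

definition hypersurface_points :: "('n::finite, 'k::field) mpoly \<Rightarrow> ('k ^ 'n) set set" where
  "hypersurface_points F = {t \<in> proj_space. \<forall>x\<in>t. mpoly_eval x F = 0}"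

definition norm_locus_points :: "('n::finite, 'k::field) mpoly \<Rightarrow> ('k ^ 'n) set set" where
  "norm_locus_points F = {t \<in> hypersurface_points F. \<forall>x\<in>t. geom_normal_at F x}"

definition N_norm :: "('n::finite, rat) mpoly \<Rightarrow> real \<Rightarrow> nat" where
  "N_norm F B = card {t \<in> norm_locus_points F. height t \<le> B}"


section \<open>The two hypersurfaces and the leading constants\<close>

definition W1 :: "int \<Rightarrow> (4, rat) mpoly" where
  "W1 a = mvar 0 * mvar 1 * mvar 2 + mvar 3 * ((mvar 0)\<^sup>2 + of_int a * (mvar 1)\<^sup>2)"

definition W2 :: "(5, rat) mpoly" where
  "W2 = (mvar 0)\<^sup>2 * mvar 2 + (mvar 1)\<^sup>2 * mvar 3 + mvar 0 * mvar 1 * mvar 4"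

text \<open>The Dirichlet series of the Riemann zeta function; only meant for \<open>s > 1\<close>.\<close>

definition zeta :: "real \<Rightarrow> real" where
  "zeta s = suminf (\<lambda>n. 1 / real (Suc n) powr s)"

definition prim2 :: "(int \<times> int) set" where
  "prim2 = {(m, l). (m, l) \<noteq> (0, 0) \<and> gcd m l = 1}"

definition f1 :: "int \<Rightarrow> int \<Rightarrow> int \<Rightarrow> int" where
  "f1 a m l = (l\<^sup>2 + m\<^sup>2) * (l\<^sup>2 * m\<^sup>2 + (m\<^sup>2 + a * l\<^sup>2)\<^sup>2)"

definition f2 :: "int \<Rightarrow> int \<Rightarrow> int" where
  "f2 m l = (l\<^sup>2 + m\<^sup>2) * (l\<^sup>2 * m\<^sup>2 + m ^ 4 + l ^ 4)"

end

theory Submission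
  imports Defs
begin

text \<open>Both hypersurfaces have the form \<open>A t\<^sub>0\<^sup>2 + B t\<^sub>1\<^sup>2 + C t\<^sub>0 t\<^sub>1 = 0\<close> with linear forms \<open>A\<close>, \<open>B\<close>, \<open>C\<close> in
the remaining coordinates, and they are normal exactly away from the linear space \<open>t\<^sub>0 = t\<^sub>1 = 0\<close>,
along which they have multiplicity two. Where \<open>(t\<^sub>0, t\<^sub>1) \<noteq> 0\<close> the equation can be solved for one
of the variables, so the local ring is a localisation of a polynomial ring; that is a factorial ring,
and hence integrally closed (\<open>gcd_domain_localization_integrally_closed\<close>, \<open>normal_at_chart\<close>). On the
double locus the function \<open>w = A t\<^sub>0 / (D t\<^sub>1)\<close>, with a coordinate \<open>D\<close> that does not vanish at the
point, satisfies \<open>w\<^sup>2 + (C/D) w + A B/D\<^sup>2 = 0\<close> but has no representative with a denominator that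
is nonzero at the point (\<open>not_normal_at\<close>). The same computation works over the algebraic closure.

Counting normal points therefore means counting, up to sign, the primitive integral solutions with
\<open>(t\<^sub>0, t\<^sub>1) \<noteq> 0\<close>. Write \<open>(t\<^sub>0, t\<^sub>1) = k (\<mu>, \<lambda>)\<close> with \<open>(\<mu>, \<lambda>)\<close> primitive and \<open>k > 0\<close>. After division
by \<open>k\<^sup>2\<close> the equation is linear in the other coordinates, so for every fixed \<open>(\<mu>, \<lambda>)\<close> the solutions
form a lattice, of rank two on the surface and of rank three on the threefold. In the explicit bases
of \<open>card_W1_pos\<close> and \<open>card_W2_pos\<close>, primitive solutions are those with coprime lattice coordinates
and the height is a positive definite quadratic form. The number of lattice points in an ellipse or
ellipsoid is its volume up to an error of the size of its surface, by packing unit cubes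
(\<open>lattice_points_ellipsoid\<close>), and Moebius inversion (\<open>card_primitive_moebius\<close>,
\<open>sum_mu_power_approx\<close>) selects the primitive points at the cost of the factor \<open>1/\<zeta>(2)\<close> or
\<open>1/\<zeta>(3)\<close> (\<open>count_PE2\<close>, \<open>count_PE3\<close>). The volumes are the terms \<open>gcd(a, \<mu>)/\<surd>f(\<mu>, \<lambda>)\<close> and
\<open>1/\<surd>f(\<mu>, \<lambda>)\<close>, up to constants.

It remains to sum over \<open>(\<mu>, \<lambda>)\<close>. Let \<open>j\<close> be the maximum norm of \<open>(\<mu>, \<lambda>)\<close>; there are \<open>8 j\<close>
integral vectors of norm \<open>j\<close>, and the terms of the series are \<open>O(j\<^sup>-\<^sup>3)\<close>, so the series converges with
a tail \<open>O(1/J)\<close> after norm \<open>J\<close> (\<open>shell_tail\<close>, \<open>sum_approx_infsum\<close>). On the threefold the error of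
one lattice is \<open>O(B\<^sup>2/j\<^sup>2)\<close> and only norms up to \<open>B\<close> occur, which gives \<open>O(B\<^sup>2 log B)\<close>. On the surface
the ellipse has semi-axes \<open>O(B/j)\<close> and \<open>O(B/j\<^sup>2)\<close>. The error of the count is \<open>O((B/j) log B)\<close>, and because of
the second semi-axis only \<open>j = O(\<surd>B)\<close> contribute, once the points with \<open>t\<^sub>2 = t\<^sub>3 = 0\<close> have been set
aside; the sum of the errors is then \<open>O(B\<^sup>3\<^sup>/\<^sup>2 log B)\<close>. The exceptional points lie on the line
\<open>t\<^sub>2 = t\<^sub>3 = 0\<close>, and \<open>\<mu> = 0\<close> gives a second line \<open>t\<^sub>0 = t\<^sub>3 = 0\<close>. The primitive vectors on either line
are those of a disc of radius \<open>B\<close>, and together the lines account for the summand \<open>4\<close> of the leading constant.\<close>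

section \<open>Homomorphisms out of polynomial rings\<close>

text \<open>Polynomial rings are type classes here, while fields of fractions are record structures; maps between
the former are handled as plain functions that respect the unit and both operations.\<close>

definition rhom :: "('a::comm_ring_1 \<Rightarrow> 'b::comm_ring_1) \<Rightarrow> bool" where
  "rhom f \<longleftrightarrow> f 1 = 1 \<and> (\<forall>x y. f (x + y) = f x + f y) \<and> (\<forall>x y. f (x * y) = f x * f y)"

lemma rhomI:
  assumes "f 1 = 1" "\<And>x y. f (x + y) = f x + f y" "\<And>x y. f (x * y) = f x * f y"
  shows "rhom f"
  using assms by (auto simp: rhom_def)

lemma rhom_simps:
  assumes "rhom f"
  shows rhom_1: "f 1 = 1" and rhom_0: "f 0 = 0" and rhom_add: "f (x + y) = f x + f y"
    and rhom_mult: "f (x * y) = f x * f y" and rhom_minus: "f (- x) = - f x"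
    and rhom_diff: "f (x - y) = f x - f y" and rhom_power: "f (x ^ n) = f x ^ n"
    and rhom_of_int: "f (of_int i) = of_int i"
proof -
  have 0: "f 0 = 0" using assms unfolding rhom_def by (metis add_cancel_right_right)
  show "f 1 = 1" "f (x + y) = f x + f y" "f (x * y) = f x * f y" "f 0 = 0"
    using assms 0 unfolding rhom_def by auto
  have m: "f (- x) = - f x" for x
    using assms 0 unfolding rhom_def by (metis add.right_inverse add_eq_0_iff)
  show "f (- x) = - f x" by (fact m)
  show "f (x - y) = f x - f y" using assms m unfolding rhom_def by (metis diff_conv_add_uminus)
  show "f (x ^ n) = f x ^ n" using assms unfolding rhom_def by (induction n) auto
  have n: "f (of_nat k) = of_nat k" for k
    using assms 0 unfolding rhom_def by (induction k) auto
  show "f (of_int i) = of_int i"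
    by (cases i) (use n m assms in \<open>auto simp: rhom_def simp del: of_nat_Suc\<close>)
qed

lemma rhom_sum: "rhom f \<Longrightarrow> f (sum g A) = (\<Sum>x\<in>A. f (g x))"
  by (induction A rule: infinite_finite_induct) (auto simp: rhom_simps)

lemma rhom_comp: "rhom f \<Longrightarrow> rhom g \<Longrightarrow> rhom (\<lambda>x. f (g x))"
  by (auto simp: rhom_def)

lemma rhom_id: "rhom (\<lambda>x. x)" by (auto simp: rhom_def)

lemma rhom_dvd: "rhom f \<Longrightarrow> a dvd b \<Longrightarrow> f a dvd f b"
  by (auto simp: dvd_def rhom_mult)

abbreviation Const :: "'k::comm_ring_1 \<Rightarrow> ('n, 'k) mpoly" where
  "Const c \<equiv> Poly_Mapping.single 0 c"

lemma rhom_Const: "rhom (Const :: 'k::comm_ring_1 \<Rightarrow> ('n,'k) mpoly)"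
  by (auto simp: rhom_def single_add mult_single)

lemma mpoly_sum_terms:
  "(\<Sum>m\<in>Poly_Mapping.keys G. Poly_Mapping.single m (Poly_Mapping.lookup G m)) = G"
proof (rule poly_mapping_eqI)
  fix k
  show "Poly_Mapping.lookup (\<Sum>m\<in>Poly_Mapping.keys G. Poly_Mapping.single m (Poly_Mapping.lookup G m)) k
      = Poly_Mapping.lookup G k"
    by (simp add: lookup_sum lookup_single when_def in_keys_iff)
qed

lemma mpoly_term_induct [case_names single add]:
  fixes G :: "('n, 'k::comm_ring_1) mpoly"
  assumes "\<And>m c. Q (Poly_Mapping.single m c)" "\<And>G H. Q G \<Longrightarrow> Q H \<Longrightarrow> Q (G + H)"
  shows "Q G"
proof -
  have z: "Q 0" using assms(1)[of 0 0] by simp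
  have "Q (\<Sum>m\<in>A. Poly_Mapping.single m (Poly_Mapping.lookup G m))" for A
    by (induction A rule: infinite_finite_induct) (auto simp: assms z)
  thus ?thesis by (metis mpoly_sum_terms)
qed

lemma single_eq_prod:
  fixes m :: "'n::finite \<Rightarrow>\<^sub>0 nat"
  shows "Poly_Mapping.single m c
    = Const c * (\<Prod>i\<in>UNIV. (mvar i :: ('n, 'k::comm_ring_1) mpoly) ^ Poly_Mapping.lookup m i)"
proof -
  have p: "(mvar i :: ('n,'k) mpoly) ^ k = Poly_Mapping.single (Poly_Mapping.single i k) 1" for i k
    by (induction k) (auto simp: mvar_def mult_single single_add[symmetric] single_one)
  have q: "(\<Prod>i\<in>A. Poly_Mapping.single (Poly_Mapping.single i (g i)) (1::'k))
      = Poly_Mapping.single (\<Sum>i\<in>A. Poly_Mapping.single i (g i)) 1" for A :: "'n set" and g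
    by (induction A rule: infinite_finite_induct) (auto simp: mult_single single_one)
  have "(\<Sum>i\<in>UNIV. Poly_Mapping.single i (Poly_Mapping.lookup m i)) = m"
    by (rule poly_mapping_eqI) (simp add: lookup_sum lookup_single when_def)
  thus ?thesis by (simp add: p q mult_single)
qed

text \<open>This is the universal property in the form of an induction rule: a polynomial ring is generated by
constants and variables.\<close>

lemma mpoly_induct [case_names Const mvar add mult]:
  fixes G :: "('n::finite, 'k::comm_ring_1) mpoly"
  assumes C: "\<And>c. Q (Const c)" and v: "\<And>i. Q (mvar i)"
    and a: "\<And>G H. Q G \<Longrightarrow> Q H \<Longrightarrow> Q (G + H)" and m: "\<And>G H. Q G \<Longrightarrow> Q H \<Longrightarrow> Q (G * H)"
  shows "Q G"
proof (induction G rule: mpoly_term_induct)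
  case (single e c)
  have 1: "Q 1" using C[of 1] by simp
  have "Q (mvar i ^ k)" for i k by (induction k) (auto simp: 1 v m)
  hence "Q (\<Prod>i\<in>A. mvar i ^ Poly_Mapping.lookup e i)" for A
    by (induction A rule: infinite_finite_induct) (auto simp: 1 assms(4))
  thus ?case by (subst single_eq_prod) (intro m C)
qed (fact a)

lemma rhom_mpoly_eqI:
  fixes f g :: "('n::finite, 'k::comm_ring_1) mpoly \<Rightarrow> 'r::comm_ring_1"
  assumes "rhom f" "rhom g" "\<And>c. f (Const c) = g (Const c)" "\<And>i. f (mvar i) = g (mvar i)"
  shows "f G = g G"
  by (induction G rule: mpoly_induct)
    (simp_all add: assms(3,4) rhom_simps[OF assms(1)] rhom_simps[OF assms(2)])

definition meval ::
  "('k::comm_ring_1 \<Rightarrow> 'r::comm_ring_1) \<Rightarrow> ('n::finite \<Rightarrow> 'r) \<Rightarrow> ('n, 'k) mpoly \<Rightarrow> 'r" where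
  "meval h v G = (\<Sum>m\<in>Poly_Mapping.keys G.
     h (Poly_Mapping.lookup G m) * (\<Prod>i\<in>UNIV. v i ^ Poly_Mapping.lookup m i))"

lemma meval_superset:
  assumes "h 0 = 0" "finite S" "Poly_Mapping.keys G \<subseteq> S"
  shows "meval h v G = (\<Sum>m\<in>S. h (Poly_Mapping.lookup G m) * (\<Prod>i\<in>UNIV. v i ^ Poly_Mapping.lookup m i))"
  unfolding meval_def using assms
  by (intro sum.mono_neutral_left) (auto simp: in_keys_iff)

lemma meval_single:
  assumes "h 0 = 0"
  shows "meval h v (Poly_Mapping.single m c) = h c * (\<Prod>i\<in>UNIV. v i ^ Poly_Mapping.lookup m i)"
  using meval_superset[of h, OF assms, of "{m}" "Poly_Mapping.single m c" v] by (simp split: if_splits)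

lemma rhom_meval:
  assumes h: "rhom h"
  shows "rhom (meval h v)"
proof (rule rhomI)
  have h0: "h 0 = 0" using h by (rule rhom_0)
  show "meval h v 1 = 1"
    using meval_single[of h v 0 1, OF h0] by (simp add: rhom_1[OF h])
  show add: "meval h v (G + H) = meval h v G + meval h v H" for G H
  proof -
    let ?S = "Poly_Mapping.keys G \<union> Poly_Mapping.keys H"
    have "Poly_Mapping.keys (G + H) \<subseteq> ?S" by (rule keys_add)
    thus ?thesis
      using meval_superset[of h, OF h0, of ?S "G+H" v] meval_superset[of h, OF h0, of ?S "G" v]
        meval_superset[of h, OF h0, of ?S "H" v]
      by (simp add: lookup_add rhom_add[OF h] distrib_right sum.distrib)
  qed
  show "meval h v (G * H) = meval h v G * meval h v H" for G H
  proof (induction G rule: mpoly_term_induct)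
    case (single m c)
    show ?case
    proof (induction H rule: mpoly_term_induct)
      case (single m' c')
      show ?case
        by (simp add: mult_single meval_single[of h v, OF h0] lookup_add power_add prod.distrib
          rhom_mult[OF h] mult_ac)
    qed (auto simp: distrib_left add)
  qed (auto simp: distrib_right add)
qed

lemma meval_Const: "rhom h \<Longrightarrow> meval h v (Const c) = h c"
  by (simp add: meval_single rhom_0)

lemma meval_mvar:
  assumes "rhom h"
  shows "meval h v (mvar i) = v i"
proof -
  have "(\<Prod>j\<in>UNIV. v j ^ Poly_Mapping.lookup (Poly_Mapping.single i 1) j) = (\<Prod>j\<in>UNIV. if j = i then v j else 1)"
    by (intro prod.cong) (auto simp: lookup_single when_def)
  also have "\<dots> = v i" by (simp add: prod.delta)
  finally show ?thesis using assms by (simp add: mvar_def meval_single rhom_simps)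
qed

lemma mpoly_eval_eq_meval: "mpoly_eval x = meval (\<lambda>c. c) (\<lambda>i. x $ i)"
  by (rule ext) (simp add: mpoly_eval_def meval_def)

lemma rhom_mpoly_eval: "rhom (mpoly_eval x)"
  unfolding mpoly_eval_eq_meval by (rule rhom_meval[OF rhom_id])

lemma mpoly_eval_mvar [simp]: "mpoly_eval x (mvar i) = x $ i"
  by (simp add: mpoly_eval_eq_meval meval_mvar rhom_id)

lemma mpoly_eval_Const [simp]: "mpoly_eval x (Const c) = c"
  by (simp add: mpoly_eval_eq_meval meval_Const rhom_id)

text \<open>Base change of polynomials, needed because geometric normality is tested over the algebraic closure.\<close>

lemma rhom_map_mpoly:
  fixes h :: "'k::comm_ring_1 \<Rightarrow> 'l::comm_ring_1"
  assumes h: "rhom h"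
  shows "rhom (Poly_Mapping.map h :: ('n, 'k) mpoly \<Rightarrow> ('n, 'l) mpoly)"
proof (rule rhomI)
  have h0: "h 0 = 0" using h by (rule rhom_0)
  have lookup: "Poly_Mapping.lookup (Poly_Mapping.map h G) k = h (Poly_Mapping.lookup G k)"
    for G :: "('n, 'k) mpoly" and k
    by (simp add: Poly_Mapping.map.rep_eq when_def h0)
  have sg: "Poly_Mapping.map h (Poly_Mapping.single m c) = Poly_Mapping.single m (h c)"
    for m :: "'n \<Rightarrow>\<^sub>0 nat" and c
    by (rule poly_mapping_eqI) (simp add: lookup lookup_single when_def h0)
  show "Poly_Mapping.map h (1 :: ('n, 'k) mpoly) = 1"
    by (rule poly_mapping_eqI) (simp add: lookup lookup_one when_def rhom_simps[OF h])
  show add: "Poly_Mapping.map h (G + H) = Poly_Mapping.map h G + Poly_Mapping.map h H"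
    for G H :: "('n, 'k) mpoly"
    by (rule poly_mapping_eqI) (simp add: lookup lookup_add rhom_simps[OF h])
  show "Poly_Mapping.map h (G * H) = Poly_Mapping.map h G * Poly_Mapping.map h H"
    for G H :: "('n, 'k) mpoly"
  proof (induction G rule: mpoly_term_induct)
    case (single m c)
    show ?case
    proof (induction H rule: mpoly_term_induct)
      case (single m' c')
      show ?case by (simp add: mult_single sg rhom_mult[OF h])
    qed (auto simp: distrib_left add)
  qed (auto simp: distrib_right add)
qed

lemma map_mpoly_mvar: "rhom h \<Longrightarrow> Poly_Mapping.map h (mvar i) = mvar i"
  by (rule poly_mapping_eqI) (auto simp: mvar_def Poly_Mapping.map.rep_eq lookup_single when_def rhom_simps)

definition peval :: "('a::comm_ring_1 \<Rightarrow> 'r::comm_ring_1) \<Rightarrow> 'r \<Rightarrow> 'a poly \<Rightarrow> 'r" where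
  "peval h v p = fold_coeffs (\<lambda>a r. h a + v * r) p 0"

lemma peval_0 [simp]: "peval h v 0 = 0"
  by (simp add: peval_def)

lemma peval_pCons: "rhom h \<Longrightarrow> peval h v (pCons a p) = h a + v * peval h v p"
  by (cases "p = 0 \<and> a = 0") (auto simp: peval_def rhom_0)

lemma rhom_peval:
  assumes h: "rhom h"
  shows "rhom (peval h v)"
proof (rule rhomI)
  show "peval h v 1 = 1" by (simp add: one_pCons peval_pCons rhom_simps h)
  show add: "peval h v (p + q) = peval h v p + peval h v q" for p q
    by (induction p q rule: poly_induct2)
      (auto simp: peval_pCons[OF h] rhom_simps[OF h] algebra_simps)
  have smult: "peval h v (Polynomial.smult a p) = h a * peval h v p" for a p
    by (induction p) (auto simp: peval_pCons[OF h] rhom_simps[OF h] algebra_simps)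
  show "peval h v (p * q) = peval h v p * peval h v q" for p q
    by (induction p) (auto simp: peval_pCons[OF h] rhom_simps[OF h] add smult algebra_simps)
qed

lemma peval_const: "rhom h \<Longrightarrow> peval h v [:a:] = h a"
  by (simp add: peval_pCons)

lemma peval_X: "rhom h \<Longrightarrow> peval h v [:0, 1:] = v"
  by (simp add: peval_pCons rhom_simps)

lemma rhom_poly_eqI:
  fixes f g :: "'a::comm_ring_1 poly \<Rightarrow> 'r::comm_ring_1"
  assumes f: "rhom f" and g: "rhom g" and "\<And>a. f [:a:] = g [:a:]" "f [:0, 1:] = g [:0, 1:]"
  shows "f p = g p"
proof (induction p)
  case (pCons a p)
  have e: "pCons a p = [:a:] + [:0, 1:] * p" by simp
  show ?case unfolding e using pCons assms by (simp add: rhom_add rhom_mult del: add_pCons mult_pCons_left)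
qed (use f g in \<open>auto simp: rhom_0\<close>)

lemma rhom_poly_const: "rhom (\<lambda>a. [:a:])"
  by (auto simp: rhom_def)

lemma rhom_to_fract: "rhom to_fract"
  by (auto simp: rhom_def)

section \<open>The function field of an integral hypersurface\<close>

lemma frac_rel_iff:
  "((a, b), (c, d)) \<in> frac_rel R \<longleftrightarrow> a \<in> carrier R \<and> b \<in> carrier R \<and> b \<noteq> \<zero>\<^bsub>R\<^esub> \<and>
     c \<in> carrier R \<and> d \<in> carrier R \<and> d \<noteq> \<zero>\<^bsub>R\<^esub> \<and> a \<otimes>\<^bsub>R\<^esub> d = c \<otimes>\<^bsub>R\<^esub> b"
  by (auto simp: frac_rel_def)

lemma carrier_type_algebra [simp]: "carrier (ring_of_type_algebra :: 'a::comm_ring_1 ring) = UNIV"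
  by (simp add: ring_of_type_algebra_def)

text \<open>Coefficients are listed from the leading one down, as for the polynomials in the definition of integral
elements.\<close>

fun list_eval :: "'a::comm_ring_1 list \<Rightarrow> 'a \<Rightarrow> 'a" where
  "list_eval [] x = 0"
| "list_eval (c # cs) x = c * x ^ length cs + list_eval cs x"

text \<open>A homomorphism to a field whose kernel is generated by \<open>F\<close> embeds the homogeneous coordinate ring of
\<open>F = 0\<close>, and hence its field of fractions. Working with such a \<open>\<phi>\<close> replaces residue classes and
classes of fractions by elements \<open>\<phi> G / \<phi> H\<close> of an ordinary field. That \<open>F\<close> is prime is implicit.\<close>

locale field_embedding =
  fixes F :: "('n::finite, 'k::field) mpoly" and \<phi> :: "('n, 'k) mpoly \<Rightarrow> 'q::field"
  assumes hom: "rhom \<phi>" and ker: "\<phi> G = 0 \<longleftrightarrow> F dvd G"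
begin

abbreviation "Q \<equiv> hom_coord_ring F"
abbreviation "L \<equiv> frac_field Q"
abbreviation "rc \<equiv> residue_class F"
abbreviation "fc G H \<equiv> frac_class Q (rc G) (rc H)"
abbreviation "\<R> \<equiv> (ring_of_type_algebra :: ('n, 'k) mpoly ring)"

lemma genideal_eq: "genideal \<R> {F} = {G. F dvd G}"
proof -
  interpret R: cring \<R> by (rule cring_from_type_algebra)
  have "genideal \<R> {F} = cgenideal \<R> F"
    using R.cgenideal_eq_genideal[of F] by simp
  also have "\<dots> = {G. F dvd G}"
    by (auto simp: cgenideal_def ring_of_type_algebra_def dvd_def mult.commute)
  finally show ?thesis .
qed

lemma ideal_F: "ideal (genideal \<R> {F}) \<R>"
proof -
  interpret R: ring \<R> by (rule ring_from_type_algebra)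
  show ?thesis by (rule R.genideal_ideal) simp
qed

lemma rc_eq: "rc G = {H. F dvd H - G}"
proof -
  have "rc G = {H. \<exists>A. F dvd A \<and> H = A + G}"
    unfolding residue_class_def genideal_eq
    by (auto simp: a_r_coset_def r_coset_def ring_of_type_algebra_def)
  also have "\<dots> = {H. F dvd H - G}"
    by (auto intro: exI[of _ "_ - G"])
  finally show ?thesis .
qed

lemma rc_eq_iff: "rc G = rc H \<longleftrightarrow> \<phi> G = \<phi> H"
proof -
  have "F dvd G - H" if "rc G = rc H"
  proof -
    have "G \<in> rc G" by (simp add: rc_eq)
    hence "G \<in> rc H" using that by simp
    thus ?thesis by (simp add: rc_eq)
  qed
  moreover have "rc G = rc H" if "F dvd G - H"
    using that unfolding rc_eq
    by (smt (verit) Collect_cong diff_add_cancel dvd_add_left_iff add_diff_eq diff_diff_eq2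
      dvd_diff_commute)
  ultimately show ?thesis using ker[of "G - H"] hom by (auto simp: rhom_diff)
qed

lemma Q_carrier: "carrier Q = range rc"
proof -
  have "carrier Q = (\<Union>a\<in>carrier \<R>. {genideal \<R> {F} +>\<^bsub>\<R>\<^esub> a})"
    unfolding hom_coord_ring_def FactRing_def A_RCOSETS_def RCOSETS_def a_r_coset_def by simp
  thus ?thesis unfolding residue_class_def by auto
qed

lemma Q_mult: "rc G \<otimes>\<^bsub>Q\<^esub> rc H = rc (G * H)"
  and Q_add: "rc G \<oplus>\<^bsub>Q\<^esub> rc H = rc (G + H)"
  and Q_one: "\<one>\<^bsub>Q\<^esub> = rc 1"
  using ring_hom_mult[OF ideal.rcos_ring_hom[OF ideal_F], of G H]
    ring_hom_add[OF ideal.rcos_ring_hom[OF ideal_F], of G H]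
    ring_hom_one[OF ideal.rcos_ring_hom[OF ideal_F]]
  by (simp_all add: residue_class_def hom_coord_ring_def)
    (simp_all add: ring_of_type_algebra_def)

lemma Q_zero: "\<zero>\<^bsub>Q\<^esub> = rc 0"
  unfolding rc_eq by (simp add: hom_coord_ring_def FactRing_def genideal_eq)

lemma mem_fc_iff:
  assumes "\<phi> H \<noteq> 0"
  shows "u \<in> fc G H \<longleftrightarrow> (\<exists>G' H'. u = (rc G', rc H') \<and> \<phi> H' \<noteq> 0 \<and> \<phi> G * \<phi> H' = \<phi> G' * \<phi> H)"
proof -
  have "u \<in> fc G H \<longleftrightarrow> (\<exists>G' H'. u = (rc G', rc H') \<and> ((rc G, rc H), (rc G', rc H')) \<in> frac_rel Q)"
  proof -
    obtain a b where u: "u = (a, b)" by (cases u)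
    have "u \<in> fc G H \<longleftrightarrow> ((rc G, rc H), (a, b)) \<in> frac_rel Q"
      by (simp add: frac_class_def u)
    moreover have "\<exists>G' H'. a = rc G' \<and> b = rc H'" if "((rc G, rc H), (a, b)) \<in> frac_rel Q"
      using that unfolding frac_rel_iff Q_carrier by blast
    ultimately show ?thesis unfolding u prod.inject by metis
  qed
  also have "\<dots> \<longleftrightarrow> (\<exists>G' H'. u = (rc G', rc H') \<and> \<phi> H' \<noteq> 0 \<and> \<phi> G * \<phi> H' = \<phi> G' * \<phi> H)"
    using assms by (simp add: frac_rel_iff Q_carrier Q_zero Q_mult rc_eq_iff rhom_0[OF hom] rhom_mult[OF hom])
  finally show ?thesis .
qed

lemma fc_self: "\<phi> H \<noteq> 0 \<Longrightarrow> (rc G, rc H) \<in> fc G H"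
  by (subst mem_fc_iff) auto

lemma fc_eq_iff:
  assumes "\<phi> H \<noteq> 0" "\<phi> H' \<noteq> 0"
  shows "fc G H = fc G' H' \<longleftrightarrow> \<phi> G / \<phi> H = \<phi> G' / \<phi> H'"
proof
  assume "fc G H = fc G' H'"
  hence "(rc G, rc H) \<in> fc G' H'" using fc_self[OF assms(1)] by auto
  then obtain A B where "rc G = rc A" "rc H = rc B" "\<phi> G' * \<phi> B = \<phi> A * \<phi> H'"
    unfolding mem_fc_iff[OF assms(2)] by auto
  thus "\<phi> G / \<phi> H = \<phi> G' / \<phi> H'" using assms by (simp add: rc_eq_iff field_simps)
next
  assume e: "\<phi> G / \<phi> H = \<phi> G' / \<phi> H'"
  have "(\<phi> G * b = a * \<phi> H) \<longleftrightarrow> (\<phi> G' * b = a * \<phi> H')" if "b \<noteq> 0" for a b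
  proof -
    have "(\<phi> G * b = a * \<phi> H) \<longleftrightarrow> \<phi> G / \<phi> H = a / b"
      using assms that by (auto simp: field_simps)
    also have "\<dots> \<longleftrightarrow> \<phi> G' / \<phi> H' = a / b" by (simp only: e)
    also have "\<dots> \<longleftrightarrow> (\<phi> G' * b = a * \<phi> H')"
      using assms that by (auto simp: field_simps)
    finally show ?thesis .
  qed
  note * = this
  show "fc G H = fc G' H'"
    unfolding set_eq_iff mem_fc_iff[OF assms(1)] mem_fc_iff[OF assms(2)] using * by blast
qed

lemma L_carrier: "carrier L = {fc G H | G H. \<phi> H \<noteq> 0}"
proof -
  have *: "(\<exists>b\<in>range rc - {rc 0}. Y b) \<longleftrightarrow> (\<exists>H. \<phi> H \<noteq> 0 \<and> Y (rc H))" for Y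
    by (simp add: Bex_def image_iff rc_eq_iff[of _ 0] rhom_0[OF hom]) (metis rc_eq_iff rhom_0[OF hom])
  have "(U \<in> carrier L) = (\<exists>x\<in>range rc. \<exists>y\<in>range rc - {rc 0}. U = frac_class Q x y)" for U
    by (simp add: frac_field_def quotient_def frac_class_def Q_carrier Q_zero)
  hence "(U \<in> carrier L) = (\<exists>G H. \<phi> H \<noteq> 0 \<and> U = fc G H)" for U
    by (simp add: *)
  thus ?thesis by blast
qed

lemma \<phi>_nz: "\<phi> H \<noteq> 0 \<Longrightarrow> \<phi> H' \<noteq> 0 \<Longrightarrow> \<phi> (H * H') \<noteq> 0"
  using hom by (simp add: rhom_mult)

lemma L_mult:
  assumes "\<phi> H \<noteq> 0" "\<phi> H' \<noteq> 0"
  shows "fc G H \<otimes>\<^bsub>L\<^esub> fc G' H' = fc (G * G') (H * H')"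
proof -
  have *: "frac_class Q (fst u \<otimes>\<^bsub>Q\<^esub> fst v) (snd u \<otimes>\<^bsub>Q\<^esub> snd v) = fc (G * G') (H * H')"
    if m: "u \<in> fc G H" "v \<in> fc G' H'" for u v
  proof -
    obtain A B A' B' where 1: "u = (rc A, rc B)" "v = (rc A', rc B')" "\<phi> B \<noteq> 0" "\<phi> B' \<noteq> 0"
      "\<phi> G * \<phi> B = \<phi> A * \<phi> H" "\<phi> G' * \<phi> B' = \<phi> A' * \<phi> H'"
      using m(1)[unfolded mem_fc_iff[OF assms(1)]] m(2)[unfolded mem_fc_iff[OF assms(2)]] by blast
    hence "\<phi> G / \<phi> H = \<phi> A / \<phi> B" "\<phi> G' / \<phi> H' = \<phi> A' / \<phi> B'"
      using assms by (auto simp: field_simps)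
    hence "fc (A * A') (B * B') = fc (G * G') (H * H')"
      by (subst fc_eq_iff[OF \<phi>_nz[OF 1(3,4)] \<phi>_nz[OF assms]])
        (simp only: rhom_mult[OF hom] times_divide_times_eq[symmetric])
    thus ?thesis by (simp add: 1 Q_mult)
  qed
  have "fc G H \<otimes>\<^bsub>L\<^esub> fc G' H' = (\<Union>u\<in>fc G H. \<Union>v\<in>fc G' H'. fc (G * G') (H * H'))"
    using * by (simp add: frac_field_def)
  thus ?thesis using fc_self[OF assms(1)] fc_self[OF assms(2)] by auto
qed

lemma L_add:
  assumes "\<phi> H \<noteq> 0" "\<phi> H' \<noteq> 0"
  shows "fc G H \<oplus>\<^bsub>L\<^esub> fc G' H' = fc (G * H' + G' * H) (H * H')"
proof -
  have *: "frac_class Q ((fst u \<otimes>\<^bsub>Q\<^esub> snd v) \<oplus>\<^bsub>Q\<^esub> (fst v \<otimes>\<^bsub>Q\<^esub> snd u)) (snd u \<otimes>\<^bsub>Q\<^esub> snd v)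
      = fc (G * H' + G' * H) (H * H')"
    if m: "u \<in> fc G H" "v \<in> fc G' H'" for u v
  proof -
    obtain A B A' B' where 1: "u = (rc A, rc B)" "v = (rc A', rc B')" "\<phi> B \<noteq> 0" "\<phi> B' \<noteq> 0"
      "\<phi> G * \<phi> B = \<phi> A * \<phi> H" "\<phi> G' * \<phi> B' = \<phi> A' * \<phi> H'"
      using m(1)[unfolded mem_fc_iff[OF assms(1)]] m(2)[unfolded mem_fc_iff[OF assms(2)]] by blast
    hence "\<phi> G / \<phi> H = \<phi> A / \<phi> B" "\<phi> G' / \<phi> H' = \<phi> A' / \<phi> B'"
      using assms by (auto simp: field_simps)
    hence "\<phi> A / \<phi> B + \<phi> A' / \<phi> B' = \<phi> G / \<phi> H + \<phi> G' / \<phi> H'" by simp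
    hence "fc (A * B' + A' * B) (B * B') = fc (G * H' + G' * H) (H * H')"
      by (subst fc_eq_iff[OF \<phi>_nz[OF 1(3,4)] \<phi>_nz[OF assms]])
        (simp only: rhom_mult[OF hom] rhom_add[OF hom] add_frac_eq[OF 1(3,4)] add_frac_eq[OF assms])
    thus ?thesis by (simp add: 1 Q_mult Q_add)
  qed
  have "fc G H \<oplus>\<^bsub>L\<^esub> fc G' H' = (\<Union>u\<in>fc G H. \<Union>v\<in>fc G' H'. fc (G * H' + G' * H) (H * H'))"
    using * by (simp add: frac_field_def)
  thus ?thesis using fc_self[OF assms(1)] fc_self[OF assms(2)] by auto
qed

lemma L_one: "\<one>\<^bsub>L\<^esub> = fc 1 1" and L_zero: "\<zero>\<^bsub>L\<^esub> = fc 0 1"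
  by (simp_all add: frac_field_def Q_one Q_zero)

text \<open>The induced embedding of the field of fractions: a fraction of residue classes of \<open>G\<close> and \<open>H\<close> goes to
\<open>\<phi> G / \<phi> H\<close>, whatever representatives are used.\<close>

definition \<Psi> :: "(('n, 'k) mpoly set \<times> ('n, 'k) mpoly set) set \<Rightarrow> 'q" where
  "\<Psi> U = (THE q. \<exists>G H. \<phi> H \<noteq> 0 \<and> U = fc G H \<and> q = \<phi> G / \<phi> H)"

lemma \<Psi>_fc: "\<phi> H \<noteq> 0 \<Longrightarrow> \<Psi> (fc G H) = \<phi> G / \<phi> H"
  unfolding \<Psi>_def by (rule the_equality) (auto simp: fc_eq_iff)

lemma L_cases:
  assumes "U \<in> carrier L"
  obtains G H where "\<phi> H \<noteq> 0" "U = fc G H"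
  using assms by (auto simp: L_carrier)

lemma \<Psi>_eq_iff: "U \<in> carrier L \<Longrightarrow> V \<in> carrier L \<Longrightarrow> \<Psi> U = \<Psi> V \<longleftrightarrow> U = V"
  by (elim L_cases) (simp add: \<Psi>_fc fc_eq_iff)

lemma \<phi>1: "\<phi> 1 = 1" and \<phi>0: "\<phi> 0 = 0"
  using hom by (auto simp: rhom_simps)

lemma \<Psi>_mult: "U \<in> carrier L \<Longrightarrow> V \<in> carrier L \<Longrightarrow> U \<otimes>\<^bsub>L\<^esub> V \<in> carrier L \<and> \<Psi> (U \<otimes>\<^bsub>L\<^esub> V) = \<Psi> U * \<Psi> V"
  and \<Psi>_add: "U \<in> carrier L \<Longrightarrow> V \<in> carrier L \<Longrightarrow> U \<oplus>\<^bsub>L\<^esub> V \<in> carrier L \<and> \<Psi> (U \<oplus>\<^bsub>L\<^esub> V) = \<Psi> U + \<Psi> V"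
  and \<Psi>_one: "\<one>\<^bsub>L\<^esub> \<in> carrier L \<and> \<Psi> \<one>\<^bsub>L\<^esub> = 1"
  and \<Psi>_zero: "\<zero>\<^bsub>L\<^esub> \<in> carrier L \<and> \<Psi> \<zero>\<^bsub>L\<^esub> = 0"
proof -
  have c: "fc G H \<in> carrier L" if "\<phi> H \<noteq> 0" for G H using that by (auto simp: L_carrier)
  show "U \<otimes>\<^bsub>L\<^esub> V \<in> carrier L \<and> \<Psi> (U \<otimes>\<^bsub>L\<^esub> V) = \<Psi> U * \<Psi> V" if "U \<in> carrier L" "V \<in> carrier L"
    using that by (auto elim!: L_cases simp: L_mult \<Psi>_fc c \<phi>_nz rhom_mult[OF hom])
  show "U \<oplus>\<^bsub>L\<^esub> V \<in> carrier L \<and> \<Psi> (U \<oplus>\<^bsub>L\<^esub> V) = \<Psi> U + \<Psi> V" if "U \<in> carrier L" "V \<in> carrier L"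
    using that by (auto elim!: L_cases simp: L_add \<Psi>_fc c \<phi>_nz rhom_mult[OF hom] rhom_add[OF hom] add_frac_eq)
  show "\<one>\<^bsub>L\<^esub> \<in> carrier L \<and> \<Psi> \<one>\<^bsub>L\<^esub> = 1" "\<zero>\<^bsub>L\<^esub> \<in> carrier L \<and> \<Psi> \<zero>\<^bsub>L\<^esub> = 0"
    by (auto simp: L_one L_zero \<Psi>_fc c \<phi>1 \<phi>0)
qed

lemmas \<Psi>_ops = \<Psi>_mult[THEN conjunct1] \<Psi>_mult[THEN conjunct2] \<Psi>_add[THEN conjunct1]
  \<Psi>_add[THEN conjunct2] \<Psi>_one[THEN conjunct1] \<Psi>_one[THEN conjunct2]
  \<Psi>_zero[THEN conjunct1] \<Psi>_zero[THEN conjunct2]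

lemma ring_L: "ring L"
proof (rule ringI)
  have neg: "\<exists>V\<in>carrier L. V \<oplus>\<^bsub>L\<^esub> U = \<zero>\<^bsub>L\<^esub>" if "U \<in> carrier L" for U
  proof -
    obtain G H where 1: "\<phi> H \<noteq> 0" "U = fc G H" using \<open>U \<in> carrier L\<close> by (rule L_cases)
    have c: "fc (- G) H \<in> carrier L" using 1 by (auto simp: L_carrier)
    have "\<Psi> (fc (- G) H \<oplus>\<^bsub>L\<^esub> U) = 0"
      using 1 c that by (simp add: \<Psi>_ops \<Psi>_fc rhom_minus[OF hom])
    hence "fc (- G) H \<oplus>\<^bsub>L\<^esub> U = \<zero>\<^bsub>L\<^esub>"
      using c that by (subst \<Psi>_eq_iff[symmetric]) (auto simp: \<Psi>_ops)
    thus ?thesis using c by blast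
  qed
  show "abelian_group L"
    by (rule abelian_groupI; (rule neg | subst \<Psi>_eq_iff[symmetric])?)
      (auto simp: \<Psi>_ops algebra_simps)
  show "monoid L"
    by (rule monoidI; (subst \<Psi>_eq_iff[symmetric])?) (auto simp: \<Psi>_ops algebra_simps)
qed (auto simp: \<Psi>_ops algebra_simps \<Psi>_eq_iff[symmetric])

lemma L_inv:
  assumes "U \<in> carrier L" "\<Psi> U \<noteq> 0"
  shows "inv\<^bsub>L\<^esub> U \<in> carrier L \<and> \<Psi> (inv\<^bsub>L\<^esub> U) = inverse (\<Psi> U)"
proof -
  interpret L: ring L by (rule ring_L)
  obtain G H where 1: "\<phi> H \<noteq> 0" "U = fc G H" using \<open>U \<in> carrier L\<close> by (rule L_cases)
  hence G: "\<phi> G \<noteq> 0" using assms by (auto simp: \<Psi>_fc)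
  have c: "fc H G \<in> carrier L" using G by (auto simp: L_carrier)
  have "\<Psi> (U \<otimes>\<^bsub>L\<^esub> fc H G) = \<Psi> \<one>\<^bsub>L\<^esub>" "\<Psi> (fc H G \<otimes>\<^bsub>L\<^esub> U) = \<Psi> \<one>\<^bsub>L\<^esub>"
    using 1 G c assms by (auto simp: \<Psi>_ops \<Psi>_fc)
  hence e: "U \<otimes>\<^bsub>L\<^esub> fc H G = \<one>\<^bsub>L\<^esub>" "fc H G \<otimes>\<^bsub>L\<^esub> U = \<one>\<^bsub>L\<^esub>"
    using \<Psi>_eq_iff[OF \<Psi>_ops(1)[OF assms(1) c] \<Psi>_ops(5)]
      \<Psi>_eq_iff[OF \<Psi>_ops(1)[OF c assms(1)] \<Psi>_ops(5)] by blast+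
  have "inv\<^bsub>L\<^esub> U = fc H G"
    by (rule L.inv_char[OF assms(1) c e])
  thus ?thesis using c 1 G by (simp add: \<Psi>_fc)
qed

lemma \<Psi>_pow:
  assumes "U \<in> carrier L"
  shows "U [^]\<^bsub>L\<^esub> (n::nat) \<in> carrier L \<and> \<Psi> (U [^]\<^bsub>L\<^esub> n) = \<Psi> U ^ n"
proof -
  interpret L: ring L by (rule ring_L)
  show ?thesis using assms by (induction n) (auto simp: \<Psi>_ops)
qed

lemma \<Psi>_eval:
  assumes "U \<in> carrier L" "set p \<subseteq> carrier L"
  shows "ring.eval L p U \<in> carrier L \<and> \<Psi> (ring.eval L p U) = list_eval (map \<Psi> p) (\<Psi> U)"
proof -
  interpret L: ring L by (rule ring_L)
  show ?thesis using assms(2)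
    by (induction p) (use assms(1) in \<open>auto simp: \<Psi>_ops \<Psi>_pow\<close>)
qed

text \<open>All questions about the record structure \<open>L\<close> are transported to the target field along the injective
map \<open>\<Psi>\<close>; in particular integral equations become ordinary polynomial equations.\<close>

lemma integral_over_iff:
  assumes "A \<subseteq> carrier L" "U \<in> carrier L"
  shows "integral_over L A U \<longleftrightarrow>
    (\<exists>cs. set cs \<subseteq> A \<and> cs \<noteq> [] \<and> hd cs = \<one>\<^bsub>L\<^esub> \<and> list_eval (map \<Psi> cs) (\<Psi> U) = 0)"
proof -
  interpret L: ring L by (rule ring_L)
  have ne: "\<one>\<^bsub>L\<^esub> \<noteq> \<zero>\<^bsub>L\<^esub>" using \<Psi>_one \<Psi>_zero by force
  have *: "ring.eval L cs U = \<zero>\<^bsub>L\<^esub> \<longleftrightarrow> list_eval (map \<Psi> cs) (\<Psi> U) = 0" if "set cs \<subseteq> A" for cs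
    using \<Psi>_eval[of U cs] that assms \<Psi>_eq_iff[of "ring.eval L cs U" "\<zero>\<^bsub>L\<^esub>"] by (auto simp: \<Psi>_ops)
  show ?thesis
    unfolding integral_over_def Polynomials.polynomial_def by (rule ex_cong1) (use ne * in force)
qed

end

section \<open>Homogeneous components\<close>

text \<open>The grading is encoded in a homomorphism: substituting \<open>t\<^sub>i X\<close> for \<open>t\<^sub>i\<close> turns the component of degree
\<open>e\<close> into the coefficient of \<open>X\<^sup>e\<close>. Multiplicativity of this map replaces computations with monomials.\<close>

definition hom_split :: "('n::finite, 'k::comm_ring_1) mpoly \<Rightarrow> ('n, 'k) mpoly poly" where
  "hom_split = meval (\<lambda>c. [:Const c:]) (\<lambda>i. Polynomial.monom (mvar i) 1)"

lemma rhom_hom_split: "rhom hom_split"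
  unfolding hom_split_def by (intro rhom_meval rhom_comp[OF rhom_poly_const rhom_Const])

abbreviation mdeg :: "('n::finite \<Rightarrow>\<^sub>0 nat) \<Rightarrow> nat" where
  "mdeg m \<equiv> (\<Sum>i\<in>UNIV. Poly_Mapping.lookup m i)"

lemma hom_split_single:
  "hom_split (Poly_Mapping.single m c) = Polynomial.monom (Poly_Mapping.single m c) (mdeg m)"
proof -
  have p: "(\<Prod>i\<in>A. Polynomial.monom (v i) (e i)) = Polynomial.monom (\<Prod>i\<in>A. v i) (\<Sum>i\<in>A. e i)"
    for A :: "'n set" and v :: "'n \<Rightarrow> ('n, 'k::comm_ring_1) mpoly" and e
    by (induction A rule: infinite_finite_induct) (auto simp: mult_monom one_poly_eq_simps)
  have "hom_split (Poly_Mapping.single m c)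
      = [:Const c:] * (\<Prod>i\<in>UNIV. Polynomial.monom (mvar i) 1 ^ Poly_Mapping.lookup m i)"
    unfolding hom_split_def by (rule meval_single) simp
  also have "\<dots> = Polynomial.monom (Const c * (\<Prod>i\<in>UNIV. mvar i ^ Poly_Mapping.lookup m i)) (mdeg m)"
    by (simp add: monom_power p smult_monom)
  finally show ?thesis by (simp only: single_eq_prod[symmetric])
qed

lemma hom_split_eq_sum:
  "hom_split G = (\<Sum>m\<in>Poly_Mapping.keys G.
     Polynomial.monom (Poly_Mapping.single m (Poly_Mapping.lookup G m)) (mdeg m))"
proof -
  have "hom_split G = hom_split (\<Sum>m\<in>Poly_Mapping.keys G. Poly_Mapping.single m (Poly_Mapping.lookup G m))"
    by (simp add: mpoly_sum_terms)
  also have "\<dots> = (\<Sum>m\<in>Poly_Mapping.keys G.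
     Polynomial.monom (Poly_Mapping.single m (Poly_Mapping.lookup G m)) (mdeg m))"
    by (simp add: rhom_sum[OF rhom_hom_split] hom_split_single)
  finally show ?thesis .
qed

lemma hom_split_homogeneous:
  fixes G :: "('a::finite, 'b::comm_ring_1) mpoly"
  assumes "homogeneous d G"
  shows "hom_split G = Polynomial.monom G d"
proof -
  have msum: "Polynomial.monom (\<Sum>m\<in>A. g m) d = (\<Sum>m\<in>A. Polynomial.monom (g m) d)"
    for A :: "('a \<Rightarrow>\<^sub>0 nat) set" and g :: "_ \<Rightarrow> ('a, 'b) mpoly"
    by (rule poly_eqI) (simp add: coeff_sum)
  have "hom_split G = (\<Sum>m\<in>Poly_Mapping.keys G.
     Polynomial.monom (Poly_Mapping.single m (Poly_Mapping.lookup G m)) d)"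
    unfolding hom_split_eq_sum using assms by (intro sum.cong) (auto simp: homogeneous_def)
  also have "\<dots> = Polynomial.monom G d"
    by (subst (2) mpoly_sum_terms[symmetric]) (simp add: msum)
  finally show ?thesis .
qed

lemma homogeneous_coeff_hom_split: "homogeneous e (Polynomial.coeff (hom_split G) e)"
proof -
  have comp: "Polynomial.coeff (hom_split G) e = (\<Sum>m\<in>Poly_Mapping.keys G.
      if mdeg m = e then Poly_Mapping.single m (Poly_Mapping.lookup G m) else 0)"
    unfolding hom_split_eq_sum by (simp add: coeff_sum if_distrib cong: if_cong)
  have "Poly_Mapping.lookup (Polynomial.coeff (hom_split G) e) m
      = (\<Sum>m'\<in>Poly_Mapping.keys G. if m' = m then (if mdeg m = e then Poly_Mapping.lookup G m else 0) else 0)"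
    for m
    unfolding comp lookup_sum by (rule sum.cong) (auto simp: lookup_single when_def)
  hence *: "Poly_Mapping.lookup (Polynomial.coeff (hom_split G) e) m
      = (if mdeg m = e then Poly_Mapping.lookup G m else 0)" for m
    by (simp add: in_keys_iff)
  show ?thesis by (auto simp: homogeneous_def in_keys_iff * split: if_splits)
qed

lemma homogeneous_iff_hom_split: "homogeneous d G \<longleftrightarrow> hom_split G = Polynomial.monom G d"
  using homogeneous_coeff_hom_split[of d G] hom_split_homogeneous by (metis coeff_monom)

lemma sum_hom_split:
  fixes G :: "('a::finite, 'b::comm_ring_1) mpoly"
  shows "poly (hom_split G) 1 = G"
proof -
  have "rhom (\<lambda>G. poly (hom_split G) 1 :: ('a, 'b) mpoly)"
    using rhom_hom_split[where 'a='a and 'b='b]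
    by (auto simp: rhom_def)
  thus ?thesis
    by (rule rhom_mpoly_eqI[OF _ rhom_id])
      (simp_all add: hom_split_def meval_Const meval_mvar rhom_comp[OF rhom_poly_const rhom_Const] poly_monom)
qed

lemma homogeneous_mult:
  "homogeneous d G \<Longrightarrow> homogeneous e H \<Longrightarrow> homogeneous (d + e) (G * H)"
  by (simp add: homogeneous_iff_hom_split rhom_mult[OF rhom_hom_split] mult_monom)

lemma homogeneous_add:
  "homogeneous d G \<Longrightarrow> homogeneous d H \<Longrightarrow> homogeneous d (G + H)"
  by (simp add: homogeneous_iff_hom_split rhom_add[OF rhom_hom_split] add_monom)

lemma homogeneous_mvar: "homogeneous 1 (mvar i)"
  by (simp add: homogeneous_iff_hom_split hom_split_def meval_mvar rhom_comp[OF rhom_poly_const rhom_Const])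

lemma homogeneous_Const: "homogeneous 0 (Const c)"
  by (simp add: homogeneous_iff_hom_split hom_split_def meval_Const monom_0 rhom_comp[OF rhom_poly_const rhom_Const])

lemma homogeneous_power: "homogeneous d G \<Longrightarrow> homogeneous (k * d) (G ^ k)"
  using homogeneous_Const[of 1] by (induction k) (auto intro: homogeneous_mult)

text \<open>Compare the coefficients of \<open>X\<^sup>d\<^sup>+\<^sup>e\<close> in the image of \<open>G h - H g = F Q\<close> under \<open>hom_split\<close>. The
lemma replaces a fraction \<open>g/h\<close> that equals a homogeneous fraction of degree zero by a quotient of
components of \<open>g\<close> and \<open>h\<close> of equal degree.\<close>

lemma homogeneous_dvd_component:
  assumes "homogeneous c F" "homogeneous d G" "homogeneous d H" "F dvd G * h - H * g"
  shows "F dvd G * Polynomial.coeff (hom_split h) e - H * Polynomial.coeff (hom_split g) e"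
proof -
  obtain Q where Q: "G * h - H * g = F * Q" using assms(4) by (auto simp: dvd_def)
  have "hom_split G * hom_split h - hom_split H * hom_split g = hom_split F * hom_split Q"
    using arg_cong[OF Q, of hom_split]
    by (simp add: rhom_mult[OF rhom_hom_split] rhom_diff[OF rhom_hom_split])
  hence "Polynomial.monom G d * hom_split h - Polynomial.monom H d * hom_split g = Polynomial.monom F c * hom_split Q"
    using assms by (simp add: hom_split_homogeneous)
  from arg_cong[OF this, of "\<lambda>p. Polynomial.coeff p (d + e)"]
  have "G * Polynomial.coeff (hom_split h) e - H * Polynomial.coeff (hom_split g) e
      = (if c \<le> d + e then F * Polynomial.coeff (hom_split Q) (d + e - c) else 0)"
    by (simp add: coeff_monom_mult)
  thus ?thesis by (auto split: if_splits)
qed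

lemma homogeneous_dvd_lower_degree:
  assumes "homogeneous c F" "homogeneous d G" "d < c" "F dvd G"
  shows "G = 0"
proof -
  obtain Q where "G = F * Q" using assms(4) by (auto simp: dvd_def)
  hence "Polynomial.monom G d = Polynomial.monom F c * hom_split Q"
    using assms by (simp add: hom_split_homogeneous[symmetric] rhom_mult[OF rhom_hom_split])
  from arg_cong[OF this, of "\<lambda>p. Polynomial.coeff p d"] show ?thesis
    using assms(3) by (simp add: coeff_monom_mult)
qed

lemma exists_component_nonzero:
  assumes "mpoly_eval x G \<noteq> 0"
  obtains e where "mpoly_eval x (Polynomial.coeff (hom_split G) e) \<noteq> 0"
proof -
  have "mpoly_eval x G = mpoly_eval x (\<Sum>e\<le>Polynomial.degree (hom_split G). Polynomial.coeff (hom_split G) e)"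
    using sum_hom_split[of G] by (simp add: poly_altdef)
  also have "\<dots> = (\<Sum>e\<le>Polynomial.degree (hom_split G). mpoly_eval x (Polynomial.coeff (hom_split G) e))"
    by (rule rhom_sum[OF rhom_mpoly_eval])
  finally show ?thesis using assms that by (metis sum.neutral)
qed

lemma to_fract_power: "to_fract (x ^ n) = to_fract x ^ n"
  by (rule rhom_power[OF rhom_to_fract])

section \<open>Normality where the equation can be solved for a variable\<close>

text \<open>Write \<open>z = g/h\<close> in lowest terms. Clearing denominators in the integral equation shows that \<open>h\<close>
divides \<open>b g\<^sup>n\<close> for some \<open>b\<close> that is invertible in the localisation. Since \<open>h\<close> is coprime to \<open>g\<close> it
divides \<open>b\<close>, so \<open>h\<close> is invertible in the localisation as well. The localisation consists of the
fractions whose denominator is not killed by \<open>e\<close>; in the application \<open>e\<close> evaluates at a point.\<close>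

lemma gcd_domain_localization_integrally_closed:
  fixes e :: "'t::{factorial_ring_gcd, semiring_gcd_mult_normalize} \<Rightarrow> 'k::field"
  defines "A \<equiv> {to_fract a / to_fract b | a b. e b \<noteq> 0}"
  assumes e: "rhom e" and cs: "set cs \<subseteq> A" "cs \<noteq> []" "hd cs = 1" "list_eval cs z = 0"
  shows "z \<in> A"
proof -
  have nz: "b \<noteq> 0" if "e b \<noteq> 0" for b using that rhom_0[OF e] by auto
  obtain u v where uv: "z = to_fract u / to_fract v" "v \<noteq> 0"
    by (cases z) (auto simp: Fract_conv_to_fract)
  obtain g h where gh: "u = gcd u v * g" "v = gcd u v * h" "coprime g h"
    using uv(2) by (metis gcd_coprime_exists gcd_eq_0_iff mult.commute)
  have h: "h \<noteq> 0" using gh uv by auto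
  have z: "z = to_fract g / to_fract h"
  proof -
    have "gcd u v \<noteq> 0" using uv by simp
    hence g0: "to_fract (gcd u v) \<noteq> 0" by simp
    have "z = to_fract (gcd u v * g) / to_fract (gcd u v * h)"
      using uv(1) gh(1,2) by simp
    thus ?thesis using g0 by (simp add: to_fract_mult del: to_fract_eq_0_iff)
  qed
  \<comment> \<open>the tail of the equation, multiplied by a suitable denominator \<open>b h\<^sup>k\<close>, is a multiple of \<open>h\<close>\<close>
  have clear: "\<exists>b r. e b \<noteq> 0 \<and> to_fract b * list_eval ds z * to_fract h ^ length ds = to_fract (h * r)"
    if "set ds \<subseteq> A" for ds
    using that
  proof (induction ds)
    case Nil
    show ?case by (rule exI[of _ 1], rule exI[of _ 0]) (simp add: rhom_1[OF e])
  next
    case (Cons c ds)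
    then obtain b r where 1: "e b \<noteq> 0"
      "to_fract b * list_eval ds z * to_fract h ^ length ds = to_fract (h * r)" by auto
    obtain a b' where 2: "c = to_fract a / to_fract b'" "e b' \<noteq> 0" using Cons.prems by (auto simp: A_def)
    have b': "to_fract b' \<noteq> 0" using nz[OF 2(2)] by simp
    have zh: "z ^ n * to_fract h ^ n = to_fract (g ^ n)" for n
      using h by (simp add: z power_divide to_fract_power)
    have "to_fract (b * b') * list_eval (c # ds) z * to_fract h ^ length (c # ds)
      = to_fract b * (to_fract b' * c) * (z ^ length ds * to_fract h ^ length ds) * to_fract h
        + to_fract b' * (to_fract b * list_eval ds z * to_fract h ^ length ds) * to_fract h"
      by (simp add: to_fract_mult algebra_simps)
    also have "\<dots> = to_fract (h * (b * a * g ^ length ds + b' * (h * r)))"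
      unfolding 1(2) zh using 2 b' by (simp add: to_fract_mult to_fract_add algebra_simps)
    finally have "to_fract (b * b') * list_eval (c # ds) z * to_fract h ^ length (c # ds)
      = to_fract (h * (b * a * g ^ length ds + b' * (h * r)))" .
    moreover have "e (b * b') \<noteq> 0" using 1 2 by (simp add: rhom_mult[OF e])
    ultimately show ?case by blast
  qed
  obtain ds where ds: "cs = 1 # ds" using cs by (cases cs) auto
  obtain b r where br: "e b \<noteq> 0"
    "to_fract b * list_eval ds z * to_fract h ^ length ds = to_fract (h * r)"
    using clear[of ds] cs ds by auto
  have "list_eval ds z = - (z ^ length ds)" using cs(4) ds by (simp add: add_eq_0_iff)
  hence "to_fract (h * r) = - (to_fract b * (z ^ length ds * to_fract h ^ length ds))"
    using br(2) by (simp add: mult.assoc)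
  also have "z ^ length ds * to_fract h ^ length ds = to_fract (g ^ length ds)"
    using h by (simp add: z power_divide to_fract_power)
  finally have "to_fract (h * r) = to_fract (- (b * g ^ length ds))"
    by (simp add: to_fract_mult to_fract_uminus)
  hence "h * r = - (b * g ^ length ds)" by (simp only: to_fract_eq_iff)
  hence "h dvd b * g ^ length ds" by (metis dvd_minus_iff dvd_triv_left)
  moreover have "coprime h (g ^ length ds)" using gh(3) by (simp add: coprime_commute)
  ultimately have "h dvd b" by (simp add: coprime_dvd_mult_left_iff)
  hence "e h \<noteq> 0" using br(1) rhom_dvd[OF e, of h b] by auto
  thus ?thesis unfolding A_def z by blast
qed

text \<open>A chart describes the part of the hypersurface where \<open>\<rho> p\<close> does not vanish: there every polynomial is,
up to a power of \<open>\<rho> p\<close> and modulo \<open>F\<close>, a polynomial in the variables that come from the factorial ring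
\<open>'t\<close>. So the coordinate ring becomes a localisation of \<open>'t\<close>.\<close>

locale chart = field_embedding F \<phi>
  for F :: "('n::finite, 'k::field) mpoly"
    and \<phi> :: "('n, 'k) mpoly \<Rightarrow> 't::{factorial_ring_gcd, semiring_gcd_mult_normalize} fract" +
  fixes \<rho> :: "'t \<Rightarrow> ('n, 'k) mpoly" and p :: 't
  assumes hom_\<rho>: "rhom \<rho>" and \<phi>_\<rho>: "\<phi> (\<rho> y) = to_fract y"
    and reduce: "\<exists>N y. F dvd \<rho> p ^ N * G - \<rho> y"
begin

lemma local_ring_in_localization:
  assumes x: "mpoly_eval x F = 0" "mpoly_eval x (\<rho> p) \<noteq> 0" and H: "mpoly_eval x H \<noteq> 0"
  shows "\<exists>a b. mpoly_eval x (\<rho> b) \<noteq> 0 \<and> \<phi> G / \<phi> H = to_fract a / to_fract b"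
proof -
  note ev = rhom_simps[OF rhom_mpoly_eval[of x]]
  obtain M y where 1: "F dvd \<rho> p ^ M * G - \<rho> y" using reduce by blast
  obtain N w where 2: "F dvd \<rho> p ^ N * H - \<rho> w" using reduce by blast
  have e1: "to_fract p ^ M * \<phi> G = to_fract y"
    using 1 ker[of "\<rho> p ^ M * G - \<rho> y"] by (simp add: rhom_simps[OF hom] \<phi>_\<rho>)
  have e2: "to_fract p ^ N * \<phi> H = to_fract w"
    using 2 ker[of "\<rho> p ^ N * H - \<rho> w"] by (simp add: rhom_simps[OF hom] \<phi>_\<rho>)
  have "mpoly_eval x (\<rho> p ^ N * H - \<rho> w) = 0" using rhom_dvd[OF rhom_mpoly_eval 2, of x] x by simp
  hence w: "mpoly_eval x (\<rho> w) = mpoly_eval x (\<rho> p) ^ N * mpoly_eval x H" by (simp add: ev)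
  have p: "to_fract p \<noteq> 0" using x(2) rhom_0[OF hom_\<rho>] ev by (metis to_fract_eq_0_iff)
  have "\<phi> G / \<phi> H = to_fract (p ^ N * y) / to_fract (p ^ M * w)"
    using p by (simp add: to_fract_mult to_fract_power e1[symmetric] e2[symmetric])
  moreover have "mpoly_eval x (\<rho> (p ^ M * w)) \<noteq> 0"
    using x H by (simp add: rhom_simps[OF hom_\<rho>] ev w)
  ultimately show ?thesis by blast
qed

text \<open>An element of the field of fractions that is integral over the local ring at \<open>x\<close> is integral over the
localisation of \<open>'t\<close> at \<open>x\<close>, hence belongs to it. It is then a quotient \<open>\<rho> g / \<rho> h\<close> with \<open>\<rho> h\<close> nonzero
at \<open>x\<close>, but not of homogeneous polynomials; a component of \<open>\<rho> h\<close> that does not vanish at \<open>x\<close>, together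
with the component of \<open>\<rho> g\<close> of the same degree, gives a representation in the local ring.\<close>

theorem normal_at_chart:
  assumes F: "homogeneous c F" and x: "mpoly_eval x F = 0" "mpoly_eval x (\<rho> p) \<noteq> 0"
  shows "normal_at F x"
proof -
  interpret L: ring L by (rule ring_L)
  note ev = rhom_simps[OF rhom_mpoly_eval[of x]]
  have nz: "\<phi> H \<noteq> 0" if "mpoly_eval x H \<noteq> 0" for H
    using that x(1) rhom_dvd[OF rhom_mpoly_eval[of x], of F H] ker[of H] by auto
  have sub: "local_ring F x \<subseteq> carrier L"
    unfolding local_ring_def L_carrier using nz by blast
  have "a \<otimes>\<^bsub>L\<^esub> inv\<^bsub>L\<^esub> b \<in> local_ring F x"
    if a: "a \<in> local_ring F x" and b: "b \<in> local_ring F x" "b \<noteq> \<zero>\<^bsub>L\<^esub>"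
      and int: "integral_over L (local_ring F x) (a \<otimes>\<^bsub>L\<^esub> inv\<^bsub>L\<^esub> b)" for a b
  proof -
    let ?z = "a \<otimes>\<^bsub>L\<^esub> inv\<^bsub>L\<^esub> b"
    obtain G1 H1 d1 where 1: "a = fc G1 H1" "homogeneous d1 G1" "homogeneous d1 H1" "mpoly_eval x H1 \<noteq> 0"
      using a by (auto simp: local_ring_def)
    obtain G2 H2 d2 where 2: "b = fc G2 H2" "homogeneous d2 G2" "homogeneous d2 H2" "mpoly_eval x H2 \<noteq> 0"
      using b by (auto simp: local_ring_def)
    have cl: "a \<in> carrier L" "b \<in> carrier L" using a b sub by auto
    have b0: "\<Psi> b \<noteq> 0" using b cl \<Psi>_eq_iff[of b "\<zero>\<^bsub>L\<^esub>"] by (auto simp: \<Psi>_ops)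
    have G2: "\<phi> G2 \<noteq> 0" using b0 2 nz by (auto simp: \<Psi>_fc)
    have zc: "?z \<in> carrier L" using cl L_inv[OF cl(2) b0] by (auto intro: \<Psi>_ops)
    have \<Psi>z: "\<Psi> ?z = \<phi> (G1 * H2) / \<phi> (H1 * G2)"
      using cl L_inv[OF cl(2) b0] 1 2 nz by (simp add: \<Psi>_ops \<Psi>_fc rhom_mult[OF hom])
    obtain cs where cs: "set cs \<subseteq> local_ring F x" "cs \<noteq> []" "hd cs = \<one>\<^bsub>L\<^esub>"
      "list_eval (map \<Psi> cs) (\<Psi> ?z) = 0"
      using int integral_over_iff[OF sub zc] by auto
    have "\<Psi> ?z \<in> {to_fract a / to_fract b | a b. mpoly_eval x (\<rho> b) \<noteq> 0}"
    proof (rule gcd_domain_localization_integrally_closed)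
      show "rhom (\<lambda>b. mpoly_eval x (\<rho> b))" by (rule rhom_comp[OF rhom_mpoly_eval hom_\<rho>])
      show "list_eval (map \<Psi> cs) (\<Psi> ?z) = 0" by (fact cs(4))
      show "hd (map \<Psi> cs) = 1" using cs by (simp add: hd_map \<Psi>_ops)
      have "\<exists>a b. mpoly_eval x (\<rho> b) \<noteq> 0 \<and> \<Psi> U = to_fract a / to_fract b" if "U \<in> local_ring F x" for U
        using that local_ring_in_localization[OF x] nz by (auto simp: local_ring_def \<Psi>_fc)
      thus "set (map \<Psi> cs) \<subseteq> {to_fract a / to_fract b | a b. mpoly_eval x (\<rho> b) \<noteq> 0}"
        using cs(1) by fastforce
    qed (use cs in auto)
    then obtain g h where gh: "mpoly_eval x (\<rho> h) \<noteq> 0" "\<Psi> ?z = to_fract g / to_fract h" by auto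
    have "\<phi> (G1 * H2) / \<phi> (H1 * G2) = \<phi> (\<rho> g) / \<phi> (\<rho> h)" using gh \<Psi>z by (simp add: \<phi>_\<rho>)
    moreover have H12: "\<phi> (H1 * G2) \<noteq> 0" using nz 1 G2 by (simp add: rhom_mult[OF hom])
    ultimately have "\<phi> ((G1 * H2) * \<rho> h - (H1 * G2) * \<rho> g) = 0"
      using nz[OF gh(1)] by (simp add: rhom_simps[OF hom] field_simps)
    hence dv: "F dvd (G1 * H2) * \<rho> h - (H1 * G2) * \<rho> g" using ker by blast
    obtain e where e: "mpoly_eval x (Polynomial.coeff (hom_split (\<rho> h)) e) \<noteq> 0"
      using exists_component_nonzero[OF gh(1)] by blast
    let ?h = "Polynomial.coeff (hom_split (\<rho> h)) e" and ?g = "Polynomial.coeff (hom_split (\<rho> g)) e"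
    have "F dvd (G1 * H2) * ?h - (H1 * G2) * ?g"
      using 1 2 by (intro homogeneous_dvd_component[OF F _ _ dv]) (auto intro: homogeneous_mult)
    hence "\<phi> (G1 * H2) * \<phi> ?h = \<phi> (H1 * G2) * \<phi> ?g"
      using ker[of "(G1 * H2) * ?h - (H1 * G2) * ?g"] by (simp add: rhom_simps[OF hom])
    hence "\<Psi> ?z = \<Psi> (fc ?g ?h)"
      unfolding \<Psi>z using H12 nz[OF e] by (simp add: \<Psi>_fc field_simps)
    moreover have "fc ?g ?h \<in> local_ring F x"
      unfolding local_ring_def using e homogeneous_coeff_hom_split by blast
    ultimately show ?thesis using \<Psi>_eq_iff[of ?z "fc ?g ?h"] zc sub by auto
  qed
  thus ?thesis unfolding normal_at_def integrally_closed_def by blast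
qed

end

section \<open>Failure of normality along the double locus\<close>

text \<open>The witness is \<open>w = A t\<^sub>i / (D t\<^sub>j)\<close>, where \<open>A\<close> is the variable \<open>t\<^sub>k\<close> that multiplies \<open>t\<^sub>i\<^sup>2\<close> and \<open>D\<close> a
variable with \<open>D(x) \<noteq> 0\<close>. Multiplying the equation by \<open>A/(D t\<^sub>j)\<^sup>2\<close> gives a monic quadratic equation for
\<open>w\<close> over the local ring. If \<open>w = G/H\<close> held with \<open>H(x) \<noteq> 0\<close>, then \<open>A t\<^sub>i H - D t\<^sub>j G\<close> would be a multiple
of \<open>F\<close>; on the slice \<open>t\<^sub>j = 0\<close> this reads \<open>A t\<^sub>i H = A t\<^sub>i\<^sup>2 R\<close>, so \<open>H = t\<^sub>i R\<close> there and \<open>H(x) = 0\<close>.\<close>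

theorem (in field_embedding) not_normal_at:
  fixes x :: "'k ^ 'n"
  assumes F_def: "F = mvar k * mvar i ^ 2 + B * mvar j ^ 2 + C * (mvar i * mvar j)"
    and ij: "i \<noteq> j" "k \<noteq> i" "k \<noteq> j" and BC: "homogeneous 1 B" "homogeneous 1 C"
    and x: "x \<noteq> 0" "x $ i = 0" "x $ j = 0"
  shows "\<not> normal_at F x"
proof
  assume norm: "normal_at F x"
  note ev = rhom_simps[OF rhom_mpoly_eval[of x]]
  obtain l where l: "x $ l \<noteq> 0" using x(1) by (auto simp: vec_eq_iff)
  let ?A = "mvar k :: ('n, 'k) mpoly" and ?D = "mvar l :: ('n, 'k) mpoly"
  have hm: "homogeneous 1 G \<Longrightarrow> homogeneous 1 H \<Longrightarrow> homogeneous 2 (G * H)" for G H :: "('n, 'k) mpoly"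
    using homogeneous_mult[of 1 G 1 H] by (simp add: numeral_2_eq_2)
  note h1 = homogeneous_mvar
  have h2: "homogeneous 2 (mvar u ^ 2 :: ('n, 'k) mpoly)" for u
    using homogeneous_power[OF homogeneous_mvar, of 2 u] by simp
  have F3: "homogeneous 3 F"
    unfolding F_def
    using homogeneous_mult[OF h1 h2] homogeneous_mult[OF BC(1) h2]
      homogeneous_mult[OF BC(2) homogeneous_mult[OF h1 h1]]
    by (intro homogeneous_add) (simp_all add: numeral_eq_Suc)
  have xF: "mpoly_eval x F = 0" by (simp add: F_def ev x)
  have nz: "\<phi> H \<noteq> 0" if "mpoly_eval x H \<noteq> 0" for H
    using that xF rhom_dvd[OF rhom_mpoly_eval[of x], of F H] ker[of H] by auto
  have var0: "mvar u \<noteq> (0 :: ('n, 'k) mpoly)" for u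
    by (simp add: mvar_def) (metis lookup_single_eq lookup_zero one_neq_zero)
  have nzv: "\<phi> (mvar u) \<noteq> 0" for u
    using homogeneous_dvd_lower_degree[OF F3 h1, of u] ker[of "mvar u"] var0 by auto
  have sub: "local_ring F x \<subseteq> carrier L"
    unfolding local_ring_def L_carrier using nz by blast
  have mem: "fc G H \<in> local_ring F x" if "homogeneous d G" "homogeneous d H" "mpoly_eval x H \<noteq> 0" for G H d
    using that unfolding local_ring_def by blast
  have D2: "mpoly_eval x (?D ^ 2) \<noteq> 0" "mpoly_eval x ?D \<noteq> 0" using l by (auto simp: ev)
  define a where "a = fc (?A * mvar i) (?D ^ 2)"
  define b where "b = fc (?D * mvar j) (?D ^ 2)"
  define c1 where "c1 = fc C ?D"
  define c2 where "c2 = fc (?A * B) (?D ^ 2)"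
  have loc: "a \<in> local_ring F x" "b \<in> local_ring F x" "c1 \<in> local_ring F x" "c2 \<in> local_ring F x"
    unfolding a_def b_def c1_def c2_def
    using mem[OF hm[OF h1 h1] h2 D2(1)] mem[OF BC(2) h1 D2(2)] mem[OF hm[OF h1 BC(1)] h2 D2(1)]
    by simp_all
  have one: "\<one>\<^bsub>L\<^esub> \<in> local_ring F x"
    unfolding L_one by (rule mem[of 0]) (use homogeneous_Const[of 1] in \<open>auto simp: ev\<close>)
  have cl: "a \<in> carrier L" "b \<in> carrier L" using loc sub by auto
  have \<Psi>a: "\<Psi> a = \<phi> ?A * \<phi> (mvar i) / \<phi> ?D ^ 2" and \<Psi>b: "\<Psi> b = \<phi> (mvar j) / \<phi> ?D"
    and \<Psi>c1: "\<Psi> c1 = \<phi> C / \<phi> ?D" and \<Psi>c2: "\<Psi> c2 = \<phi> ?A * \<phi> B / \<phi> ?D ^ 2"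
    using nz[OF D2(1)] nz[OF D2(2)] unfolding a_def b_def c1_def c2_def
    by (simp_all add: \<Psi>_fc rhom_simps[OF hom] power2_eq_square)
  have b0: "\<Psi> b \<noteq> 0" using nzv by (simp add: \<Psi>b)
  let ?z = "a \<otimes>\<^bsub>L\<^esub> inv\<^bsub>L\<^esub> b"
  have zc: "?z \<in> carrier L" using cl L_inv[OF cl(2) b0] by (auto intro: \<Psi>_ops)
  have \<Psi>z: "\<Psi> ?z = \<phi> ?A * \<phi> (mvar i) / (\<phi> ?D * \<phi> (mvar j))"
    using cl L_inv[OF cl(2) b0] nzv by (simp add: \<Psi>_ops \<Psi>a \<Psi>b power2_eq_square field_simps)
  have F0: "\<phi> ?A * \<phi> (mvar i) ^ 2 + \<phi> B * \<phi> (mvar j) ^ 2 + \<phi> C * (\<phi> (mvar i) * \<phi> (mvar j)) = 0"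
    using ker[of F] unfolding F_def by (simp add: rhom_simps[OF hom])
  have "list_eval (map \<Psi> [\<one>\<^bsub>L\<^esub>, c1, c2]) (\<Psi> ?z)
    = \<phi> ?A / (\<phi> ?D * \<phi> (mvar j)) ^ 2
      * (\<phi> ?A * \<phi> (mvar i) ^ 2 + \<phi> B * \<phi> (mvar j) ^ 2 + \<phi> C * (\<phi> (mvar i) * \<phi> (mvar j)))"
    using nzv[of l] nzv[of j] unfolding \<Psi>z by (simp add: \<Psi>_ops \<Psi>c1 \<Psi>c2 power2_eq_square field_simps)
  hence "list_eval (map \<Psi> [\<one>\<^bsub>L\<^esub>, c1, c2]) (\<Psi> ?z) = 0" by (simp only: F0 mult_zero_right)
  moreover have "set [\<one>\<^bsub>L\<^esub>, c1, c2] \<subseteq> local_ring F x" using loc one by simp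
  ultimately have "integral_over L (local_ring F x) ?z"
    unfolding integral_over_iff[OF sub zc] by (intro exI[of _ "[\<one>\<^bsub>L\<^esub>, c1, c2]"]) simp
  moreover have "b \<noteq> \<zero>\<^bsub>L\<^esub>" using b0 by (auto simp: \<Psi>_ops)
  ultimately have "?z \<in> local_ring F x"
    using norm loc unfolding normal_at_def integrally_closed_def by blast
  then obtain G H d where GH: "?z = fc G H" "mpoly_eval x H \<noteq> 0" by (auto simp: local_ring_def)
  have "\<phi> G / \<phi> H = \<phi> ?A * \<phi> (mvar i) / (\<phi> ?D * \<phi> (mvar j))"
    using \<Psi>z nz GH by (simp add: \<Psi>_fc)
  hence "\<phi> (?A * mvar i * H - ?D * mvar j * G) = 0"
    using nz[OF GH(2)] nzv[of l] nzv[of j] by (simp add: rhom_simps[OF hom] field_simps)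
  then obtain R where R: "?A * mvar i * H - ?D * mvar j * G = F * R" using ker by (auto simp: dvd_def)
  \<comment> \<open>restriction to \<open>t\<^sub>j = 0\<close> with \<open>t\<^sub>i\<close> the outer variable; \<open>t\<^sub>k\<close> moves around \<open>x\<^sub>k\<close> in the inner one, so that its image is nonzero even if \<open>x\<^sub>k = 0\<close>, and the other coordinates are those of \<open>x\<close>\<close>
  define \<sigma> :: "('n, 'k) mpoly \<Rightarrow> 'k poly poly" where
    "\<sigma> = meval (\<lambda>c. [:[:c:]:]) (\<lambda>u. if u = i then [:0, 1:] else if u = j then 0
       else if u = k then [:[:x $ u, 1:]:] else [:[:x $ u:]:])"
  have hc: "rhom (\<lambda>c. [:[:c::'k:]:])" by (rule rhom_comp[OF rhom_poly_const rhom_poly_const])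
  have \<sigma>: "rhom \<sigma>" unfolding \<sigma>_def by (rule rhom_meval[OF hc])
  have \<sigma>v: "\<sigma> (mvar i) = [:0, 1:]" "\<sigma> (mvar j) = 0" "\<sigma> (mvar k) = [:[:x $ k, 1:]:]"
    using ij by (auto simp: \<sigma>_def meval_mvar[OF hc])
  have "\<sigma> ?A * \<sigma> (mvar i) * \<sigma> H = \<sigma> ?A * \<sigma> (mvar i) * (\<sigma> (mvar i) * \<sigma> R)"
    using arg_cong[OF R, of \<sigma>] unfolding F_def
    by (simp only: rhom_simps[OF \<sigma>] \<sigma>v(2)) (simp add: power2_eq_square mult_ac)
  moreover have "\<sigma> ?A * \<sigma> (mvar i) \<noteq> 0" by (simp add: \<sigma>v)
  ultimately have H: "\<sigma> H = [:0, 1:] * \<sigma> R" by (simp only: mult_cancel_left \<sigma>v(1)) simp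
  have "rhom (\<lambda>G. poly (poly (\<sigma> G) 0) 0)" using \<sigma> by (auto simp: rhom_def)
  hence "poly (poly (\<sigma> G) 0) 0 = mpoly_eval x G" for G
    by (rule rhom_mpoly_eqI[OF _ rhom_mpoly_eval])
      (use x in \<open>auto simp: \<sigma>_def meval_Const[OF hc] meval_mvar[OF hc]\<close>)
  hence "mpoly_eval x H = 0" using H by (metis mult_zero_left poly_0 poly_mult poly_pCons add_0 )
  thus False using GH by simp
qed

section \<open>Charts of a hypersurface that is linear in one variable\<close>

text \<open>Modulo \<open>F\<close> the product \<open>\<rho> p \<cdot> t\<^sub>j\<close> equals \<open>- \<rho> q\<close>, so powers of \<open>\<rho> p\<close> eliminate \<open>t\<^sub>j\<close>.\<close>

lemma reduce_linear_variable:
  fixes \<rho> :: "'t::comm_ring_1 \<Rightarrow> ('n::finite, 'k::comm_ring_1) mpoly"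
  assumes \<rho>: "rhom \<rho>" and c: "\<And>c. Const c \<in> range \<rho>" and v: "\<And>i. i \<noteq> j \<Longrightarrow> mvar i \<in> range \<rho>"
    and F: "F = mvar j * \<rho> p + \<rho> q"
  shows "\<exists>N y. F dvd \<rho> p ^ N * G - \<rho> y"
proof (induction G rule: mpoly_induct)
  case (Const c)
  obtain y where "Const c = \<rho> y" using c by blast
  thus ?case by (intro exI[of _ 0] exI[of _ y]) simp
next
  case (mvar i)
  show ?case
  proof (cases "i = j")
    case True
    have "\<rho> p ^ 1 * mvar i - \<rho> (- q) = F * 1"
      using True by (simp add: F rhom_simps[OF \<rho>] mult.commute)
    thus ?thesis by (metis dvd_triv_left)
  next
    case False
    then obtain y where "mvar i = \<rho> y" using v by blast
    thus ?thesis by (intro exI[of _ 0] exI[of _ y]) simp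
  qed
next
  case (add G H)
  then obtain M y N z where 1: "F dvd \<rho> p ^ M * G - \<rho> y" and 2: "F dvd \<rho> p ^ N * H - \<rho> z" by auto
  have "\<rho> p ^ (M + N) * (G + H) - \<rho> (p ^ N * y + p ^ M * z)
      = \<rho> p ^ N * (\<rho> p ^ M * G - \<rho> y) + \<rho> p ^ M * (\<rho> p ^ N * H - \<rho> z)"
    by (simp add: rhom_simps[OF \<rho>] power_add algebra_simps)
  moreover have "F dvd \<dots>" using 1 2 by (intro dvd_add dvd_mult)
  ultimately show ?case by metis
next
  case (mult G H)
  then obtain M y N z where 1: "F dvd \<rho> p ^ M * G - \<rho> y" and 2: "F dvd \<rho> p ^ N * H - \<rho> z" by auto
  have "\<rho> p ^ (M + N) * (G * H) - \<rho> (y * z)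
      = (\<rho> p ^ N * H) * (\<rho> p ^ M * G - \<rho> y) + \<rho> y * (\<rho> p ^ N * H - \<rho> z)"
    by (simp add: rhom_simps[OF \<rho>] power_add algebra_simps)
  moreover have "F dvd \<dots>" using 1 2 by (intro dvd_add dvd_mult)
  ultimately show ?case by metis
qed

text \<open>A variable \<open>t\<^sub>u\<close> is prime, and it does not divide \<open>F\<close> because \<open>F\<close> is nonzero at some point with
\<open>t\<^sub>u = 0\<close>. If \<open>t\<^sub>u G = F R\<close>, it must divide \<open>R\<close>.\<close>

lemma dvd_cancel_mvar:
  fixes F :: "('n::{finite, linorder}, 'k::idom) mpoly" and y :: "('k, 'n) vec"
  assumes y: "y $ u = 0" "mpoly_eval y F \<noteq> 0" and dv: "F dvd mvar u * G"
  shows "F dvd G"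
proof -
  \<comment> \<open>reduction modulo \<open>t\<^sub>u\<close>\<close>
  define \<sigma> :: "('n, 'k) mpoly \<Rightarrow> ('n, 'k) mpoly" where
    "\<sigma> = meval Const (\<lambda>i. if i = u then 0 else mvar i)"
  have \<sigma>: "rhom \<sigma>" unfolding \<sigma>_def by (rule rhom_meval[OF rhom_Const])
  have \<sigma>_dvd: "mvar u dvd H - \<sigma> H" for H
  proof (induction H rule: mpoly_induct)
    case (add G H)
    have "G + H - \<sigma> (G + H) = (G - \<sigma> G) + (H - \<sigma> H)" by (simp add: rhom_add[OF \<sigma>])
    thus ?case using add by (metis dvd_add)
  next
    case (mult G H)
    have "G * H - \<sigma> (G * H) = H * (G - \<sigma> G) + \<sigma> G * (H - \<sigma> H)"
      by (simp add: rhom_mult[OF \<sigma>] algebra_simps)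
    thus ?case using mult by (metis dvd_add dvd_mult)
  qed (auto simp: \<sigma>_def meval_Const meval_mvar rhom_Const)
  have "mpoly_eval y (\<sigma> H) = mpoly_eval y H" for H
    by (rule rhom_mpoly_eqI[OF rhom_comp[OF rhom_mpoly_eval \<sigma>] rhom_mpoly_eval])
      (use y(1) in \<open>auto simp: \<sigma>_def meval_Const meval_mvar rhom_Const rhom_0[OF rhom_mpoly_eval]\<close>)
  hence \<sigma>F: "\<sigma> F \<noteq> 0" using y(2) rhom_0[OF rhom_mpoly_eval] by metis
  obtain R where R: "mvar u * G = F * R" using dv by (auto simp: dvd_def)
  have "\<sigma> F * \<sigma> R = \<sigma> (mvar u) * \<sigma> G" using R by (simp add: rhom_mult[OF \<sigma>, symmetric])
  hence "\<sigma> R = 0" using \<sigma>F by (simp add: \<sigma>_def meval_mvar rhom_Const)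
  then obtain R' where R': "R = mvar u * R'" using \<sigma>_dvd[of R] by (auto simp: dvd_def)
  have "mvar u \<noteq> (0 :: ('n, 'k) mpoly)"
    by (simp add: mvar_def) (metis lookup_single_eq lookup_zero one_neq_zero)
  hence "G = F * R'" using R R' by (simp add: mult.left_commute)
  thus ?thesis by simp
qed

text \<open>Only the kernel needs an argument. If \<open>\<phi> G = 0\<close>, then reducing \<open>G\<close> leaves an element of \<open>'t\<close> with
image zero, so a power of \<open>\<rho> p\<close> times \<open>G\<close> is divisible by \<open>F\<close>, and \<open>\<rho> p\<close> can be cancelled.\<close>

lemma chartI:
  fixes F :: "('n::finite, 'k::field) mpoly"
    and \<phi> :: "('n, 'k) mpoly \<Rightarrow> 't::{factorial_ring_gcd, semiring_gcd_mult_normalize} fract"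
  assumes \<phi>: "rhom \<phi>" and \<rho>: "rhom \<rho>" and \<phi>\<rho>: "\<And>y. \<phi> (\<rho> y) = to_fract y"
    and red: "\<And>G. \<exists>N y. F dvd \<rho> p ^ N * G - \<rho> y" and F: "\<phi> F = 0"
    and canc: "\<And>G. F dvd \<rho> p * G \<Longrightarrow> F dvd G"
  shows "chart F \<phi> \<rho> p"
proof
  fix G
  have cancN: "F dvd G" if "F dvd \<rho> p ^ N * G" for N
    using that by (induction N) (auto intro: canc simp: mult.assoc)
  show "\<phi> G = 0 \<longleftrightarrow> F dvd G"
  proof
    assume G: "\<phi> G = 0"
    obtain N y where 1: "F dvd \<rho> p ^ N * G - \<rho> y" using red by blast
    hence "\<phi> (\<rho> p ^ N * G - \<rho> y) = 0" using rhom_dvd[OF \<phi> 1] F by simp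
    hence "y = 0" using G by (simp add: rhom_simps[OF \<phi>] \<phi>\<rho>)
    thus "F dvd G" using 1 cancN by (simp add: rhom_0[OF \<rho>])
  next
    assume "F dvd G"
    thus "\<phi> G = 0" using rhom_dvd[OF \<phi>, of F G] F by simp
  qed
qed (rule \<phi> \<rho> \<phi>\<rho> red)+

lemma (in field_embedding) dvd_cancel:
  assumes "F dvd H * G" "\<not> F dvd H"
  shows "F dvd G"
  using assms ker[of "H * G"] ker[of H] ker[of G] by (simp add: rhom_mult[OF hom])

lemma rhom_C3: "rhom (\<lambda>c. [:[:[:c:]:]:])"
  by (rule rhom_comp[OF rhom_poly_const rhom_comp[OF rhom_poly_const rhom_poly_const]])

lemma rhom_C4: "rhom (\<lambda>c. [:[:[:[:c:]:]:]:])"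
  by (rule rhom_comp[OF rhom_poly_const rhom_C3])

text \<open>Iterated univariate polynomial rings are factorial by Gauss's lemma. They serve as the rings \<open>'t\<close> of
the charts; the variables are listed from the innermost one.\<close>

definition poly3 :: "('k::comm_ring_1 \<Rightarrow> 'r::comm_ring_1) \<Rightarrow> 'r \<Rightarrow> 'r \<Rightarrow> 'r \<Rightarrow> 'k poly poly poly \<Rightarrow> 'r" where
  "poly3 h v1 v2 v3 = peval (peval (peval h v1) v2) v3"

definition poly4 ::
  "('k::comm_ring_1 \<Rightarrow> 'r::comm_ring_1) \<Rightarrow> 'r \<Rightarrow> 'r \<Rightarrow> 'r \<Rightarrow> 'r \<Rightarrow> 'k poly poly poly poly \<Rightarrow> 'r" where
  "poly4 h v1 v2 v3 v4 = peval (poly3 h v1 v2 v3) v4"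

lemma poly3_simps:
  assumes "rhom h"
  shows rhom_poly3: "rhom (poly3 h v1 v2 v3)"
    and "poly3 h v1 v2 v3 [:[:[:c:]:]:] = h c" "poly3 h v1 v2 v3 [:[:[:0, 1:]:]:] = v1"
    "poly3 h v1 v2 v3 [:[:0, 1:]:] = v2" "poly3 h v1 v2 v3 [:0, 1:] = v3"
  using assms by (simp_all add: poly3_def rhom_peval peval_const peval_X)

lemma poly4_simps:
  assumes "rhom h"
  shows rhom_poly4: "rhom (poly4 h v1 v2 v3 v4)"
    and "poly4 h v1 v2 v3 v4 [:[:[:[:c:]:]:]:] = h c" "poly4 h v1 v2 v3 v4 [:[:[:[:0, 1:]:]:]:] = v1"
    "poly4 h v1 v2 v3 v4 [:[:[:0, 1:]:]:] = v2" "poly4 h v1 v2 v3 v4 [:[:0, 1:]:] = v3"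
    "poly4 h v1 v2 v3 v4 [:0, 1:] = v4"
  using assms by (simp_all add: poly4_def poly3_simps rhom_peval peval_const peval_X)

lemma rhom_poly3_eqI:
  fixes f g :: "'k::comm_ring_1 poly poly poly \<Rightarrow> 'r::comm_ring_1"
  assumes f: "rhom f" and g: "rhom g" and "\<And>c. f [:[:[:c:]:]:] = g [:[:[:c:]:]:]"
    "f [:[:[:0, 1:]:]:] = g [:[:[:0, 1:]:]:]" "f [:[:0, 1:]:] = g [:[:0, 1:]:]" "f [:0, 1:] = g [:0, 1:]"
  shows "f y = g y"
proof (rule rhom_poly_eqI[OF f g])
  note c1 = rhom_comp[OF _ rhom_poly_const]
  show "f [:a:] = g [:a:]" for a
  proof (rule rhom_poly_eqI[OF c1[OF f] c1[OF g]])
    show "f [:[:b:]:] = g [:[:b:]:]" for b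
      by (rule rhom_poly_eqI[OF c1[OF c1[OF f]] c1[OF c1[OF g]]]) (use assms in auto)
  qed (use assms in auto)
qed (use assms in auto)

lemma rhom_poly4_eqI:
  fixes f g :: "'k::comm_ring_1 poly poly poly poly \<Rightarrow> 'r::comm_ring_1"
  assumes f: "rhom f" and g: "rhom g" and "\<And>c. f [:[:[:[:c:]:]:]:] = g [:[:[:[:c:]:]:]:]"
    "f [:[:[:[:0, 1:]:]:]:] = g [:[:[:[:0, 1:]:]:]:]"
    "f [:[:[:0, 1:]:]:] = g [:[:[:0, 1:]:]:]" "f [:[:0, 1:]:] = g [:[:0, 1:]:]" "f [:0, 1:] = g [:0, 1:]"
  shows "f y = g y"
proof (rule rhom_poly_eqI[OF f g])
  note c1 = rhom_comp[OF _ rhom_poly_const]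
  show "f [:a:] = g [:a:]" for a
    by (rule rhom_poly3_eqI[OF c1[OF f] c1[OF g]]) (use assms in auto)
qed (use assms in auto)

lemma exhaust_4': fixes x :: 4 shows "x = 0 \<or> x = 1 \<or> x = 2 \<or> x = 3"
  using exhaust_4[of x] by auto

lemma UNIV_5: "(UNIV :: 5 set) = {0, 1, 2, 3, 4}"
proof -
  have "card {0, 1, 2, 3, 4 :: 5} = 5" by simp
  thus ?thesis by (intro card_eq_UNIV_imp_eq_UNIV[symmetric]) simp_all
qed

lemma exhaust_5: fixes x :: 5 shows "x = 0 \<or> x = 1 \<or> x = 2 \<or> x = 3 \<or> x = 4"
  using UNIV_5 by blast

section \<open>The normal loci of the two hypersurfaces\<close>

definition F1 :: "'k::comm_ring_1 \<Rightarrow> (4, 'k) mpoly" where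
  "F1 c = mvar 0 * mvar 1 * mvar 2 + mvar 3 * ((mvar 0)\<^sup>2 + Const c * (mvar 1)\<^sup>2)"

definition F2 :: "(5, 'k::comm_ring_1) mpoly" where
  "F2 = (mvar 0)\<^sup>2 * mvar 2 + (mvar 1)\<^sup>2 * mvar 3 + mvar 0 * mvar 1 * mvar 4"

lemma homogeneous_mvar2: "homogeneous 2 (mvar i * mvar j)" "homogeneous 2 ((mvar i)\<^sup>2)"
  using homogeneous_mult[OF homogeneous_mvar homogeneous_mvar]
  by (simp_all add: numeral_2_eq_2)

lemma homogeneous_cmult: "homogeneous d G \<Longrightarrow> homogeneous d (Const c * G)"
  using homogeneous_mult[OF homogeneous_Const] by fastforce

lemma homogeneous_mvar3: "homogeneous 2 G \<Longrightarrow> homogeneous 3 (mvar i * G)" "homogeneous 2 G \<Longrightarrow> homogeneous 3 (G * mvar i)"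
  using homogeneous_mult[OF homogeneous_mvar, of 2 G i] by (simp_all add: numeral_3_eq_3 mult.commute)

lemma homogeneous_F1: "homogeneous 3 (F1 c)"
  unfolding F1_def
  by (intro homogeneous_add homogeneous_mvar3 homogeneous_mvar2 homogeneous_cmult)

lemma homogeneous_F2: "homogeneous 3 F2"
  unfolding F2_def by (intro homogeneous_add homogeneous_mvar3 homogeneous_mvar2)

text \<open>The embedding sends \<open>t\<^sub>j\<close> to \<open>- q/p\<close>, the solution of \<open>F = t\<^sub>j \<rho> p + \<rho> q = 0\<close>, and is the identity on
the other variables, which are the images of the generators \<open>V i\<close> of \<open>'t\<close>.\<close>

lemma exists_chart:
  fixes F :: "('n::finite, 'k::field) mpoly"
    and \<rho> :: "'t::{factorial_ring_gcd, semiring_gcd_mult_normalize} \<Rightarrow> ('n, 'k) mpoly"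
  assumes \<rho>: "rhom \<rho>" and K: "rhom K" "\<And>c. \<rho> (K c) = Const c"
    and V: "\<And>i. i \<noteq> j \<Longrightarrow> \<rho> (V i) = mvar i"
    and gen: "\<And>(f :: 't \<Rightarrow> 't fract) g y. rhom f \<Longrightarrow> rhom g \<Longrightarrow> (\<And>c. f (K c) = g (K c)) \<Longrightarrow>
        (\<And>i. i \<noteq> j \<Longrightarrow> f (V i) = g (V i)) \<Longrightarrow> f y = g y"
    and F: "F = mvar j * \<rho> p + \<rho> q" and p: "p \<noteq> 0" and canc: "\<And>G. F dvd \<rho> p * G \<Longrightarrow> F dvd G"
  shows "\<exists>\<phi>. chart F \<phi> \<rho> p"
proof -
  define \<phi> where "\<phi> = meval (\<lambda>a. to_fract (K a)) (\<lambda>i. if i = j then - (to_fract q / to_fract p) else to_fract (V i))"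
  have hK: "rhom (\<lambda>a. to_fract (K a))" by (rule rhom_comp[OF rhom_to_fract K(1)])
  have \<phi>: "rhom \<phi>" unfolding \<phi>_def by (rule rhom_meval[OF hK])
  have \<phi>\<rho>: "\<phi> (\<rho> y) = to_fract y" for y
    by (rule gen[OF rhom_comp[OF \<phi> \<rho>] rhom_to_fract])
      (simp_all add: K V \<phi>_def meval_mvar[OF hK] meval_Const[OF hK])
  have "chart F \<phi> \<rho> p"
  proof (rule chartI[OF \<phi> \<rho> \<phi>\<rho> _ _ canc])
    show "\<exists>N y. F dvd \<rho> p ^ N * G - \<rho> y" for G
      by (rule reduce_linear_variable[OF \<rho> _ _ F]) (metis K(2) V rangeI)+
    have "\<phi> (mvar j) = - (to_fract q / to_fract p)" by (simp add: \<phi>_def meval_mvar[OF hK])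
    thus "\<phi> F = 0" using p by (simp add: F rhom_simps[OF \<phi>] \<phi>\<rho>)
  qed
  thus ?thesis by blast
qed

text \<open>The surface is solved for \<open>t\<^sub>2\<close> where \<open>t\<^sub>0 t\<^sub>1 \<noteq> 0\<close>, and for \<open>t\<^sub>3\<close> where \<open>t\<^sub>0\<^sup>2 + c t\<^sub>1\<^sup>2 \<noteq> 0\<close>; the two
sets cover \<open>(t\<^sub>0, t\<^sub>1) \<noteq> 0\<close>. Cancelling \<open>t\<^sub>0 t\<^sub>1\<close> is done one variable at a time. The first chart shows that
\<open>F1 c\<close> is prime, so that \<open>t\<^sub>0\<^sup>2 + c t\<^sub>1\<^sup>2\<close>, being of smaller degree, can be cancelled in the second.\<close>

lemma chart_F1:
  fixes c :: "'k::{field, factorial_ring_gcd, semiring_gcd_mult_normalize}"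
  assumes c: "c \<noteq> 0"
  shows "\<exists>\<phi>. chart (F1 c) \<phi> (poly3 Const (mvar 0) (mvar 1) (mvar 3)) ([:[:[:0, 1:]:]:] * [:[:0, 1:]:])"
    and "\<exists>\<phi>. chart (F1 c) \<phi> (poly3 Const (mvar 0) (mvar 1) (mvar 2)) ([:[:[:0, 1:]:]:]\<^sup>2 + [:[:[:c:]:]:] * [:[:0, 1:]:]\<^sup>2)"
proof -
  let ?X1 = "[:[:[:0, 1:]:]:] :: 'k poly poly poly" and ?X2 = "[:[:0, 1:]:] :: 'k poly poly poly"
    and ?X3 = "[:0, 1:] :: 'k poly poly poly" and ?K = "\<lambda>c::'k. [:[:[:c:]:]:]"
  let ?\<rho> = "\<lambda>v. poly3 Const (mvar 0) (mvar 1) v :: _ \<Rightarrow> (4, 'k) mpoly"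
  note p3 = poly3_simps[OF rhom_Const]
  note \<rho>p = rhom_simps[OF p3(1)] p3
  have canc: "F1 c dvd G" if "F1 c dvd ?\<rho> (mvar 3) (?X1 * ?X2) * G" for G
  proof -
    have "?\<rho> (mvar 3) (?X1 * ?X2) = mvar 0 * mvar 1" by (simp only: \<rho>p)
    hence "F1 c dvd mvar 0 * (mvar 1 * G)" using that by (simp only: mult.assoc)
    hence "F1 c dvd mvar 1 * G"
      by (rule dvd_cancel_mvar[rotated 2, where y = "\<chi> i. if i = 0 then 0 else 1"])
        (use c in \<open>simp_all add: F1_def rhom_simps[OF rhom_mpoly_eval]\<close>)
    thus ?thesis
      by (rule dvd_cancel_mvar[rotated 2, where y = "\<chi> i. if i = 1 then 0 else 1"])
        (use c in \<open>simp_all add: F1_def rhom_simps[OF rhom_mpoly_eval]\<close>)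
  qed
  show ch1: "\<exists>\<phi>. chart (F1 c) \<phi> (?\<rho> (mvar 3)) (?X1 * ?X2)"
  proof (rule exists_chart[where K = ?K and j = 2 and V = "\<lambda>i. if i = 0 then ?X1 else if i = 1 then ?X2 else ?X3"])
    show "F1 c = mvar 2 * ?\<rho> (mvar 3) (?X1 * ?X2) + ?\<rho> (mvar 3) (?X3 * (?X1\<^sup>2 + ?K c * ?X2\<^sup>2))"
      unfolding \<rho>p by (simp add: F1_def algebra_simps)
    show "f y = g y" if "rhom f" "rhom g" "\<And>c. f (?K c) = g (?K c)"
      "\<And>i::4. i \<noteq> 2 \<Longrightarrow> f (if i = 0 then ?X1 else if i = 1 then ?X2 else ?X3)
        = g (if i = 0 then ?X1 else if i = 1 then ?X2 else ?X3)" for f g :: "_ \<Rightarrow> 'k poly poly poly fract" and y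
      using that(3) that(4)[of 0] that(4)[of 1] that(4)[of 3]
      by - (rule rhom_poly3_eqI[OF that(1,2)], simp_all)
    show "?\<rho> (mvar 3) (if i = 0 then ?X1 else if i = 1 then ?X2 else ?X3) = mvar i" if "i \<noteq> 2" for i
      using exhaust_4'[of i] that by (auto simp: p3)
    show "F1 c dvd G" if "F1 c dvd ?\<rho> (mvar 3) (?X1 * ?X2) * G" for G by (rule canc[OF that])
  qed (auto simp: p3 rhom_C3)
  then obtain \<phi> where "chart (F1 c) \<phi> (?\<rho> (mvar 3)) (?X1 * ?X2)" by blast
  then interpret A: chart "F1 c" \<phi> "?\<rho> (mvar 3)" "?X1 * ?X2" .
  let ?p = "?X1\<^sup>2 + ?K c * ?X2\<^sup>2"
  have \<rho>p': "?\<rho> (mvar 2) ?p = (mvar 0)\<^sup>2 + Const c * (mvar 1)\<^sup>2"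
    by (simp only: \<rho>p)
  have ev1: "mpoly_eval (\<chi> i. if i = 0 then 1 else 0) (?\<rho> (mvar 2) ?p) = 1"
    unfolding \<rho>p' by (simp add: rhom_simps[OF rhom_mpoly_eval])
  have nd: "\<not> F1 c dvd ?\<rho> (mvar 2) ?p"
  proof
    assume "F1 c dvd ?\<rho> (mvar 2) ?p"
    moreover have "homogeneous 2 (?\<rho> (mvar 2) ?p)"
      unfolding \<rho>p' by (intro homogeneous_add homogeneous_mvar2 homogeneous_cmult)
    ultimately have "?\<rho> (mvar 2) ?p = 0"
      using homogeneous_dvd_lower_degree[OF homogeneous_F1] by fastforce
    thus False using ev1 by (simp add: rhom_0[OF rhom_mpoly_eval])
  qed
  show "\<exists>\<phi>. chart (F1 c) \<phi> (?\<rho> (mvar 2)) ?p"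
  proof (rule exists_chart[where K = ?K and j = 3 and V = "\<lambda>i. if i = 0 then ?X1 else if i = 1 then ?X2 else ?X3"])
    show "F1 c = mvar 3 * ?\<rho> (mvar 2) ?p + ?\<rho> (mvar 2) (?X1 * ?X2 * ?X3)"
      unfolding \<rho>p by (simp add: F1_def algebra_simps)
    show "f y = g y" if "rhom f" "rhom g" "\<And>c. f (?K c) = g (?K c)"
      "\<And>i::4. i \<noteq> 3 \<Longrightarrow> f (if i = 0 then ?X1 else if i = 1 then ?X2 else ?X3)
        = g (if i = 0 then ?X1 else if i = 1 then ?X2 else ?X3)" for f g :: "_ \<Rightarrow> 'k poly poly poly fract" and y
      using that(3) that(4)[of 0] that(4)[of 1] that(4)[of 2]
      by - (rule rhom_poly3_eqI[OF that(1,2)], simp_all)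
    show "?\<rho> (mvar 2) (if i = 0 then ?X1 else if i = 1 then ?X2 else ?X3) = mvar i" if "i \<noteq> 3" for i
      using exhaust_4'[of i] that by (auto simp: p3)
    show "?p \<noteq> 0" using ev1 by (metis rhom_0[OF p3(1)] rhom_0[OF rhom_mpoly_eval] zero_neq_one)
    show "F1 c dvd G" if "F1 c dvd ?\<rho> (mvar 2) ?p * G" for G
      using A.dvd_cancel[OF that nd] .
  qed (auto simp: p3 rhom_C3)
qed

text \<open>The threefold is solved for \<open>t\<^sub>2\<close> where \<open>t\<^sub>0 \<noteq> 0\<close> and for \<open>t\<^sub>3\<close> where \<open>t\<^sub>1 \<noteq> 0\<close>.\<close>

lemma chart_F2:
  fixes F :: "(5, 'k::{field, factorial_ring_gcd, semiring_gcd_mult_normalize}) mpoly"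
  defines "F \<equiv> F2"
  shows "\<exists>\<phi>. chart F \<phi> (poly4 Const (mvar 0) (mvar 1) (mvar 3) (mvar 4)) ([:[:[:[:0, 1:]:]:]:]\<^sup>2)"
    and "\<exists>\<phi>. chart F \<phi> (poly4 Const (mvar 0) (mvar 1) (mvar 2) (mvar 4)) ([:[:[:0, 1:]:]:]\<^sup>2)"
proof -
  let ?X1 = "[:[:[:[:0, 1:]:]:]:] :: 'k poly poly poly poly" and ?X2 = "[:[:[:0, 1:]:]:] :: 'k poly poly poly poly"
    and ?X3 = "[:[:0, 1:]:] :: 'k poly poly poly poly"
    and ?X4 = "[:0, 1:] :: 'k poly poly poly poly" and ?K = "\<lambda>c::'k. [:[:[:[:c:]:]:]:]"
  let ?\<rho> = "\<lambda>v. poly4 Const (mvar 0) (mvar 1) v (mvar 4) :: _ \<Rightarrow> (5, 'k) mpoly"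
  let ?V = "\<lambda>i::5. if i = 0 then ?X1 else if i = 1 then ?X2 else if i = 4 then ?X4 else ?X3"
  note p4 = poly4_simps[OF rhom_Const]
  note \<rho>p = rhom_simps[OF p4(1)] p4
  have canc: "F dvd G" if "F dvd mvar 0 * (mvar 0 * G)" for G
  proof -
    have "F dvd mvar 0 * G"
      by (rule dvd_cancel_mvar[where y = "\<chi> i. if i = 0 then 0 else 1", OF _ _ that])
        (simp_all add: F_def F2_def rhom_simps[OF rhom_mpoly_eval])
    thus ?thesis
      by (rule dvd_cancel_mvar[rotated 2, where y = "\<chi> i. if i = 0 then 0 else 1"])
        (simp_all add: F_def F2_def rhom_simps[OF rhom_mpoly_eval])
  qed
  have canc': "F dvd G" if "F dvd mvar 1 * (mvar 1 * G)" for G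
  proof -
    have "F dvd mvar 1 * G"
      by (rule dvd_cancel_mvar[where y = "\<chi> i. if i = 1 then 0 else 1", OF _ _ that])
        (simp_all add: F_def F2_def rhom_simps[OF rhom_mpoly_eval])
    thus ?thesis
      by (rule dvd_cancel_mvar[rotated 2, where y = "\<chi> i. if i = 1 then 0 else 1"])
        (simp_all add: F_def F2_def rhom_simps[OF rhom_mpoly_eval])
  qed
  show "\<exists>\<phi>. chart F \<phi> (?\<rho> (mvar 3)) (?X1\<^sup>2)"
  proof (rule exists_chart[where K = ?K and j = 2 and V = ?V])
    show "F = mvar 2 * ?\<rho> (mvar 3) (?X1\<^sup>2) + ?\<rho> (mvar 3) (?X2\<^sup>2 * ?X3 + ?X1 * ?X2 * ?X4)"
      unfolding \<rho>p by (simp add: F_def F2_def algebra_simps)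
    show "f y = g y" if "rhom f" "rhom g" "\<And>c. f (?K c) = g (?K c)"
      "\<And>i::5. i \<noteq> 2 \<Longrightarrow> f (?V i) = g (?V i)" for f g :: "_ \<Rightarrow> 'k poly poly poly poly fract" and y
      using that(3) that(4)[of 0] that(4)[of 1] that(4)[of 3] that(4)[of 4]
      by - (rule rhom_poly4_eqI[OF that(1,2)], simp_all)
    show "?\<rho> (mvar 3) (?V i) = mvar i" if "i \<noteq> 2" for i
      using exhaust_5[of i] that by (auto simp: p4)
    show "F dvd G" if "F dvd ?\<rho> (mvar 3) (?X1\<^sup>2) * G" for G
    proof (rule canc)
      show "F dvd mvar 0 * (mvar 0 * G)" using that unfolding \<rho>p by (simp only: power2_eq_square mult.assoc)
    qed
  qed (auto simp: p4 rhom_C4)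
  show "\<exists>\<phi>. chart F \<phi> (?\<rho> (mvar 2)) (?X2\<^sup>2)"
  proof (rule exists_chart[where K = ?K and j = 3 and V = ?V])
    show "F = mvar 3 * ?\<rho> (mvar 2) (?X2\<^sup>2) + ?\<rho> (mvar 2) (?X1\<^sup>2 * ?X3 + ?X1 * ?X2 * ?X4)"
      unfolding \<rho>p by (simp add: F_def F2_def algebra_simps)
    show "f y = g y" if "rhom f" "rhom g" "\<And>c. f (?K c) = g (?K c)"
      "\<And>i::5. i \<noteq> 3 \<Longrightarrow> f (?V i) = g (?V i)" for f g :: "_ \<Rightarrow> 'k poly poly poly poly fract" and y
      using that(3) that(4)[of 0] that(4)[of 1] that(4)[of 2] that(4)[of 4]
      by - (rule rhom_poly4_eqI[OF that(1,2)], simp_all)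
    show "?\<rho> (mvar 2) (?V i) = mvar i" if "i \<noteq> 3" for i
      using exhaust_5[of i] that by (auto simp: p4)
    show "F dvd G" if "F dvd ?\<rho> (mvar 2) (?X2\<^sup>2) * G" for G
    proof (rule canc')
      show "F dvd mvar 1 * (mvar 1 * G)" using that unfolding \<rho>p by (simp only: power2_eq_square mult.assoc)
    qed
  qed (auto simp: p4 rhom_C4)
qed

lemma normal_at_F1_iff:
  fixes c :: "'k::{field, factorial_ring_gcd, semiring_gcd_mult_normalize}"
    and x :: "'k ^ 4"
  assumes c: "c \<noteq> 0" and x: "x \<noteq> 0" "mpoly_eval x (F1 c) = 0"
  shows "normal_at (F1 c) x \<longleftrightarrow> x $ 0 \<noteq> 0 \<or> x $ 1 \<noteq> 0"
proof (cases "x $ 0 \<noteq> 0 \<or> x $ 1 \<noteq> 0")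
  case True
  note p3 = poly3_simps[OF rhom_Const]
  have ev: "mpoly_eval x (poly3 Const (mvar 0) (mvar 1) v ([:[:[:0, 1:]:]:] * [:[:0, 1:]:])) = x $ 0 * x $ 1"
    "mpoly_eval x (poly3 Const (mvar 0) (mvar 1) v ([:[:[:0, 1:]:]:]\<^sup>2 + [:[:[:c:]:]:] * [:[:0, 1:]:]\<^sup>2)) = (x $ 0)\<^sup>2 + c * (x $ 1)\<^sup>2" for v
    by (simp_all only: rhom_simps[OF p3(1)] p3 rhom_simps[OF rhom_mpoly_eval] mpoly_eval_mvar mpoly_eval_Const)
  obtain \<phi> where ch1: "chart (F1 c) \<phi> (poly3 Const (mvar 0) (mvar 1) (mvar 3)) ([:[:[:0, 1:]:]:] * [:[:0, 1:]:])"
    using chart_F1(1)[OF c] by blast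
  obtain \<phi>' where ch2: "chart (F1 c) \<phi>' (poly3 Const (mvar 0) (mvar 1) (mvar 2)) ([:[:[:0, 1:]:]:]\<^sup>2 + [:[:[:c:]:]:] * [:[:0, 1:]:]\<^sup>2)"
    using chart_F1(2)[OF c] by blast
  have "x $ 0 * x $ 1 \<noteq> 0 \<or> (x $ 0)\<^sup>2 + c * (x $ 1)\<^sup>2 \<noteq> 0" using True c by auto
  thus ?thesis
    using chart.normal_at_chart[OF ch1 homogeneous_F1 x(2)] chart.normal_at_chart[OF ch2 homogeneous_F1 x(2)] True
    unfolding ev by blast
next
  case False
  obtain \<phi> where ch1: "chart (F1 c) \<phi> (poly3 Const (mvar 0) (mvar 1) (mvar 3)) ([:[:[:0, 1:]:]:] * [:[:0, 1:]:])"
    using chart_F1(1)[OF c] by blast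
  have "\<not> normal_at (F1 c) x"
  proof (rule field_embedding.not_normal_at)
    show "field_embedding (F1 c) \<phi>" using ch1 by (rule chart.axioms)
    show "F1 c = mvar 3 * mvar 0 ^ 2 + (Const c * mvar 3) * mvar 1 ^ 2 + mvar 2 * (mvar 0 * mvar 1)"
      by (simp add: F1_def algebra_simps)
  qed (use x False in \<open>auto intro: homogeneous_cmult homogeneous_mvar[simplified]\<close>)
  thus ?thesis using False by simp
qed

lemma normal_at_F2_iff:
  fixes x :: "'k::{field, factorial_ring_gcd, semiring_gcd_mult_normalize} ^ 5"
  assumes x: "x \<noteq> 0" "mpoly_eval x F2 = 0"
  shows "normal_at F2 x \<longleftrightarrow> x $ 0 \<noteq> 0 \<or> x $ 1 \<noteq> 0"
proof -
  note p4 = poly4_simps[OF rhom_Const]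
  have ev: "mpoly_eval x (poly4 Const (mvar 0) (mvar 1) v (mvar 4) ([:[:[:[:0, 1:]:]:]:]\<^sup>2)) = (x $ 0)\<^sup>2"
    "mpoly_eval x (poly4 Const (mvar 0) (mvar 1) v (mvar 4) ([:[:[:0, 1:]:]:]\<^sup>2)) = (x $ 1)\<^sup>2" for v
    by (simp_all only: rhom_simps[OF p4(1)] p4 rhom_simps[OF rhom_mpoly_eval] mpoly_eval_mvar)
  obtain \<phi> where ch1: "chart (F2 :: (5, 'k) mpoly) \<phi> (poly4 Const (mvar 0) (mvar 1) (mvar 3) (mvar 4)) ([:[:[:[:0, 1:]:]:]:]\<^sup>2)"
    using chart_F2(1) by blast
  obtain \<phi>' where ch2: "chart (F2 :: (5, 'k) mpoly) \<phi>' (poly4 Const (mvar 0) (mvar 1) (mvar 2) (mvar 4)) ([:[:[:0, 1:]:]:]\<^sup>2)"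
    using chart_F2(2) by blast
  show ?thesis
  proof (cases "x $ 0 \<noteq> 0 \<or> x $ 1 \<noteq> 0")
    case True
    thus ?thesis
      using chart.normal_at_chart[OF ch1 homogeneous_F2 x(2)] chart.normal_at_chart[OF ch2 homogeneous_F2 x(2)]
      unfolding ev by auto
  next
    case False
    have "\<not> normal_at F2 x"
    proof (rule field_embedding.not_normal_at)
      show "field_embedding (F2 :: (5, 'k) mpoly) \<phi>" using ch1 by (rule chart.axioms)
      show "(F2 :: (5, 'k) mpoly) = mvar 2 * mvar 0 ^ 2 + mvar 3 * mvar 1 ^ 2 + mvar 4 * (mvar 0 * mvar 1)"
        by (simp add: F2_def algebra_simps)
    qed (use x False in \<open>auto intro: homogeneous_mvar[simplified]\<close>)
    thus ?thesis using False by simp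
  qed
qed

lemma rhom_to_ac: "rhom to_ac"
  by (auto simp: rhom_def)

lemma map_to_ac_mvar_poly:
  "Poly_Mapping.map to_ac (W1 a) = F1 (of_int a)" "Poly_Mapping.map to_ac W2 = F2"
proof -
  note m = rhom_simps[OF rhom_map_mpoly[OF rhom_to_ac]] map_mpoly_mvar[OF rhom_to_ac]
  have "Const (of_int a) = (of_int a :: ('n, 'b::comm_ring_1) mpoly)" for a by simp
  note c = this[symmetric]
  show "Poly_Mapping.map to_ac (W1 a) = F1 (of_int a)"
    by (simp only: W1_def F1_def m) (simp only: c)
  show "Poly_Mapping.map to_ac W2 = F2"
    by (simp only: W2_def F2_def m)
qed

lemma mpoly_eval_map_to_ac:
  "mpoly_eval (\<chi> i. to_ac (x $ i)) (Poly_Mapping.map to_ac G) = to_ac (mpoly_eval x G)"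
  by (rule rhom_mpoly_eqI[OF rhom_comp[OF rhom_mpoly_eval rhom_map_mpoly[OF rhom_to_ac]]
      rhom_comp[OF rhom_to_ac rhom_mpoly_eval]])
    (simp_all add: map_mpoly_mvar[OF rhom_to_ac])

lemma geom_normal_at_W1_iff:
  assumes "a \<noteq> 0" "x \<noteq> 0" "mpoly_eval x (W1 a) = 0"
  shows "geom_normal_at (W1 a) x \<longleftrightarrow> x $ 0 \<noteq> 0 \<or> x $ 1 \<noteq> 0"
proof -
  have "(\<chi> i. to_ac (x $ i)) \<noteq> 0" using assms(2) by (auto simp: vec_eq_iff)
  moreover have "mpoly_eval (\<chi> i. to_ac (x $ i)) (F1 (of_int a)) = 0"
    using mpoly_eval_map_to_ac[of x "W1 a"] assms by (simp add: map_to_ac_mvar_poly)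
  ultimately show ?thesis
    using normal_at_F1_iff[of "of_int a" "\<chi> i. to_ac (x $ i)"] assms(1)
    by (simp add: geom_normal_at_def map_to_ac_mvar_poly)
qed

lemma geom_normal_at_W2_iff:
  assumes "x \<noteq> 0" "mpoly_eval x W2 = 0"
  shows "geom_normal_at W2 x \<longleftrightarrow> x $ 0 \<noteq> 0 \<or> x $ 1 \<noteq> 0"
proof -
  have "(\<chi> i. to_ac (x $ i)) \<noteq> 0" using assms(1) by (auto simp: vec_eq_iff)
  moreover have "mpoly_eval (\<chi> i. to_ac (x $ i)) F2 = 0"
    using mpoly_eval_map_to_ac[of x W2] assms by (simp add: map_to_ac_mvar_poly)
  ultimately show ?thesis
    using normal_at_F2_iff[of "\<chi> i. to_ac (x $ i)"]
    by (simp add: geom_normal_at_def map_to_ac_mvar_poly)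
qed

section \<open>Rational points and primitive integer vectors\<close>

abbreviation ratv :: "int ^ 'n \<Rightarrow> rat ^ 'n::finite" where
  "ratv z \<equiv> (\<chi> i. of_int (z $ i))"

definition znorm2 :: "int ^ 'n::finite \<Rightarrow> int" where
  "znorm2 z = (\<Sum>i\<in>UNIV. (z $ i)\<^sup>2)"

lemma prim_dvd_unit:
  fixes z :: "int ^ 'n"
  assumes "z \<in> prim" "\<And>i. d dvd z $ i"
  shows "is_unit d"
proof -
  have "d dvd Gcd (range (\<lambda>i. z $ i))" using assms(2) by (intro Gcd_greatest) auto
  thus ?thesis using assms(1) by (simp add: prim_def)
qed

lemma primI:
  fixes z :: "int ^ 'n"
  assumes "\<And>d. (\<And>i. d dvd z $ i) \<Longrightarrow> is_unit d"
  shows "z \<in> prim"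
proof -
  have "is_unit (Gcd (range (\<lambda>i. z $ i)))" by (rule assms) (auto intro: Gcd_dvd)
  hence "Gcd (range (\<lambda>i. z $ i)) = 1" by (metis is_unit_normalize normalize_Gcd)
  moreover have "z \<noteq> 0" using assms[of 0] by force
  ultimately show ?thesis by (simp add: prim_def)
qed

lemma ratv_eq_0_iff: "ratv z = 0 \<longleftrightarrow> z = 0"
  by (auto simp: vec_eq_iff)

lemma proj_rel_iff: "(x, y) \<in> proj_rel \<longleftrightarrow> x \<noteq> 0 \<and> (\<exists>c. c \<noteq> 0 \<and> y = c *s x)"
  by (auto simp: proj_rel_def vec_eq_iff)

lemma equiv_proj_rel: "equiv (UNIV - {0}) (proj_rel :: (('k::field ^ 'n) \<times> ('k ^ 'n)) set)"
proof (rule equivI)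
  show "proj_rel \<subseteq> (UNIV - {0}) \<times> (UNIV - {0 :: 'k ^ 'n})" by (auto simp: proj_rel_def)
  show "refl_on (UNIV - {0}) (proj_rel :: (('k ^ 'n) \<times> ('k ^ 'n)) set)"
    by (auto simp: refl_on_def proj_rel_iff intro!: exI[of _ 1])
  show "sym (proj_rel :: (('k ^ 'n) \<times> ('k ^ 'n)) set)"
  proof (rule symI)
    fix x y :: "'k ^ 'n" assume "(x, y) \<in> proj_rel"
    then obtain c where "x \<noteq> 0" "c \<noteq> 0" "y = c *s x" by (auto simp: proj_rel_iff)
    hence "y \<noteq> 0" "x = inverse c *s y" by (auto simp: vec_eq_iff)
    thus "(y, x) \<in> proj_rel" using \<open>c \<noteq> 0\<close> by (auto simp: proj_rel_iff intro!: exI[of _ "inverse c"])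
  qed
  show "trans (proj_rel :: (('k ^ 'n) \<times> ('k ^ 'n)) set)"
  proof (rule transI)
    fix x y z :: "'k ^ 'n" assume "(x, y) \<in> proj_rel" "(y, z) \<in> proj_rel"
    then obtain c d where "x \<noteq> 0" "c \<noteq> 0" "y = c *s x" "d \<noteq> 0" "z = d *s y" by (auto simp: proj_rel_iff)
    thus "(x, z) \<in> proj_rel" by (auto simp: proj_rel_iff intro!: exI[of _ "d * c"])
  qed
qed

definition proj_pt :: "int ^ 'n \<Rightarrow> (rat ^ 'n::finite) set" where
  "proj_pt z = proj_rel `` {ratv z}"

lemma mem_proj_pt: "z \<noteq> 0 \<Longrightarrow> y \<in> proj_pt z \<longleftrightarrow> (\<exists>c. c \<noteq> 0 \<and> y = c *s ratv z)"
  by (simp add: proj_pt_def proj_rel_iff ratv_eq_0_iff)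

lemma prim_nonzero: "z \<in> prim \<Longrightarrow> z \<noteq> 0" by (simp add: prim_def)

text \<open>In lowest terms the scaling factor is \<open>p/q\<close>; then \<open>p\<close> divides one vector and \<open>q\<close> the other, so both are units.\<close>

lemma prim_scaled_eq:
  assumes z: "z \<in> prim" "z' \<in> prim" and c: "ratv z' = c *s ratv z"
  shows "z' = z \<or> z' = - z"
proof -
  obtain p q where pq: "quotient_of c = (p, q)" by (cases "quotient_of c")
  hence q: "q > 0" "coprime p q" "c = of_int p / of_int q"
    by (auto dest: quotient_of_denom_pos quotient_of_coprime quotient_of_div)
  have e: "q * z' $ i = p * z $ i" for i
  proof -
    have "(of_int (z' $ i) :: rat) = c * of_int (z $ i)" using c by (simp add: vec_eq_iff)
    hence "(of_int (q * z' $ i) :: rat) = of_int (p * z $ i)" using q by (simp add: field_simps)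
    thus ?thesis by (simp only: of_int_eq_iff)
  qed
  have "p dvd z' $ i" for i using e[of i] q(2) by (metis coprime_dvd_mult_right_iff dvd_triv_left)
  hence p: "is_unit p" by (rule prim_dvd_unit[OF z(2)])
  have "q dvd z $ i" for i
    using e[of i] q(2) by (metis coprime_commute coprime_dvd_mult_right_iff dvd_triv_left)
  hence "is_unit q" by (rule prim_dvd_unit[OF z(1)])
  hence "q = 1" using q(1) by simp
  moreover have "p = 1 \<or> p = -1" using p by auto
  ultimately show ?thesis using e by (auto simp: vec_eq_iff)
qed

lemma uminus_prim: "z \<in> prim \<Longrightarrow> - z \<in> prim"
  by (rule primI, rule prim_dvd_unit) auto

lemma proj_pt_eq_iff:
  assumes "z \<in> prim" "z' \<in> prim"
  shows "proj_pt z' = proj_pt z \<longleftrightarrow> z' = z \<or> z' = - z"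
proof
  assume "proj_pt z' = proj_pt z"
  moreover have "ratv z' \<in> proj_pt z'"
    by (subst mem_proj_pt[OF prim_nonzero[OF assms(2)]]) (auto intro: exI[of _ 1])
  ultimately obtain c where "ratv z' = c *s ratv z" using mem_proj_pt[OF prim_nonzero[OF assms(1)]] by auto
  thus "z' = z \<or> z' = - z" by (rule prim_scaled_eq[OF assms])
next
  have "y \<in> proj_pt (- z) \<longleftrightarrow> y \<in> proj_pt z" for y
  proof -
    have "(\<exists>c. c \<noteq> 0 \<and> y = c *s ratv (- z)) \<longleftrightarrow> (\<exists>c. c \<noteq> 0 \<and> y = c *s ratv z)"
      by (rule iffI; elim exE; rule_tac x = "- c" in exI) (auto simp: vec_eq_iff)
    thus ?thesis using assms by (simp add: mem_proj_pt prim_nonzero)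
  qed
  thus "z' = z \<or> z' = - z \<Longrightarrow> proj_pt z' = proj_pt z" by auto
qed

lemma exists_common_denominator:
  fixes x :: "rat ^ 'n::finite"
  shows "\<exists>d>0. \<exists>w. of_int d *s x = ratv w"
proof -
  define den where "den i = snd (quotient_of (x $ i))" for i
  have den: "den i > 0" for i by (simp add: den_def quotient_of_denom_pos')
  define d where "d = prod den UNIV"
  have "\<exists>w. of_int d * x $ i = of_int w" for i
  proof -
    have "x $ i = of_int (fst (quotient_of (x $ i))) / of_int (den i)"
      unfolding den_def by (rule quotient_of_div) simp
    moreover have "d = den i * prod den (UNIV - {i})" unfolding d_def by (rule prod.remove) auto
    ultimately have "of_int d * x $ i = of_int (fst (quotient_of (x $ i)) * prod den (UNIV - {i}))"
      using den[of i] by (simp add: field_simps)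
    thus ?thesis by blast
  qed
  then obtain w where "\<And>i. of_int d * x $ i = of_int (w i)" by metis
  hence "of_int d *s x = ratv (\<chi> i. w i)" by (simp add: vec_eq_iff)
  moreover have "d > 0" unfolding d_def by (rule prod_pos) (use den in auto)
  ultimately show ?thesis by blast
qed

lemma proj_space_cases:
  assumes "t \<in> (proj_space :: (rat ^ 'n::finite) set set)"
  obtains z where "z \<in> prim" "t = proj_pt z"
proof -
  obtain x where x: "x \<noteq> 0" "t = proj_rel `` {x}"
    using assms by (auto simp: proj_space_def quotient_def)
  obtain d w where d: "d > 0" and w: "of_int d *s x = ratv w" using exists_common_denominator by blast
  define g where "g = Gcd (range (\<lambda>i. w $ i))"
  have w0: "w \<noteq> 0"
  proof
    assume "w = 0"
    hence "of_int d * x $ i = 0" for i using w by (auto simp: vec_eq_iff)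
    hence "x = 0" using d by (simp add: vec_eq_iff)
    thus False using x by simp
  qed
  have "g \<noteq> 0"
  proof
    assume "g = 0"
    hence "w $ i = 0" for i by (auto simp: g_def)
    thus False using w0 by (simp add: vec_eq_iff)
  qed
  have "g dvd w $ i" for i unfolding g_def by (rule Gcd_dvd) auto
  hence "\<forall>i. \<exists>k. w $ i = g * k" by (simp add: dvd_def)
  then obtain v where "\<forall>i. w $ i = g * v i" by (rule choice[THEN exE])
  hence v: "w $ i = g * v i" for i by simp
  define z where "z = (\<chi> i. v i)"
  have zp: "z \<in> prim"
  proof (rule primI)
    fix e assume "\<And>i. e dvd z $ i"
    hence "g * e dvd w $ i" for i using v by (simp add: z_def)
    hence "g * e dvd g" unfolding g_def by (intro Gcd_greatest) auto
    thus "is_unit e" using \<open>g \<noteq> 0\<close> by simp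
  qed
  have e: "x = (of_int g / of_int d) *s ratv z"
  proof -
    have "of_int d * x $ i = of_int g * of_int (v i)" for i
      using w v[of i] by (simp add: vec_eq_iff)
    thus ?thesis using d by (simp add: vec_eq_iff z_def field_simps)
  qed
  have "(ratv z, x) \<in> proj_rel"
    using e d \<open>g \<noteq> 0\<close> prim_nonzero[OF zp]
    by (auto simp: proj_rel_iff ratv_eq_0_iff intro!: exI[of _ "of_int g / of_int d"])
  hence "proj_pt z = t"
    unfolding proj_pt_def x(2) by (rule equiv_class_eq[OF equiv_proj_rel])
  thus thesis using that zp by blast
qed

lemma proj_pt_in_proj_space: "z \<in> prim \<Longrightarrow> proj_pt z \<in> proj_space"
  by (auto simp: proj_space_def proj_pt_def ratv_eq_0_iff prim_nonzero intro: quotientI)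

lemma height_proj_pt:
  assumes z: "z \<in> prim"
  shows "height (proj_pt z) = sqrt (real_of_int (znorm2 z))"
proof -
  \<comment> \<open>the representative chosen in the definition of the height\<close>
  define z' where "z' = (SOME z'. z' \<in> prim \<and> ratv z' \<in> proj_pt z)"
  have "z' \<in> prim \<and> ratv z' \<in> proj_pt z"
    unfolding z'_def
    by (rule someI[of _ z]) (use z in \<open>auto simp: mem_proj_pt prim_nonzero intro: exI[of _ 1]\<close>)
  then obtain c where "z' \<in> prim" "ratv z' = c *s ratv z" using z by (auto simp: mem_proj_pt prim_nonzero)
  hence "z' = z \<or> z' = - z" using prim_scaled_eq z by blast
  hence e: "znorm2 z' = znorm2 z" by (auto simp: znorm2_def)
  have "height (proj_pt z) = sqrt (real_of_int (znorm2 z'))"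
    by (simp add: height_def z'_def[symmetric] znorm2_def)
  thus ?thesis by (simp only: e)
qed

lemma finite_bounded_vectors: "finite {z :: int ^ 'n::finite. real_of_int (znorm2 z) \<le> R}"
proof -
  define m where "m = \<lceil>\<bar>R\<bar>\<rceil>"
  have "\<bar>z $ i\<bar> \<le> m" if "real_of_int (znorm2 z) \<le> R" for z :: "int ^ 'n" and i
  proof -
    have "\<bar>z $ i\<bar> \<le> (z $ i)\<^sup>2"
      by (metis abs_le_square_iff abs_of_nonneg abs_ge_zero power2_abs self_le_power zero_less_numeral abs_0 int_one_le_iff_zero_less linorder_not_less nle_le zero_le_power2 power2_eq_square mult_le_cancel_right1)
    also have "\<dots> \<le> znorm2 z" unfolding znorm2_def by (rule member_le_sum) auto
    also have "\<dots> \<le> m" using that by (simp add: m_def) linarith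
    finally show ?thesis .
  qed
  hence "{z :: int ^ 'n. real_of_int (znorm2 z) \<le> R} \<subseteq> (\<lambda>f. \<chi> i. f i) ` (PiE UNIV (\<lambda>_. {-m..m}))"
    by (intro subsetI image_eqI[where x = "\<lambda>i. vec_nth _ i"]) (auto simp: vec_eq_iff abs_le_iff minus_le_iff)
  moreover have "finite (PiE (UNIV :: 'n set) (\<lambda>_. {-m..m}))" by (intro finite_PiE) auto
  ultimately show ?thesis by (meson finite_imageI finite_subset)
qed

text \<open>Every rational point has exactly the two primitive representatives \<open>z\<close> and \<open>- z\<close>.\<close>

lemma card_points_eq_half_card_vectors:
  fixes S :: "(int ^ 'n::finite) set"
  assumes T: "T \<subseteq> proj_space" and B: "B \<ge> 0"
    and S: "S = {z \<in> prim. proj_pt z \<in> T \<and> real_of_int (znorm2 z) \<le> B\<^sup>2}"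
  shows "card S = 2 * card {t \<in> T. height t \<le> B}"
proof -
  let ?T = "{t \<in> T. height t \<le> B}"
  have fin: "finite S" by (rule finite_subset[OF _ finite_bounded_vectors[of "B\<^sup>2"]]) (auto simp: S)
  have h: "height (proj_pt z) \<le> B \<longleftrightarrow> real_of_int (znorm2 z) \<le> B\<^sup>2" if "z \<in> prim" for z :: "int ^ 'n"
    using B real_sqrt_le_iff[of "real_of_int (znorm2 z)" "B\<^sup>2"] by (simp add: height_proj_pt[OF that])
  have im: "?T = proj_pt ` S"
  proof
    show "?T \<subseteq> proj_pt ` S" using T h by (auto simp: S elim!: proj_space_cases[OF subsetD])
    show "proj_pt ` S \<subseteq> ?T" using h by (auto simp: S)
  qed
  have "card S = (\<Sum>t\<in>?T. card {z \<in> S. proj_pt z = t})"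
    using sum.image_gen[OF fin, of "\<lambda>_. 1::nat" proj_pt] by (simp add: im)
  also have "\<dots> = (\<Sum>t\<in>?T. 2)"
  proof (rule sum.cong[OF refl])
    fix t assume "t \<in> ?T"
    then obtain z where z: "z \<in> S" "t = proj_pt z" by (auto simp: im)
    have zp: "z \<in> prim" using z by (simp add: S)
    have e: "proj_pt (- z) = proj_pt z"
      using proj_pt_eq_iff[OF zp uminus_prim[OF zp]] by simp
    moreover have "proj_pt (- z) \<in> T" using z by (simp add: S e)
    ultimately have "- z \<in> S" using z uminus_prim[OF zp] by (simp add: S znorm2_def e)
    moreover have "z' \<in> prim" if "z' \<in> S" for z' using that by (simp add: S)
    ultimately have "{z' \<in> S. proj_pt z' = t} = {z, - z}"
      using z(1) unfolding z(2) by (auto simp: e proj_pt_eq_iff[OF zp])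
    moreover have "z \<noteq> - z" using prim_nonzero[OF zp] by (auto simp: vec_eq_iff)
    ultimately show "card {z' \<in> S. proj_pt z' = t} = 2" by simp
  qed
  finally show ?thesis by simp
qed

lemma norm_locus_points_iff:
  fixes F :: "('n::finite, rat) mpoly" and i j :: 'n
  assumes hom: "homogeneous d F"
    and norm: "\<And>x. x \<noteq> 0 \<Longrightarrow> mpoly_eval x F = 0 \<Longrightarrow> geom_normal_at F x \<longleftrightarrow> x $ i \<noteq> 0 \<or> x $ j \<noteq> 0"
    and z: "z \<in> prim"
  shows "proj_pt z \<in> norm_locus_points F \<longleftrightarrow> mpoly_eval (ratv z) F = 0 \<and> (z $ i \<noteq> 0 \<or> z $ j \<noteq> 0)"
proof -
  have sc: "mpoly_eval (c *s x) F = c ^ d * mpoly_eval x F" for c :: rat and x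
  proof -
    have *: "c ^ d * (a * (\<Prod>i\<in>UNIV. x $ i ^ Poly_Mapping.lookup m i))
        = a * (\<Prod>i\<in>UNIV. (c *s x) $ i ^ Poly_Mapping.lookup m i)"
      if "m \<in> Poly_Mapping.keys F" for m a
    proof -
      have "c ^ d = (\<Prod>i\<in>UNIV. c ^ Poly_Mapping.lookup m i)"
        using hom that by (simp add: homogeneous_def power_sum[symmetric])
      thus ?thesis by (simp add: power_mult_distrib prod.distrib mult_ac)
    qed
    thus ?thesis unfolding mpoly_eval_def sum_distrib_left by (intro sum.cong refl *[symmetric])
  qed
  have z0: "z \<noteq> 0" using z by (rule prim_nonzero)
  have all: "(\<forall>y\<in>proj_pt z. P y) \<longleftrightarrow> (\<forall>c. c \<noteq> 0 \<longrightarrow> P (c *s ratv z))" for P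
    unfolding Ball_def mem_proj_pt[OF z0] by blast
  have "proj_pt z \<in> norm_locus_points F \<longleftrightarrow>
     (\<forall>c. c \<noteq> 0 \<longrightarrow> mpoly_eval (c *s ratv z) F = 0) \<and> (\<forall>c. c \<noteq> 0 \<longrightarrow> geom_normal_at F (c *s ratv z))"
    unfolding norm_locus_points_def hypersurface_points_def
    by (simp add: all proj_pt_in_proj_space[OF z])
  also have "(\<forall>c. c \<noteq> 0 \<longrightarrow> mpoly_eval (c *s ratv z) F = 0) \<longleftrightarrow> mpoly_eval (ratv z) F = 0"
    unfolding sc by (auto dest: spec[of _ 1])
  also have "mpoly_eval (ratv z) F = 0 \<and> (\<forall>c. c \<noteq> 0 \<longrightarrow> geom_normal_at F (c *s ratv z))
    \<longleftrightarrow> mpoly_eval (ratv z) F = 0 \<and> (z $ i \<noteq> 0 \<or> z $ j \<noteq> 0)"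
  proof (rule conj_cong[OF refl])
    assume z1: "mpoly_eval (ratv z) F = 0"
    have "geom_normal_at F (c *s ratv z) \<longleftrightarrow> z $ i \<noteq> 0 \<or> z $ j \<noteq> 0" if "c \<noteq> 0" for c
    proof -
      have "c *s ratv z \<noteq> 0" using that z0 ratv_eq_0_iff[of z] by (auto simp: vec_eq_iff)
      thus ?thesis using norm[of "c *s ratv z"] that z1 by (simp add: sc)
    qed
    thus "(\<forall>c. c \<noteq> 0 \<longrightarrow> geom_normal_at F (c *s ratv z)) \<longleftrightarrow> z $ i \<noteq> 0 \<or> z $ j \<noteq> 0"
      by (auto dest!: spec[of _ "1 :: rat"])
  qed
  finally show ?thesis .
qed

lemma card_solutions_W:
  fixes F :: "('n::finite, rat) mpoly" and i j :: 'n
  assumes hom: "homogeneous d F"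
    and norm: "\<And>x. x \<noteq> 0 \<Longrightarrow> mpoly_eval x F = 0 \<Longrightarrow> geom_normal_at F x \<longleftrightarrow> x $ i \<noteq> 0 \<or> x $ j \<noteq> 0"
    and B: "B \<ge> 0"
  shows "card {z \<in> prim. mpoly_eval (ratv z) F = 0 \<and> (z $ i \<noteq> 0 \<or> z $ j \<noteq> 0) \<and> real_of_int (znorm2 z) \<le> B\<^sup>2}
    = 2 * N_norm F B"
  unfolding N_norm_def
proof (rule card_points_eq_half_card_vectors[OF _ B])
  show "norm_locus_points F \<subseteq> proj_space"
    by (auto simp: norm_locus_points_def hypersurface_points_def)
  show "{z \<in> prim. mpoly_eval (ratv z) F = 0 \<and> (z $ i \<noteq> 0 \<or> z $ j \<noteq> 0) \<and> real_of_int (znorm2 z) \<le> B\<^sup>2}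
    = {z \<in> prim. proj_pt z \<in> norm_locus_points F \<and> real_of_int (znorm2 z) \<le> B\<^sup>2}"
  proof (rule Collect_cong)
    fix z :: "int ^ 'n"
    have "proj_pt z \<in> norm_locus_points F \<longleftrightarrow> mpoly_eval (ratv z) F = 0 \<and> (z $ i \<noteq> 0 \<or> z $ j \<noteq> 0)"
      if "z \<in> prim" by (rule norm_locus_points_iff[OF hom norm that])
    thus "(z \<in> prim \<and> mpoly_eval (ratv z) F = 0 \<and> (z $ i \<noteq> 0 \<or> z $ j \<noteq> 0) \<and> real_of_int (znorm2 z) \<le> B\<^sup>2)
      = (z \<in> prim \<and> proj_pt z \<in> norm_locus_points F \<and> real_of_int (znorm2 z) \<le> B\<^sup>2)"
      by (cases "z \<in> prim") simp_all
  qed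
qed

section \<open>Parametrising the solutions by lattices\<close>

lemma int_gcd_eq_1I: "(\<And>d. d dvd a \<Longrightarrow> d dvd b \<Longrightarrow> is_unit d) \<Longrightarrow> gcd a b = (1::int)"
  by (metis coprimeI coprime_imp_gcd_eq_1)

lemma prim_4_iff:
  fixes z :: "int ^ 4"
  shows "z \<in> prim \<longleftrightarrow> gcd (gcd (z $ 0) (z $ 1)) (gcd (z $ 2) (z $ 3)) = 1"
proof
  assume z: "z \<in> prim"
  show "gcd (gcd (z $ 0) (z $ 1)) (gcd (z $ 2) (z $ 3)) = 1"
  proof (rule int_gcd_eq_1I)
    fix d assume "d dvd gcd (z $ 0) (z $ 1)" "d dvd gcd (z $ 2) (z $ 3)"
    hence "d dvd z $ i" for i using exhaust_4'[of i] by auto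
    thus "is_unit d" by (rule prim_dvd_unit[OF z])
  qed
next
  assume g: "gcd (gcd (z $ 0) (z $ 1)) (gcd (z $ 2) (z $ 3)) = 1"
  show "z \<in> prim"
  proof (rule primI)
    fix d assume "\<And>i. d dvd z $ i"
    hence "d dvd gcd (gcd (z $ 0) (z $ 1)) (gcd (z $ 2) (z $ 3))" by simp
    thus "is_unit d" by (simp add: g)
  qed
qed

lemma prim_5_iff:
  fixes z :: "int ^ 5"
  shows "z \<in> prim \<longleftrightarrow> gcd (gcd (z $ 0) (z $ 1)) (gcd (z $ 2) (gcd (z $ 3) (z $ 4))) = 1"
proof
  assume z: "z \<in> prim"
  show "gcd (gcd (z $ 0) (z $ 1)) (gcd (z $ 2) (gcd (z $ 3) (z $ 4))) = 1"
  proof (rule int_gcd_eq_1I)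
    fix d assume "d dvd gcd (z $ 0) (z $ 1)" "d dvd gcd (z $ 2) (gcd (z $ 3) (z $ 4))"
    hence "d dvd z $ i" for i using exhaust_5[of i] by auto
    thus "is_unit d" by (rule prim_dvd_unit[OF z])
  qed
next
  assume g: "gcd (gcd (z $ 0) (z $ 1)) (gcd (z $ 2) (gcd (z $ 3) (z $ 4))) = 1"
  show "z \<in> prim"
  proof (rule primI)
    fix d assume "\<And>i. d dvd z $ i"
    hence "d dvd gcd (gcd (z $ 0) (z $ 1)) (gcd (z $ 2) (gcd (z $ 3) (z $ 4)))" by simp
    thus "is_unit d" by (simp add: g)
  qed
qed

lemma znorm2_4: "znorm2 (z :: int ^ 4) = (z $ 0)\<^sup>2 + (z $ 1)\<^sup>2 + (z $ 2)\<^sup>2 + (z $ 3)\<^sup>2"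
proof -
  have "(4 :: 4) = 0" by simp
  thus ?thesis unfolding znorm2_def sum_4 by (simp only: ac_simps)
qed

lemma znorm2_5: "znorm2 (z :: int ^ 5) = (z $ 0)\<^sup>2 + (z $ 1)\<^sup>2 + (z $ 2)\<^sup>2 + (z $ 3)\<^sup>2 + (z $ 4)\<^sup>2"
  unfolding znorm2_def UNIV_5 by simp

lemma eval_W1: "mpoly_eval (ratv z) (W1 a) = 0 \<longleftrightarrow> z $ 0 * z $ 1 * z $ 2 + z $ 3 * ((z $ 0)\<^sup>2 + a * (z $ 1)\<^sup>2) = 0"
proof -
  have "mpoly_eval (ratv z) (W1 a) = of_int (z $ 0 * z $ 1 * z $ 2 + z $ 3 * ((z $ 0)\<^sup>2 + a * (z $ 1)\<^sup>2))"
    unfolding W1_def by (simp only: rhom_simps[OF rhom_mpoly_eval] mpoly_eval_mvar) simp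
  thus ?thesis by (simp only: of_int_eq_0_iff)
qed

lemma eval_W2: "mpoly_eval (ratv z) W2 = 0 \<longleftrightarrow> (z $ 0)\<^sup>2 * z $ 2 + (z $ 1)\<^sup>2 * z $ 3 + z $ 0 * z $ 1 * z $ 4 = 0"
proof -
  have "mpoly_eval (ratv z) W2 = of_int ((z $ 0)\<^sup>2 * z $ 2 + (z $ 1)\<^sup>2 * z $ 3 + z $ 0 * z $ 1 * z $ 4)"
    unfolding W2_def by (simp only: rhom_simps[OF rhom_mpoly_eval] mpoly_eval_mvar) simp
  thus ?thesis by (simp only: of_int_eq_0_iff)
qed

lemma homogeneous_W: "homogeneous 3 (W1 a)" "homogeneous 3 W2"
proof -
  have "W1 a = F1 (of_int a)" by (simp add: W1_def F1_def)
  thus "homogeneous 3 (W1 a)" by (simp add: homogeneous_F1)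
  have "W2 = F2" by (simp add: W2_def F2_def)
  thus "homogeneous 3 W2" by (simp add: homogeneous_F2)
qed

text \<open>The solutions of \<open>u y + v z = 0\<close> form a lattice of rank one with basis \<open>(- v, u)\<close>. From
\<open>s u + t v = 1\<close> the coordinate is \<open>l = s z - t y\<close>.\<close>

lemma coprime_line:
  fixes u v y z :: int
  assumes "coprime u v" "u * y + v * z = 0"
  obtains l where "y = - (l * v)" "z = l * u"
proof -
  obtain s t where st: "s * u + t * v = 1" using bezout_int[of u v] assms(1) by auto
  have "z = (s * z - t * y) * u"
  proof -
    have "(s * z - t * y) * u = s * u * z - t * (u * y)" by (simp add: algebra_simps)
    also have "u * y = - (v * z)" using assms(2) by simp
    also have "s * u * z - t * (- (v * z)) = (s * u + t * v) * z" by (simp add: algebra_simps)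
    finally show ?thesis using st by simp
  qed
  moreover have "y = - ((s * z - t * y) * v)"
  proof -
    have "- ((s * z - t * y) * v) = t * v * y - s * (v * z)" by (simp add: algebra_simps)
    also have "v * z = - (u * y)" using assms(2) by simp
    also have "t * v * y - s * (- (u * y)) = (s * u + t * v) * y" by (simp add: algebra_simps)
    finally show ?thesis using st by simp
  qed
  ultimately show thesis using that by blast
qed

lemma coprime_int_imp: "gcd m l = 1 \<Longrightarrow> coprime m (l::int)" by (simp add: coprime_iff_gcd_eq_1)

lemma gcd_mult_pos: "k > 0 \<Longrightarrow> gcd m l = 1 \<Longrightarrow> gcd (k * m) (k * l) = (k::int)"
  by (metis abs_of_pos gcd_mult_distrib_int mult.right_neutral)

text \<open>For \<open>(t\<^sub>0, t\<^sub>1) = k (m, l)\<close> the equation of the surface becomes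
\<open>m l \<cdot> t\<^sub>2 + (m\<^sup>2 + a l\<^sup>2) \<cdot> t\<^sub>3 = 0\<close>. Its coefficients have greatest common divisor \<open>gcd(a, m)\<close>; dividing
by it gives \<open>u1\<close> and \<open>v1\<close>, and \<open>q1\<close> is the square of the length of the basis vector \<open>(- v1, u1)\<close>.\<close>

definition u1 :: "int \<Rightarrow> int \<Rightarrow> int \<Rightarrow> int" where "u1 a m l = m * l div gcd a m"
definition v1 :: "int \<Rightarrow> int \<Rightarrow> int \<Rightarrow> int" where "v1 a m l = (m\<^sup>2 + a * l\<^sup>2) div gcd a m"
definition q1 :: "int \<Rightarrow> int \<Rightarrow> int \<Rightarrow> int" where "q1 a m l = (u1 a m l)\<^sup>2 + (v1 a m l)\<^sup>2"

lemma gcd_line_coeffs: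
  assumes ml: "gcd m l = (1::int)"
  shows "gcd (m * l) (m\<^sup>2 + a * l\<^sup>2) = gcd a m"
proof -
  have c: "coprime m l" using ml by (rule coprime_int_imp)
  have 1: "gcd m (m\<^sup>2 + a * l\<^sup>2) = gcd a m"
  proof -
    have "gcd m (m\<^sup>2 + a * l\<^sup>2) = gcd m (a * l\<^sup>2)"
      by (metis add.commute gcd_add_mult power2_eq_square mult.commute)
    also have "\<dots> = gcd m a"
      using c by (intro gcd_mult_right_right_cancel) (simp add: coprime_commute)
    finally show ?thesis by (simp add: gcd.commute)
  qed
  have "coprime l (m\<^sup>2 + a * l\<^sup>2)"
  proof -
    have "gcd l (m\<^sup>2 + a * l\<^sup>2) = gcd l (m\<^sup>2)"
      by (metis gcd_add_mult mult.assoc mult.commute power2_eq_square add.commute)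
    thus ?thesis using c by (simp add: coprime_iff_gcd_eq_1[symmetric] coprime_commute)
  qed
  hence "gcd (m * l) (m\<^sup>2 + a * l\<^sup>2) = gcd m (m\<^sup>2 + a * l\<^sup>2)"
    by (metis gcd_mult_left_left_cancel gcd_mult_left_right_cancel coprime_commute mult.commute)
  thus ?thesis using 1 by simp
qed

lemma line_coeffs:
  assumes a: "a \<noteq> 0" and ml: "gcd m l = (1::int)"
  shows "m * l = gcd a m * u1 a m l" "m\<^sup>2 + a * l\<^sup>2 = gcd a m * v1 a m l" "coprime (u1 a m l) (v1 a m l)"
proof -
  note g = gcd_line_coeffs[OF ml, of a]
  show "m * l = gcd a m * u1 a m l" "m\<^sup>2 + a * l\<^sup>2 = gcd a m * v1 a m l"
    unfolding u1_def v1_def g[symmetric] by simp_all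
  show "coprime (u1 a m l) (v1 a m l)"
    unfolding u1_def v1_def g[symmetric]
    by (rule div_gcd_coprime) (use g a in \<open>auto simp: gcd_eq_0_iff\<close>)
qed

text \<open>The solutions with \<open>(t\<^sub>0, t\<^sub>1) = k (m, l)\<close> are \<open>(k m, k l, - h v1, h u1)\<close>. The sign of \<open>(m, l)\<close> is fixed
by \<open>k > 0\<close>, and as \<open>(m, l)\<close> and \<open>(u1, v1)\<close> are coprime pairs, the solution is primitive if and only if
\<open>k\<close> and \<open>h\<close> are coprime.\<close>

lemma card_W1_pos:
  assumes a: "a \<noteq> 0" and B: "B \<ge> 0"
  shows "2 * N_norm (W1 a) B = card {((m, l), (k, h)). (m, l) \<in> prim2 \<and> k > 0 \<and> gcd k h = 1 \<and>
     real_of_int (k\<^sup>2 * (m\<^sup>2 + l\<^sup>2) + h\<^sup>2 * q1 a m l) \<le> B\<^sup>2}"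
    (is "_ = card ?P")
proof -
  let ?S = "{z \<in> prim. mpoly_eval (ratv z) (W1 a) = 0 \<and> (z $ 0 \<noteq> 0 \<or> z $ 1 \<noteq> 0) \<and> real_of_int (znorm2 z) \<le> B\<^sup>2}"
  define \<theta> :: "(int \<times> int) \<times> (int \<times> int) \<Rightarrow> int ^ 4" where
    "\<theta> = (\<lambda>((m, l), (k, h)). \<chi> i. if i = 0 then k * m else if i = 1 then k * l
       else if i = 2 then - (h * v1 a m l) else h * u1 a m l)"
  have \<theta>: "\<theta> ((m, l), (k, h)) $ 0 = k * m" "\<theta> ((m, l), (k, h)) $ 1 = k * l"
    "\<theta> ((m, l), (k, h)) $ 2 = - (h * v1 a m l)" "\<theta> ((m, l), (k, h)) $ 3 = h * u1 a m l" for m l k h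
    by (simp_all add: \<theta>_def)
  have inj: "inj_on \<theta> ?P"
  proof (rule inj_onI)
    fix x x' assume "x \<in> ?P" "x' \<in> ?P" and xx: "\<theta> x = \<theta> x'"
    then obtain m l k h m' l' k' h' where x: "x = ((m, l), (k, h))" "x' = ((m', l'), (k', h'))"
      and p: "(m, l) \<in> prim2" "0 < k" and p': "(m', l') \<in> prim2" "0 < k'" by blast
    have e: "\<theta> ((m, l), (k, h)) = \<theta> ((m', l'), (k', h'))" using xx by (simp only: x)
    have c: "k * m = k' * m'" "k * l = k' * l'" "h * v1 a m l = h' * v1 a m' l'" "h * u1 a m l = h' * u1 a m' l'"
      using e \<theta>[of m l k h] \<theta>[of m' l' k' h'] by auto
    have k: "k = k'"
      using gcd_mult_pos[of k m l] gcd_mult_pos[of k' m' l'] p p' c by (simp add: prim2_def)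
    hence ml: "m = m'" "l = l'" using c p by auto
    have "u1 a m l \<noteq> 0 \<or> v1 a m l \<noteq> 0"
      using line_coeffs(3)[OF a, of m l] p by (auto simp: prim2_def)
    hence "h = h'" using c ml by auto
    thus "x = x'" using k ml x by simp
  qed
  have nrm: "znorm2 (\<theta> ((m, l), (k, h))) = k\<^sup>2 * (m\<^sup>2 + l\<^sup>2) + h\<^sup>2 * q1 a m l" for m l k h
    by (simp add: znorm2_4 \<theta> q1_def power_mult_distrib algebra_simps)
  have prm: "\<theta> ((m, l), (k, h)) \<in> prim \<longleftrightarrow> gcd k h = 1" if "gcd m l = 1" "k > 0" for m l k h
  proof -
    have "gcd (h * u1 a m l) (h * v1 a m l) = \<bar>h\<bar>"
      using line_coeffs(3)[OF a that(1)] by (simp add: gcd_mult_distrib_int[symmetric] coprime_imp_gcd_eq_1)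
    hence "gcd (h * v1 a m l) (h * u1 a m l) = \<bar>h\<bar>" by (simp only: gcd.commute)
    thus ?thesis using that by (simp add: prim_4_iff \<theta> gcd_mult_pos)
  qed
  have "\<theta> ` ?P = ?S"
  proof (intro equalityI subsetI)
    fix z assume "z \<in> \<theta> ` ?P"
    then obtain x where x: "z = \<theta> x" "x \<in> ?P" by (rule imageE)
    obtain m l k h where x': "x = ((m, l), (k, h))" by (cases x) auto
    have p: "(m, l) \<in> prim2" "k > 0" "gcd k h = 1"
      "real_of_int (k\<^sup>2 * (m\<^sup>2 + l\<^sup>2) + h\<^sup>2 * q1 a m l) \<le> B\<^sup>2" using x(2) unfolding x' by simp_all
    have z: "z = \<theta> ((m, l), (k, h))" using x x' by simp
    have ml: "gcd m l = 1" "m \<noteq> 0 \<or> l \<noteq> 0" using p by (auto simp: prim2_def)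
    have "z $ 0 * z $ 1 * z $ 2 + z $ 3 * ((z $ 0)\<^sup>2 + a * (z $ 1)\<^sup>2)
      = k\<^sup>2 * h * (u1 a m l * (m\<^sup>2 + a * l\<^sup>2) - (m * l) * v1 a m l)"
      by (simp add: z \<theta> power2_eq_square algebra_simps)
    also have "\<dots> = 0" by (subst line_coeffs(1)[OF a ml(1)], subst line_coeffs(2)[OF a ml(1)]) simp
    finally have "mpoly_eval (ratv z) (W1 a) = 0" by (simp only: eval_W1)
    moreover have "z $ 0 \<noteq> 0 \<or> z $ 1 \<noteq> 0" using ml p by (auto simp: z \<theta>)
    moreover have "z \<in> prim" using prm[OF ml(1) p(2)] p(3) z by simp
    moreover have "real_of_int (znorm2 z) \<le> B\<^sup>2" using p(4) by (simp only: z nrm)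
    ultimately show "z \<in> ?S" by blast
  next
    fix z assume "z \<in> ?S"
    hence z: "z \<in> prim" "z $ 0 * z $ 1 * z $ 2 + z $ 3 * ((z $ 0)\<^sup>2 + a * (z $ 1)\<^sup>2) = 0"
      "z $ 0 \<noteq> 0 \<or> z $ 1 \<noteq> 0" "real_of_int (znorm2 z) \<le> B\<^sup>2"
      by (auto simp only: eval_W1)
    define k where "k = gcd (z $ 0) (z $ 1)"
    define m where "m = z $ 0 div k"
    define l where "l = z $ 1 div k"
    have k: "k > 0" unfolding k_def using z(3) by (simp add: gcd_pos_int)
    have z01: "z $ 0 = k * m" "z $ 1 = k * l" by (simp_all add: m_def l_def k_def)
    have ml: "gcd m l = 1"
      unfolding m_def l_def k_def using div_gcd_coprime[of "z $ 0" "z $ 1"] z(3) by (simp add: coprime_imp_gcd_eq_1)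
    have "k\<^sup>2 * (m * l * z $ 2 + (m\<^sup>2 + a * l\<^sup>2) * z $ 3) = 0"
      using z(2) by (simp add: z01 power2_eq_square algebra_simps)
    hence "m * l * z $ 2 + (m\<^sup>2 + a * l\<^sup>2) * z $ 3 = 0" using k by simp
    hence "gcd a m * (u1 a m l * z $ 2 + v1 a m l * z $ 3) = 0"
      unfolding line_coeffs(1)[OF a ml] line_coeffs(2)[OF a ml] by (simp only: distrib_left mult.assoc)
    hence "u1 a m l * z $ 2 + v1 a m l * z $ 3 = 0" using a by simp
    then obtain h where h: "z $ 2 = - (h * v1 a m l)" "z $ 3 = h * u1 a m l"
      using coprime_line[OF line_coeffs(3)[OF a ml]] by blast
    have ze: "z = \<theta> ((m, l), (k, h))"
      unfolding vec_eq_iff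
    proof
      fix i :: 4
      show "z $ i = \<theta> ((m, l), (k, h)) $ i"
        using exhaust_4'[of i] z01 h \<theta>[of m l k h] by auto
    qed
    have "(m, l) \<in> prim2" using ml z(3) z01 by (auto simp: prim2_def)
    moreover have "gcd k h = 1" using z(1) prm[OF ml k] ze by simp
    moreover have "real_of_int (k\<^sup>2 * (m\<^sup>2 + l\<^sup>2) + h\<^sup>2 * q1 a m l) \<le> B\<^sup>2" using z(4) unfolding ze nrm .
    ultimately have "((m, l), (k, h)) \<in> ?P" using k by simp
    thus "z \<in> \<theta> ` ?P" unfolding ze by (rule imageI)
  qed
  hence "card ?P = card ?S" using card_image[OF inj] by simp
  thus ?thesis using card_solutions_W[OF homogeneous_W(1) geom_normal_at_W1_iff[OF a] B] by simp
qed

text \<open>The square of the length of \<open>(l r, m s, - (m r + l s))\<close>.\<close>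

definition q2 :: "int \<Rightarrow> int \<Rightarrow> int \<Rightarrow> int \<Rightarrow> int" where
  "q2 m l r s = (m\<^sup>2 + l\<^sup>2) * (r\<^sup>2 + s\<^sup>2) + 2 * (m * l) * (r * s)"

text \<open>For coprime \<open>m\<close> and \<open>l\<close> the plane \<open>m\<^sup>2 y + l\<^sup>2 z + m l w = 0\<close> has the lattice basis \<open>(l, 0, - m)\<close>,
\<open>(0, m, - l)\<close>: the equation forces \<open>l\<close> to divide \<open>y\<close> and \<open>m\<close> to divide \<open>z\<close>.\<close>

lemma plane_param:
  fixes m l y z w :: int
  assumes ml: "gcd m l = 1" and e: "m\<^sup>2 * y + l\<^sup>2 * z + m * l * w = 0"
  obtains r s where "y = l * r" "z = m * s" "w = - (m * r + l * s)"
proof -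
  have c: "coprime m l" using ml by (rule coprime_int_imp)
  have "l\<^sup>2 * z = m * (- (m * y + l * w))" using e by (simp add: power2_eq_square algebra_simps)
  hence "m dvd l\<^sup>2 * z" by simp
  hence "m dvd z" using c by (simp add: coprime_dvd_mult_right_iff)
  then obtain s where s: "z = m * s" by (auto simp: dvd_def)
  have "m\<^sup>2 * y = l * (- (l * z + m * w))" using e by (simp add: power2_eq_square algebra_simps)
  hence "l dvd m\<^sup>2 * y" by simp
  hence "l dvd y" using c by (simp add: coprime_dvd_mult_right_iff coprime_commute)
  then obtain r where r: "y = l * r" by (auto simp: dvd_def)
  have e': "m * l * (m * r + l * s + w) = 0" using e by (simp add: r s power2_eq_square algebra_simps)
  show thesis
  proof (cases "m = 0 \<or> l = 0")
    case False
    hence "w = - (m * r + l * s)" using e' by simp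
    thus thesis using that r s by blast
  next
    \<comment> \<open>when \<open>m = 0\<close> the number \<open>l\<close> is a unit and \<open>w\<close> determines \<open>s\<close>; when \<open>l = 0\<close> it determines \<open>r\<close>\<close>
    case True
    thus thesis
    proof
      assume m: "m = 0"
      hence l: "l * l = 1" using ml by (metis abs_mult_self_eq gcd_0_left_int mult_1)
      have "w = - (m * r + l * (- (l * w)))" using m l by (simp add: mult.assoc[symmetric])
      moreover have "z = m * (- (l * w))" using m s by simp
      ultimately show thesis using that r by blast
    next
      assume l: "l = 0"
      hence m: "m * m = 1" using ml by (metis abs_mult_self_eq gcd_0_int mult_1)
      have "w = - (m * (- (m * w)) + l * s)" using m l by (simp add: mult.assoc[symmetric])
      moreover have "y = l * (- (m * w))" using l r by simp
      ultimately show thesis using that s by blast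
    qed
  qed
qed

lemma plane_param_gcd:
  fixes m l r s :: int
  assumes ml: "gcd m l = 1"
  shows "gcd (l * r) (gcd (m * s) (m * r + l * s)) = gcd r s"
proof (rule zdvd_antisym_nonneg)
  have c: "coprime m l" using ml by (rule coprime_int_imp)
  let ?d = "gcd (l * r) (gcd (m * s) (m * r + l * s))"
  have d: "?d dvd l * r" "?d dvd m * s" "?d dvd m * r + l * s"
    by (meson gcd_dvd1 gcd_dvd2 dvd_trans)+
  have "?d dvd m * (m * r + l * s) - l * (m * s)" by (rule dvd_diff[OF dvd_mult[OF d(3)] dvd_mult[OF d(2)]])
  hence "?d dvd gcd (l * r) (m\<^sup>2 * r)" using d(1) by (simp add: power2_eq_square algebra_simps)
  moreover have "gcd (l * r) (m\<^sup>2 * r) = \<bar>r\<bar>"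
    using c by (simp add: gcd_mult_distrib_int[symmetric] mult.commute[of _ r] coprime_imp_gcd_eq_1 coprime_commute)
  ultimately have 1: "?d dvd r" by simp
  have "?d dvd l * (m * r + l * s) - m * (l * r)" by (rule dvd_diff[OF dvd_mult[OF d(3)] dvd_mult[OF d(1)]])
  hence "?d dvd gcd (m * s) (l\<^sup>2 * s)" using d(2) by (simp add: power2_eq_square algebra_simps)
  moreover have "gcd (m * s) (l\<^sup>2 * s) = \<bar>s\<bar>"
    using c by (simp add: gcd_mult_distrib_int[symmetric] mult.commute[of _ s] coprime_imp_gcd_eq_1)
  ultimately have 2: "?d dvd s" by simp
  show "?d dvd gcd r s" using 1 2 by simp
  show "gcd r s dvd ?d" by (auto intro!: gcd_greatest)
qed auto

lemma card_W2_pos: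
  assumes B: "B \<ge> 0"
  shows "2 * N_norm W2 B = card {((m, l), (k, r, s)). (m, l) \<in> prim2 \<and> k > 0 \<and> gcd k (gcd r s) = 1 \<and>
     real_of_int (k\<^sup>2 * (m\<^sup>2 + l\<^sup>2) + q2 m l r s) \<le> B\<^sup>2}"
    (is "_ = card ?P")
proof -
  let ?S = "{z \<in> prim. mpoly_eval (ratv z) W2 = 0 \<and> (z $ 0 \<noteq> 0 \<or> z $ 1 \<noteq> 0) \<and> real_of_int (znorm2 z) \<le> B\<^sup>2}"
  define \<theta> :: "(int \<times> int) \<times> (int \<times> int \<times> int) \<Rightarrow> int ^ 5" where
    "\<theta> = (\<lambda>((m, l), (k, r, s)). \<chi> i. if i = 0 then k * m else if i = 1 then k * l
       else if i = 2 then l * r else if i = 3 then m * s else - (m * r + l * s))"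
  have \<theta>: "\<theta> ((m, l), (k, r, s)) $ 0 = k * m" "\<theta> ((m, l), (k, r, s)) $ 1 = k * l"
    "\<theta> ((m, l), (k, r, s)) $ 2 = l * r" "\<theta> ((m, l), (k, r, s)) $ 3 = m * s"
    "\<theta> ((m, l), (k, r, s)) $ 4 = - (m * r + l * s)" for m l k r s
    by (simp_all add: \<theta>_def)
  have inj: "inj_on \<theta> ?P"
  proof (rule inj_onI)
    fix x x' assume "x \<in> ?P" "x' \<in> ?P" and xx: "\<theta> x = \<theta> x'"
    then obtain m l k r s m' l' k' r' s' where x: "x = ((m, l), (k, r, s))" "x' = ((m', l'), (k', r', s'))"
      and p: "(m, l) \<in> prim2" "0 < k" and p': "(m', l') \<in> prim2" "0 < k'" by blast
    have e: "\<theta> ((m, l), (k, r, s)) = \<theta> ((m', l'), (k', r', s'))" using xx by (simp only: x)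
    have c: "k * m = k' * m'" "k * l = k' * l'" "l * r = l' * r'" "m * s = m' * s'" "m * r + l * s = m' * r' + l' * s'"
      using e \<theta>[of m l k r s] \<theta>[of m' l' k' r' s'] by auto
    have k: "k = k'"
      using gcd_mult_pos[of k m l] gcd_mult_pos[of k' m' l'] p p' c by (simp add: prim2_def)
    hence ml: "m = m'" "l = l'" using c p by auto
    have "m \<noteq> 0 \<or> l \<noteq> 0" using p by (auto simp: prim2_def)
    hence "r = r' \<and> s = s'" using c unfolding ml[symmetric] by auto
    thus "x = x'" using k ml x by simp
  qed
  have nrm: "znorm2 (\<theta> ((m, l), (k, r, s))) = k\<^sup>2 * (m\<^sup>2 + l\<^sup>2) + q2 m l r s" for m l k r s
    by (simp add: znorm2_5 \<theta> q2_def power2_eq_square algebra_simps)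
  have prm: "\<theta> ((m, l), (k, r, s)) \<in> prim \<longleftrightarrow> gcd k (gcd r s) = 1" if "gcd m l = 1" "k > 0" for m l k r s
  proof -
    have "gcd (m * s) (- (m * r) - l * s) = gcd (m * s) (m * r + l * s)"
      by (metis gcd_neg2_int minus_add_distrib uminus_add_conv_diff add.commute diff_conv_add_uminus)
    thus ?thesis using that by (simp add: prim_5_iff \<theta> gcd_mult_pos plane_param_gcd)
  qed
  have "\<theta> ` ?P = ?S"
  proof (intro equalityI subsetI)
    fix z assume "z \<in> \<theta> ` ?P"
    then obtain x where x: "z = \<theta> x" "x \<in> ?P" by (rule imageE)
    obtain m l k r s where x': "x = ((m, l), (k, r, s))" by (cases x) auto
    have p: "(m, l) \<in> prim2" "k > 0" "gcd k (gcd r s) = 1"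
      "real_of_int (k\<^sup>2 * (m\<^sup>2 + l\<^sup>2) + q2 m l r s) \<le> B\<^sup>2" using x(2) unfolding x' by simp_all
    have z: "z = \<theta> ((m, l), (k, r, s))" using x x' by simp
    have ml: "gcd m l = 1" "m \<noteq> 0 \<or> l \<noteq> 0" using p by (auto simp: prim2_def)
    have "(z $ 0)\<^sup>2 * z $ 2 + (z $ 1)\<^sup>2 * z $ 3 + z $ 0 * z $ 1 * z $ 4 = 0"
      by (simp add: z \<theta> power2_eq_square algebra_simps)
    hence "mpoly_eval (ratv z) W2 = 0" by (simp only: eval_W2)
    moreover have "z $ 0 \<noteq> 0 \<or> z $ 1 \<noteq> 0" using ml p by (auto simp: z \<theta>)
    moreover have "z \<in> prim" using prm[OF ml(1) p(2)] p(3) z by simp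
    moreover have "real_of_int (znorm2 z) \<le> B\<^sup>2" using p(4) by (simp only: z nrm)
    ultimately show "z \<in> ?S" by blast
  next
    fix z assume "z \<in> ?S"
    hence z: "z \<in> prim" "(z $ 0)\<^sup>2 * z $ 2 + (z $ 1)\<^sup>2 * z $ 3 + z $ 0 * z $ 1 * z $ 4 = 0"
      "z $ 0 \<noteq> 0 \<or> z $ 1 \<noteq> 0" "real_of_int (znorm2 z) \<le> B\<^sup>2"
      by (auto simp only: eval_W2)
    define k where "k = gcd (z $ 0) (z $ 1)"
    define m where "m = z $ 0 div k"
    define l where "l = z $ 1 div k"
    have k: "k > 0" unfolding k_def using z(3) by (simp add: gcd_pos_int)
    have z01: "z $ 0 = k * m" "z $ 1 = k * l" by (simp_all add: m_def l_def k_def)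
    have ml: "gcd m l = 1"
      unfolding m_def l_def k_def using div_gcd_coprime[of "z $ 0" "z $ 1"] z(3) by (simp add: coprime_imp_gcd_eq_1)
    have "k\<^sup>2 * (m\<^sup>2 * z $ 2 + l\<^sup>2 * z $ 3 + m * l * z $ 4) = 0"
      using z(2) by (simp add: z01 power2_eq_square algebra_simps)
    hence "m\<^sup>2 * z $ 2 + l\<^sup>2 * z $ 3 + m * l * z $ 4 = 0" using k by simp
    then obtain r s where h: "z $ 2 = l * r" "z $ 3 = m * s" "z $ 4 = - (m * r + l * s)"
      using plane_param[OF ml] by blast
    have ze: "z = \<theta> ((m, l), (k, r, s))"
      unfolding vec_eq_iff
    proof
      fix i :: 5
      show "z $ i = \<theta> ((m, l), (k, r, s)) $ i"
        using exhaust_5[of i] z01 h \<theta>[of m l k r s] by auto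
    qed
    have "(m, l) \<in> prim2" using ml z(3) z01 by (auto simp: prim2_def)
    moreover have "gcd k (gcd r s) = 1" using z(1) prm[OF ml k] ze by simp
    moreover have "real_of_int (k\<^sup>2 * (m\<^sup>2 + l\<^sup>2) + q2 m l r s) \<le> B\<^sup>2" using z(4) unfolding ze nrm .
    ultimately have "((m, l), (k, r, s)) \<in> ?P" using k by simp
    thus "z \<in> \<theta> ` ?P" unfolding ze by (rule imageI)
  qed
  hence "card ?P = card ?S" using card_image[OF inj] by simp
  thus ?thesis using card_solutions_W[OF homogeneous_W(2) geom_normal_at_W2_iff B] by simp
qed

section \<open>The Moebius function\<close>

definition mu :: "nat \<Rightarrow> real" where
  "mu n = (if squarefree n then (- 1) ^ card (prime_factors n) else 0)"

lemma abs_mu_le: "\<bar>mu n\<bar> \<le> 1"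
  by (simp add: mu_def power_abs)

lemma mu_1: "mu 1 = 1"
  by (simp add: mu_def)

lemma mu_prime_mult:
  assumes p: "normalization_semidom_class.prime p" "\<not> p dvd e" and e: "e > 0"
  shows "mu (p * e) = - mu e"
proof -
  have c: "coprime p e" using p by (simp add: prime_imp_coprime)
  have "squarefree (p * e) \<longleftrightarrow> squarefree e"
    using c p(1) squarefree_mult_coprime[of p e] squarefree_prime[of p] squarefree_multD(2)[of p e] by blast
  moreover have "prime_factors (p * e) = insert p (prime_factors e)"
    using p e by (simp add: prime_factors_product prime_prime_factors)
  moreover have "p \<notin> prime_factors e" using p by auto
  ultimately show ?thesis by (simp add: mu_def)
qed

lemma mu_square_mult:
  assumes "normalization_semidom_class.prime p" "p dvd e"
  shows "mu (p * e) = 0"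
proof -
  have "p\<^sup>2 dvd p * e" using assms by (simp add: power2_eq_square mult_dvd_mono)
  hence "\<not> squarefree (p * e)" using assms(1) by (auto simp: squarefree_def dest!: spec[of _ p])
  thus ?thesis by (simp add: mu_def)
qed

text \<open>Choose a prime \<open>p\<close> dividing \<open>n\<close>. The divisors \<open>e\<close> prime to \<open>p\<close> and the divisors \<open>p e\<close> cancel in pairs, and
the remaining divisors are multiples of \<open>p\<^sup>2\<close>.\<close>

lemma sum_mu_divisors:
  assumes n: "n > 0"
  shows "(\<Sum>d | d dvd n. mu d) = (if n = 1 then 1 else 0)"
proof (cases "n = 1")
  case False
  then obtain p where p: "normalization_semidom_class.prime p" "p dvd n" by (meson prime_factor_nat)
  then obtain k where k: "n = p * k" by (auto simp: dvd_def)
  hence k0: "k > 0" using n by auto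
  let ?A = "{d. d dvd n \<and> \<not> p dvd d}" and ?B = "{d. d dvd n \<and> p dvd d}"
  have fin: "finite {d. d dvd n}" using n by simp
  have "(\<Sum>d | d dvd n. mu d) = sum mu ?A + sum mu ?B"
    using fin by (subst sum.union_disjoint[symmetric]) (auto intro!: sum.cong)
  also have "sum mu ?B = sum mu ((\<lambda>e. p * e) ` {e. e dvd k})"
    using p k0 by (intro sum.cong) (auto simp: k)
  also have "\<dots> = (\<Sum>e | e dvd k. mu (p * e))"
    using p by (subst sum.reindex) (auto simp: inj_on_def prime_gt_0_nat)
  also have "\<dots> = (\<Sum>e\<in>?A. mu (p * e))"
  proof (rule sum.mono_neutral_right)
    show "finite {e. e dvd k}" using k0 by simp
    show "?A \<subseteq> {e. e dvd k}"
      using p by (auto simp: k) (metis coprime_dvd_mult_right_iff prime_imp_coprime coprime_commute)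
    show "\<forall>e\<in>{e. e dvd k} - ?A. mu (p * e) = 0"
      using p by (auto simp: k intro!: mu_square_mult)
  qed
  also have "\<dots> = (\<Sum>e\<in>?A. - mu e)"
    using p n by (intro sum.cong refl mu_prime_mult) (auto intro: Nat.gr0I)
  finally show ?thesis using False by (simp add: sum_negf)
qed (use mu_1 in simp)

lemma sum_inverse_le_ln:
  assumes "n \<ge> 1"
  shows "(\<Sum>d=1..n. 1 / real d) \<le> 1 + ln (real n)"
  using assms
proof (induction n rule: dec_induct)
  case (step n)
  have "ln (real n / real (Suc n)) \<le> real n / real (Suc n) - 1"
    using step by (intro ln_le_minus_one) simp
  also have "\<dots> = - (1 / real (Suc n))" by (simp add: field_simps)
  finally have "1 / real (Suc n) \<le> ln (real (Suc n)) - ln (real n)"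
    using step by (simp add: ln_div)
  thus ?case using step.IH by simp
qed simp

text \<open>The terms are dominated by the telescoping differences \<open>2/n\<^sup>s\<^sup>-\<^sup>1 - 2/(n + 1)\<^sup>s\<^sup>-\<^sup>1\<close>.\<close>

lemma zeta_tail:
  assumes s: "s = 2 \<or> s = (3::nat)"
  shows "0 \<le> zeta s - (\<Sum>e=1..M. 1 / real e ^ s)"
    and "zeta s - (\<Sum>e=1..M. 1 / real e ^ s) \<le> 2 / real (Suc M) ^ (s - 1)"
proof -
  let ?f = "\<lambda>n. 1 / real (Suc n) ^ s"
  have p: "1 / real (Suc n) powr real s = ?f n" for n by (simp add: powr_realpow)
  have sm: "summable ?f"
    using inverse_power_summable[of s, where 'a = real] s
    by (subst summable_Suc_iff) (auto simp: inverse_eq_divide power_one_over)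
  have z: "zeta s = suminf ?f" unfolding zeta_def using p by simp
  have part: "(\<Sum>e=1..M. 1 / real e ^ s) = (\<Sum>n<M. ?f n)"
    by (induction M) auto
  have tail: "zeta s - (\<Sum>e=1..M. 1 / real e ^ s) = suminf (\<lambda>n. ?f (n + M))"
    unfolding part z using suminf_split_initial_segment[OF sm, of M] by simp
  show "0 \<le> zeta s - (\<Sum>e=1..M. 1 / real e ^ s)"
    unfolding tail by (rule suminf_nonneg) (use summable_ignore_initial_segment[OF sm] in auto)
  let ?g = "\<lambda>n. 2 / real (Suc (n + M)) ^ (s - 1)"
  have lim: "?g \<longlonglongrightarrow> 0"
  proof -
    have "(\<lambda>n. 1 / real (Suc (n + M)) ^ (s - 1)) \<longlonglongrightarrow> 0"
    proof (rule tendsto_sandwich[OF _ _ tendsto_const LIMSEQ_inverse_real_of_nat])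
      have "1 / real (Suc (n + M)) ^ (s - 1) \<le> inverse (real (Suc n))" for n
      proof -
        have "real (Suc n) \<le> real (Suc (n + M)) ^ 1" by simp
        also have "\<dots> \<le> real (Suc (n + M)) ^ (s - 1)" using s by (intro power_increasing) auto
        finally show ?thesis by (simp add: inverse_eq_divide divide_le_cancel frac_le)
      qed
      thus "\<forall>\<^sub>F n in sequentially. 1 / real (Suc (n + M)) ^ (s - 1) \<le> inverse (real (Suc n))" by simp
    qed auto
    from tendsto_mult_left[OF this, of 2] show ?thesis by simp
  qed
  have tele: "(\<lambda>n. ?g n - ?g (Suc n)) sums (?g 0 - 0)"
    using telescope_sums'[OF lim] by simp
  have le: "?f (n + M) \<le> ?g n - ?g (Suc n)" for n
  proof -
    define x where "x = real (Suc (n + M))"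
    have x: "x \<ge> 1" by (simp add: x_def)
    have "1 / x ^ s \<le> 2 / x ^ (s - 1) - 2 / (x + 1) ^ (s - 1)"
    proof -
      from s consider "s = 2" | "s = 3" by blast
      thus ?thesis
      proof cases
        case 1
        have "2 / x - 2 / (x + 1) = 2 / (x * (x + 1))" using x by (simp add: diff_frac_eq)
        moreover have "2 / (2 * x * x) \<le> 2 / (x * (x + 1))"
          using x by (intro divide_left_mono) (simp_all add: mult.commute)
        ultimately show ?thesis using 1 by (simp add: power2_eq_square)
      next
        case 2
        define N where "N = 2 * (2 * x + 1)"
        define E where "E = x\<^sup>2 * (x + 1)\<^sup>2"
        have "2 / x\<^sup>2 - 2 / (x + 1)\<^sup>2 = (2 * (x + 1)\<^sup>2 - 2 * x\<^sup>2) / E"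
          using x by (simp add: diff_frac_eq E_def)
        also have "2 * (x + 1)\<^sup>2 - 2 * x\<^sup>2 = N" by (simp add: N_def power2_eq_square algebra_simps)
        finally have e: "2 / x\<^sup>2 - 2 / (x + 1)\<^sup>2 = N / E" .
        have "1 * 1 \<le> x * x" using x by (intro mult_mono) auto
        hence "(x + 1)\<^sup>2 \<le> 4 * x\<^sup>2 + 2 * x" by (simp add: power2_eq_square algebra_simps)
        hence "E \<le> x\<^sup>2 * (4 * x\<^sup>2 + 2 * x)" unfolding E_def by (intro mult_left_mono) auto
        also have "\<dots> = N * x ^ 3" by (simp add: N_def power2_eq_square power3_eq_cube algebra_simps)
        finally have "E \<le> N * x ^ 3" .
        moreover have "E > 0" "x ^ 3 > 0" using x by (simp_all add: E_def)
        ultimately have "1 / x ^ 3 \<le> N / E" by (simp add: pos_le_divide_eq pos_divide_le_eq)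
        thus ?thesis using 2 e by (simp add: numeral_3_eq_3 numeral_2_eq_2)
      qed
    qed
    thus ?thesis by (simp add: x_def add_ac)
  qed
  have "suminf (\<lambda>n. ?f (n + M)) \<le> suminf (\<lambda>n. ?g n - ?g (Suc n))"
    by (rule suminf_le[OF le]) (use summable_ignore_initial_segment[OF sm] tele in \<open>auto simp: sums_iff\<close>)
  also have "\<dots> = 2 / real (Suc M) ^ (s - 1)" using tele by (simp add: sums_iff)
  finally show "zeta s - (\<Sum>e=1..M. 1 / real e ^ s) \<le> 2 / real (Suc M) ^ (s - 1)" using tail by simp
qed

lemma zeta_ge_1: "s = 2 \<or> s = (3::nat) \<Longrightarrow> zeta s \<ge> 1"
  using zeta_tail(1)[of s 1] by simp

text \<open>Let \<open>Z M\<close> denote the partial sums of the zeta series. Grouping \<open>n = d e \<le> N\<close> by the value of \<open>n\<close> gives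
\<open>\<Sum>\<^sub>d \<mu>(d) d\<^sup>-\<^sup>s Z(N/d) = 1\<close> exactly. Replacing each \<open>Z(N/d)\<close> by \<open>\<zeta>(s)\<close> costs
\<open>O(d\<^sup>-\<^sup>s (d/N)\<^sup>s\<^sup>-\<^sup>1) = O(N\<^sup>1\<^sup>-\<^sup>s/d)\<close>. This finite identity avoids products of infinite series.\<close>

lemma sum_mu_power_approx:
  assumes s: "s = 2 \<or> s = (3::nat)" and N: "N \<ge> 1"
  shows "\<bar>(\<Sum>d=1..N. mu d / real d ^ s) - 1 / zeta s\<bar> \<le> 2 * (1 + ln (real N)) / real N ^ (s - 1)"
proof -
  let ?Z = "\<lambda>M. \<Sum>e=1..M. 1 / real e ^ s"
  have one: "(\<Sum>d=1..N. mu d / real d ^ s * ?Z (N div d)) = 1"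
  proof -
    have "(\<Sum>d=1..N. mu d / real d ^ s * ?Z (N div d))
        = (\<Sum>d=1..N. \<Sum>n | n \<in> {1..N} \<and> d dvd n. mu d / real n ^ s)"
    proof (rule sum.cong[OF refl])
      fix d assume d: "d \<in> {1..N}"
      have "{n. n \<in> {1..N} \<and> d dvd n} = (\<lambda>e. d * e) ` {1..N div d}"
      proof (intro equalityI subsetI)
        fix n assume n: "n \<in> {n. n \<in> {1..N} \<and> d dvd n}"
        then obtain e where e: "n = d * e" by (auto simp: dvd_def)
        hence "e \<in> {1..N div d}" using n d by (auto simp: less_eq_div_iff_mult_less_eq mult.commute Suc_le_eq)
        thus "n \<in> (\<lambda>e. d * e) ` {1..N div d}" using e by blast
      next
        fix n assume "n \<in> (\<lambda>e. d * e) ` {1..N div d}"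
        then obtain e where "n = d * e" "e \<in> {1..N div d}" by blast
        thus "n \<in> {n. n \<in> {1..N} \<and> d dvd n}"
          using d by (auto simp: less_eq_div_iff_mult_less_eq mult.commute Suc_le_eq)
      qed
      hence "(\<Sum>n | n \<in> {1..N} \<and> d dvd n. mu d / real n ^ s) = (\<Sum>e=1..N div d. mu d / real (d * e) ^ s)"
        using d by (simp add: sum.reindex inj_on_def)
      also have "\<dots> = mu d / real d ^ s * ?Z (N div d)"
        by (simp add: sum_distrib_left power_mult_distrib)
      finally show "mu d / real d ^ s * ?Z (N div d) = (\<Sum>n | n \<in> {1..N} \<and> d dvd n. mu d / real n ^ s)" by simp
    qed
    also have "\<dots> = (\<Sum>n=1..N. \<Sum>d | d \<in> {1..N} \<and> d dvd n. mu d / real n ^ s)"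
      by (rule sum.swap_restrict) auto
    also have "\<dots> = (\<Sum>n=1..N. (if n = 1 then 1 else 0))"
    proof (rule sum.cong[OF refl])
      fix n assume n: "n \<in> {1..N}"
      have "{d. d \<in> {1..N} \<and> d dvd n} = {d. d dvd n}"
        using n by (auto dest: dvd_imp_le intro!: Nat.gr0I simp: Suc_le_eq)
      thus "(\<Sum>d | d \<in> {1..N} \<and> d dvd n. mu d / real n ^ s) = (if n = 1 then 1 else 0)"
        using sum_mu_divisors[of n] n by (simp add: sum_divide_distrib[symmetric])
    qed
    also have "\<dots> = 1" using N by simp
    finally show ?thesis .
  qed
  let ?M = "\<Sum>d=1..N. mu d / real d ^ s"
  have "zeta s * ?M - 1 = ?M * zeta s - (\<Sum>d=1..N. mu d / real d ^ s * ?Z (N div d))"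
    by (simp only: one mult.commute)
  also have "\<dots> = (\<Sum>d=1..N. mu d / real d ^ s * (zeta s - ?Z (N div d)))"
    by (simp only: sum_distrib_right sum_subtractf right_diff_distrib)
  finally have "zeta s * ?M - 1 = \<dots>" .
  hence "\<bar>zeta s * ?M - 1\<bar> = \<bar>\<Sum>d=1..N. mu d / real d ^ s * (zeta s - ?Z (N div d))\<bar>" by (simp only:)
  also have "\<dots> \<le> (\<Sum>d=1..N. 2 / real N ^ (s - 1) * (1 / real d))"
  proof (rule order_trans[OF sum_abs sum_mono])
    fix d assume d: "d \<in> {1..N}"
    have dN: "real N \<le> real d * real (Suc (N div d))"
    proof -
      have "N < d * Suc (N div d)" using d dividend_less_times_div[of d N] by simp
      thus ?thesis by (metis less_imp_le of_nat_le_iff of_nat_mult)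
    qed
    have "\<bar>mu d / real d ^ s * (zeta s - ?Z (N div d))\<bar> = \<bar>mu d\<bar> * (1 / real d ^ s * (zeta s - ?Z (N div d)))"
      using zeta_tail(1)[OF s, of "N div d"] by (simp add: abs_mult)
    also have "\<dots> \<le> 1 * (1 / real d ^ s * (2 / real (Suc (N div d)) ^ (s - 1)))"
      using zeta_tail[OF s, of "N div d"] abs_mu_le by (intro mult_mono) auto
    also have "\<dots> = 2 / (real d * (real d * real (Suc (N div d))) ^ (s - 1))"
      using s by (elim disjE) (simp_all add: power_mult_distrib power2_eq_square power3_eq_cube)
    also have "\<dots> \<le> 2 / (real d * real N ^ (s - 1))"
      using d N dN by (intro divide_left_mono mult_left_mono power_mono mult_pos_pos) auto
    finally show "\<bar>mu d / real d ^ s * (zeta s - ?Z (N div d))\<bar> \<le> 2 / real N ^ (s - 1) * (1 / real d)"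
      by (simp add: mult.commute)
  qed
  also have "\<dots> \<le> 2 / real N ^ (s - 1) * (1 + ln (real N))"
    unfolding sum_distrib_left[symmetric] using sum_inverse_le_ln[OF N] by (intro mult_left_mono) auto
  finally have 1: "\<bar>zeta s * ?M - 1\<bar> \<le> 2 * (1 + ln (real N)) / real N ^ (s - 1)" by simp
  have z: "zeta s \<ge> 1" using zeta_ge_1[OF s] .
  have "\<bar>?M - 1 / zeta s\<bar> \<le> \<bar>zeta s * ?M - 1\<bar>"
  proof -
    have "zeta s * ?M - 1 = zeta s * (?M - 1 / zeta s)" using z by (simp add: algebra_simps)
    hence "\<bar>zeta s * ?M - 1\<bar> = zeta s * \<bar>?M - 1 / zeta s\<bar>" using z by (simp add: abs_mult)
    thus ?thesis using z mult_right_mono[of 1 "zeta s" "\<bar>?M - 1 / zeta s\<bar>"] by simp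
  qed
  thus ?thesis using 1 by linarith
qed

lemma card_primitive_moebius:
  fixes g :: "'a \<Rightarrow> nat"
  assumes "finite Z" and g: "\<And>z. z \<in> Z \<Longrightarrow> 0 < g z \<and> g z \<le> D"
  shows "real (card {z \<in> Z. g z = 1}) = (\<Sum>d=1..D. mu d * real (card {z \<in> Z. d dvd g z}))"
proof -
  have "(\<Sum>d=1..D. mu d * real (card {z \<in> Z. d dvd g z})) = (\<Sum>d=1..D. \<Sum>z | z \<in> Z \<and> d dvd g z. mu d)"
    by (simp add: mult.commute)
  also have "\<dots> = (\<Sum>z\<in>Z. \<Sum>d | d \<in> {1..D} \<and> d dvd g z. mu d)"
    using assms(1) by (intro sum.swap_restrict) auto
  also have "\<dots> = (\<Sum>z\<in>Z. if g z = 1 then 1 else 0)"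
  proof (rule sum.cong[OF refl])
    fix z assume "z \<in> Z"
    hence gz: "0 < g z" "g z \<le> D" using g by auto
    have "{d. d \<in> {1..D} \<and> d dvd g z} = {d. d dvd g z}"
    proof (rule Collect_cong)
      fix d
      have "1 \<le> d" "d \<le> g z" if "d dvd g z"
        using dvd_pos_nat[OF gz(1) that] dvd_imp_le[OF that gz(1)] by auto
      thus "(d \<in> {1..D} \<and> d dvd g z) = (d dvd g z)" using gz(2) by (metis atLeastAtMost_iff order_trans)
    qed
    thus "(\<Sum>d | d \<in> {1..D} \<and> d dvd g z. mu d) = (if g z = 1 then 1 else 0)"
      using sum_mu_divisors[OF gz(1)] by simp
  qed
  also have "\<dots> = real (card {z \<in> Z. g z = 1})"
    using assms(1) by (simp add: sum.If_cases Int_def)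
  finally show ?thesis by simp
qed

section \<open>Lattice points in ellipsoids\<close>

abbreviation realv :: "int ^ 'n \<Rightarrow> real ^ 'n::finite" where
  "realv z \<equiv> (\<chi> i. of_int (z $ i))"

text \<open>The set is the preimage of a ball under an invertible linear map.\<close>

lemma measure_ellipsoid:
  fixes A :: "real ^ 'n::{finite,wellorder} ^ 'n::_"
  assumes A: "det A \<noteq> 0" and r: "r \<ge> 0"
  shows "{x. norm (A *v x) \<le> r} \<in> lmeasurable"
    and "measure lebesgue {x. norm (A *v x) \<le> r} = unit_ball_vol (real CARD('n)) * r ^ CARD('n) / \<bar>det A\<bar>"
proof -
  obtain A' where A': "A' ** A = mat 1" "A ** A' = mat 1"
    using A invertible_det_nz[of A] by (auto simp: invertible_def)
  have e: "{x. norm (A *v x) \<le> r} = (*v) A' ` cball 0 r"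
  proof (intro equalityI subsetI)
    fix x assume "x \<in> {x. norm (A *v x) \<le> r}"
    moreover have "x = A' *v (A *v x)" by (simp add: matrix_vector_mul_assoc A')
    ultimately show "x \<in> (*v) A' ` cball 0 r" by (auto simp: image_iff intro!: bexI[of _ "A *v x"])
  next
    fix x assume "x \<in> (*v) A' ` cball 0 r"
    thus "x \<in> {x. norm (A *v x) \<le> r}" by (auto simp: matrix_vector_mul_assoc A')
  qed
  have lin: "linear ((*v) A')" by (rule matrix_vector_mul_linear)
  show "{x. norm (A *v x) \<le> r} \<in> lmeasurable"
    unfolding e by (rule measurable_linear_image[OF lin lmeasurable_cball])
  have "det A' * det A = 1" using A' det_mul[of A' A] by simp
  hence d: "\<bar>det A'\<bar> = 1 / \<bar>det A\<bar>" using A by (simp add: field_simps abs_mult[symmetric])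
  have "measure lebesgue {x. norm (A *v x) \<le> r} = \<bar>det (matrix ((*v) A'))\<bar> * measure lebesgue (cball (0::real^'n::_) r)"
    unfolding e by (rule measure_linear_image[OF lin lmeasurable_cball])
  also have "measure lebesgue (cball (0::real^'n::_) r) = unit_ball_vol (real CARD('n)) * r ^ CARD('n)"
    using content_cball[of r "0::real^'n::_"] r by (simp add: measure_completion)
  finally show "measure lebesgue {x. norm (A *v x) \<le> r} = unit_ball_vol (real CARD('n)) * r ^ CARD('n) / \<bar>det A\<bar>"
    by (simp add: d matrix_of_matrix_vector_mul)
qed

text \<open>Put a unit cube around every lattice point. A point of the cube differs from its centre by a vector
whose image under \<open>A\<close> has norm at most \<open>c\<close>. So the cubes around the points of \<open>Z r\<close> lie in the ellipsoid
of radius \<open>r + c\<close>, which bounds their number from above, and they cover that of radius \<open>r - c\<close>, which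
bounds it from below. Open cubes are used for the packing, closed ones for the covering.\<close>

lemma lattice_points_ellipsoid:
  fixes A :: "real ^ 'n::{finite,wellorder} ^ 'n::_"
  assumes A: "det A \<noteq> 0" and c: "\<And>u. (\<And>i. \<bar>u $ i\<bar> \<le> 1/2) \<Longrightarrow> norm (A *v u) \<le> c"
  defines "Z r \<equiv> {z :: int ^ 'n::_. norm (A *v realv z) \<le> r}"
    and "\<omega> \<equiv> unit_ball_vol (real CARD('n)) / \<bar>det A\<bar>"
  assumes r: "r \<ge> 0"
  shows "finite (Z r)" and "real (card (Z r)) \<le> \<omega> * (r + c) ^ CARD('n)"
    and "c \<le> r \<Longrightarrow> \<omega> * (r - c) ^ CARD('n) \<le> real (card (Z r))"
proof -
  let ?h = "(\<chi> i. 1/2) :: real ^ 'n::_"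
  let ?E = "\<lambda>r. {x. norm (A *v x) \<le> r}"
  let ?b = "\<lambda>z. box (realv z - ?h) (realv z + ?h)" and ?c = "\<lambda>z. cbox (realv z - ?h) (realv z + ?h)"
  have c0: "c \<ge> 0" using c[of 0] by simp
  have vol: "measure lebesgue (?b z) = 1" "measure lebesgue (?c z) = 1" for z :: "int ^ 'n::_"
  proof -
    have "?c z \<noteq> {}" by (simp add: interval_eq_empty_cart)
    hence "measure lborel (?c z) = (\<Prod>i\<in>(UNIV :: 'n set). 1)"
      by (subst content_cbox_cart) (auto intro!: prod.cong)
    thus c: "measure lebesgue (?c z) = 1" by (simp add: measure_completion)
    have "measure lborel (?b z) = measure lborel (?c z)"
      by (simp only: measure_lborel_box_eq measure_lborel_cbox_eq)
    thus "measure lebesgue (?b z) = 1" using c by (simp add: measure_completion)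
  qed
  have mem_c: "x \<in> ?c z \<longleftrightarrow> (\<forall>i. \<bar>(x - realv z) $ i\<bar> \<le> 1/2)" for x and z :: "int ^ 'n::_"
  proof -
    have "(realv z - ?h) $ i \<le> x $ i \<and> x $ i \<le> (realv z + ?h) $ i \<longleftrightarrow> \<bar>(x - realv z) $ i\<bar> \<le> 1/2" for i
    proof -
      have "(w - 1/2 \<le> y \<and> y \<le> w + 1/2) \<longleftrightarrow> \<bar>y - w\<bar> \<le> 1/2" for w y :: real
      proof
        assume "w - 1/2 \<le> y \<and> y \<le> w + 1/2"
        hence "w - 1/2 \<le> y" "y \<le> w + 1/2" by auto
        thus "\<bar>y - w\<bar> \<le> 1/2" by linarith
      next
        assume "\<bar>y - w\<bar> \<le> 1/2"
        thus "w - 1/2 \<le> y \<and> y \<le> w + 1/2" by linarith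
      qed
      thus ?thesis by simp
    qed
    thus ?thesis unfolding mem_box_cart by simp
  qed
  have bc: "?b z \<subseteq> ?c z" for z by (rule box_subset_cbox)
  have near: "\<bar>norm (A *v x) - norm (A *v realv z)\<bar> \<le> c" if "x \<in> ?c z" for x and z :: "int ^ 'n::_"
  proof -
    have "norm (A *v (x - realv z)) \<le> c" using that c unfolding mem_c by blast
    thus ?thesis using norm_triangle_ineq3[of "A *v x" "A *v realv z"] by (simp add: matrix_vector_mult_diff_distrib)
  qed
  have disj: "?b z \<inter> ?b z' = {}" if ne: "z \<noteq> z'" for z z' :: "int ^ 'n::_"
  proof -
    obtain i where i: "z $ i \<noteq> z' $ i" using ne unfolding vec_eq_iff by blast
    have False if x: "x \<in> ?b z" "x \<in> ?b z'" for x
    proof -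
      have "of_int (z $ i) - 1/2 < x $ i" "x $ i < of_int (z $ i) + 1/2"
        "of_int (z' $ i) - 1/2 < x $ i" "x $ i < of_int (z' $ i) + 1/2"
        using x(1)[unfolded mem_box_cart, rule_format, of i] x(2)[unfolded mem_box_cart, rule_format, of i]
        by simp_all
      hence "\<bar>z $ i - z' $ i\<bar> < 1" by linarith
      thus False using i by simp
    qed
    thus ?thesis by blast
  qed
  have up: "real (card S) \<le> \<omega> * (r + c) ^ CARD('n)" if S: "finite S" "S \<subseteq> Z r" for S
  proof -
    have bf: "emeasure lborel (?b z) \<noteq> top_class.top" for z :: "int ^ 'n::_"
      using emeasure_lborel_box_finite[of "realv z - ?h" "realv z + ?h"] by (metis infinity_ennreal_def less_irrefl)
    have "real (card S) = (\<Sum>z\<in>S. measure lebesgue (?b z))" by (simp add: vol)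
    also have "\<dots> = measure lebesgue (\<Union>z\<in>S. ?b z)"
      using S disj by (intro measure_finite_Union[symmetric]) (auto simp: disjoint_family_on_def bf)
    also have "\<dots> \<le> measure lebesgue (?E (r + c))"
    proof (rule measure_mono_fmeasurable)
      show "(\<Union>z\<in>S. ?b z) \<subseteq> ?E (r + c)"
      proof
        fix x assume "x \<in> (\<Union>z\<in>S. ?b z)"
        then obtain z where z: "z \<in> S" "x \<in> ?c z" using bc by blast
        thus "x \<in> ?E (r + c)" using near[OF z(2)] S by (auto simp: Z_def)
      qed
      show "?E (r + c) \<in> lmeasurable" using measure_ellipsoid[OF A] r c0 by simp
    qed (use S in auto)
    also have "\<dots> = \<omega> * (r + c) ^ CARD('n)"
      using measure_ellipsoid(2)[OF A, of "r + c"] r c0 by (simp add: \<omega>_def)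
    finally show ?thesis .
  qed
  show fin: "finite (Z r)"
  proof (rule ccontr)
    assume "infinite (Z r)"
    obtain k :: nat where k: "real k > \<omega> * (r + c) ^ CARD('n)" using reals_Archimedean2 by blast
    obtain S where "S \<subseteq> Z r" "finite S" "card S = k"
      using infinite_arbitrarily_large[OF \<open>infinite (Z r)\<close>] by blast
    thus False using up[of S] k by simp
  qed
  show "real (card (Z r)) \<le> \<omega> * (r + c) ^ CARD('n)" by (rule up[OF fin]) simp
  assume cr: "c \<le> r"
  have "\<omega> * (r - c) ^ CARD('n) = measure lebesgue (?E (r - c))"
    using measure_ellipsoid(2)[OF A, of "r - c"] cr by (simp add: \<omega>_def)
  also have "\<dots> \<le> measure lebesgue (\<Union>z\<in>Z r. ?c z)"
  proof (rule measure_mono_fmeasurable)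
    show "?E (r - c) \<subseteq> (\<Union>z\<in>Z r. ?c z)"
    proof
      fix x assume x: "x \<in> ?E (r - c)"
      define z where "z = (\<chi> i. round (x $ i))"
      have xz: "x \<in> ?c z"
        unfolding mem_c
      proof
        fix i
        show "\<bar>(x - realv z) $ i\<bar> \<le> 1/2"
          using of_int_round_abs_le[of "x $ i"] by (simp add: z_def abs_minus_commute)
      qed
      have "z \<in> Z r" using near[OF xz] x by (auto simp: Z_def)
      thus "x \<in> (\<Union>z\<in>Z r. ?c z)" using xz by blast
    qed
    show "?E (r - c) \<in> sets lebesgue" using measure_ellipsoid(1)[OF A, of "r - c"] cr by auto
    show "(\<Union>z\<in>Z r. ?c z) \<in> lmeasurable" using fin by (intro fmeasurable.finite_UN) auto
  qed
  also have "\<dots> \<le> (\<Sum>z\<in>Z r. measure lebesgue (?c z))"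
    using fin by (intro measure_UNION_le) auto
  also have "\<dots> = real (card (Z r))" by (simp add: vol)
  finally show "\<omega> * (r - c) ^ CARD('n) \<le> real (card (Z r))" .
qed

lemma norm_le_iff_sum_squares:
  fixes x :: "real ^ 'n"
  assumes "r \<ge> 0"
  shows "norm x \<le> r \<longleftrightarrow> (\<Sum>i\<in>UNIV. (x $ i)\<^sup>2) \<le> r\<^sup>2"
proof -
  have "norm x = sqrt (\<Sum>i\<in>UNIV. (x $ i)\<^sup>2)" by (simp add: norm_vec_def L2_set_def)
  moreover have "r = sqrt (r\<^sup>2)" using assms by simp
  ultimately show ?thesis by (metis real_sqrt_le_iff)
qed

section \<open>Primitive vectors in ellipses\<close>

text \<open>Cubes of the lattice have \<open>c = 1/(2U) + 1/(2V)\<close>, so the error is about \<open>2 \<pi> U V c = \<pi> (U + V)\<close>.\<close>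

lemma count_ellipse:
  fixes U V :: real
  assumes U: "U \<ge> 1" and V: "V \<ge> 1"
  defines "Z \<equiv> {(k :: int, l :: int). (k / U)\<^sup>2 + (l / V)\<^sup>2 \<le> 1}"
  shows "finite Z" and "\<bar>real (card Z) - pi * U * V\<bar> \<le> 6 * (U + V)"
proof -
  define A :: "real ^ 2 ^ 2" where "A = vector [vector [1 / U, 0], vector [0, 1 / V]]"
  define c where "c = 1 / (2 * U) + 1 / (2 * V)"
  have det: "det A = 1 / (U * V)" by (simp add: A_def det_2)
  hence det0: "det A \<noteq> 0" using U V by simp
  have Av: "norm (A *v v) \<le> r \<longleftrightarrow> (v $ 1 / U)\<^sup>2 + (v $ 2 / V)\<^sup>2 \<le> r\<^sup>2" if "r \<ge> 0" for v :: "real ^ 2" and r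
    by (simp add: norm_le_iff_sum_squares[OF that] A_def matrix_vector_mult_def sum_2)
  have c0: "0 \<le> c" using U V by (simp add: c_def)
  have "1 / (2 * U) \<le> 1 / 2" "1 / (2 * V) \<le> 1 / 2" using U V by (auto intro!: divide_left_mono)
  hence c1: "c \<le> 1" by (simp add: c_def)
  have cube: "norm (A *v u) \<le> c" if u: "\<And>i. \<bar>u $ i\<bar> \<le> 1/2" for u :: "real ^ 2"
  proof -
    have sq: "(t / T)\<^sup>2 \<le> (1 / (2 * T))\<^sup>2" if "\<bar>t\<bar> \<le> 1/2" "T \<ge> 1" for t T :: real
    proof -
      have "\<bar>t\<bar> / T \<le> (1 / 2) / T" using that by (intro divide_right_mono) auto
      hence "\<bar>t / T\<bar> \<le> \<bar>1 / (2 * T)\<bar>" using that by (simp add: abs_divide)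
      thus ?thesis by (simp only: abs_le_square_iff)
    qed
    have "(u $ 1 / U)\<^sup>2 + (u $ 2 / V)\<^sup>2 \<le> (1 / (2 * U))\<^sup>2 + (1 / (2 * V))\<^sup>2"
      by (intro add_mono sq u U V)
    also have "\<dots> \<le> c\<^sup>2" using U V by (simp add: c_def power2_sum)
    finally show ?thesis using Av[OF c0] by blast
  qed
  define v :: "int ^ 2 \<Rightarrow> int \<times> int" where "v z = (z $ 1, z $ 2)" for z
  let ?Z = "{z :: int ^ 2. norm (A *v realv z) \<le> 1}"
  have inj: "inj_on v ?Z" by (auto simp: inj_on_def v_def vec_eq_iff forall_2)
  have im: "v ` ?Z = Z"
  proof (intro equalityI subsetI)
    fix p assume "p \<in> Z"
    then obtain k l where p: "p = (k, l)" "(k / U)\<^sup>2 + (l / V)\<^sup>2 \<le> 1" by (auto simp: Z_def)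
    have "vector [k, l] \<in> ?Z" using p(2) by (simp add: Av)
    moreover have "p = v (vector [k, l])" by (simp add: p v_def)
    ultimately show "p \<in> v ` ?Z" by blast
  qed (auto simp: Av v_def Z_def)
  note L = lattice_points_ellipsoid[OF det0 cube, of 1]
  show "finite Z" using L(1) im by (metis finite_imageI zero_le_one)
  have card: "card Z = card ?Z" using card_image[OF inj] im by simp
  define w where "w = pi * U * V"
  have vol: "unit_ball_vol (real CARD(2)) / \<bar>det A\<bar> = w"
    using U V by (simp add: det unit_ball_vol_2 w_def)
  have "real (card Z) \<le> w * (1 + c)\<^sup>2" using L(2)[unfolded vol] by (simp add: card)
  moreover have "w * (1 - c)\<^sup>2 \<le> real (card Z)" using L(3)[unfolded vol] c1 by (simp add: card)
  moreover have w0: "w \<ge> 0" using U V by (simp add: w_def)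
  moreover have wc: "w * c = pi * (U + V) / 2" using U V by (simp add: w_def c_def field_simps)
  moreover have "w * c\<^sup>2 \<le> w * c" using w0 c0 c1 by (simp add: mult_left_mono power2_eq_square mult_left_le)
  moreover have "w * c\<^sup>2 \<ge> 0" using w0 by simp
  moreover have "w * (1 + c)\<^sup>2 = w + 2 * (w * c) + w * c\<^sup>2" "w * (1 - c)\<^sup>2 = w - 2 * (w * c) + w * c\<^sup>2"
    by (simp_all add: power2_eq_square algebra_simps)
  moreover have "pi * (U + V) \<le> 4 * (U + V)" using pi_less_4 U V by (intro mult_right_mono) auto
  ultimately show "\<bar>real (card Z) - pi * U * V\<bar> \<le> 6 * (U + V)"
    unfolding w_def[symmetric] by linarith
qed

lemma card_int_abs_le:
  assumes "V \<ge> 1"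
  shows "finite {l :: int. \<bar>real_of_int l\<bar> \<le> V}" "real (card {l :: int. \<bar>real_of_int l\<bar> \<le> V}) \<le> 3 * V"
proof -
  have e: "{l :: int. \<bar>real_of_int l\<bar> \<le> V} = {- \<lfloor>V\<rfloor>..\<lfloor>V\<rfloor>}" by (auto simp: le_floor_iff abs_le_iff) linarith+
  show "finite {l :: int. \<bar>real_of_int l\<bar> \<le> V}" unfolding e by simp
  have "\<lfloor>V\<rfloor> \<ge> 1" using assms by (simp add: le_floor_iff)
  hence "real (card {l :: int. \<bar>real_of_int l\<bar> \<le> V}) = 2 * real_of_int \<lfloor>V\<rfloor> + 1" unfolding e by simp
  thus "real (card {l :: int. \<bar>real_of_int l\<bar> \<le> V}) \<le> 3 * V"
    using of_int_floor_le[of V] assms by linarith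
qed

text \<open>The axes are left out. This makes the set empty as soon as a semi-axis is shorter than \<open>1\<close>, and it
bounds the divisors \<open>d\<close> in the Moebius inversion by the shorter semi-axis.\<close>

definition E2 :: "real \<Rightarrow> real \<Rightarrow> (int \<times> int) set" where
  "E2 U V = {(k, l). k \<noteq> 0 \<and> l \<noteq> 0 \<and> (k / U)\<^sup>2 + (l / V)\<^sup>2 \<le> 1}"

lemma square_quotient_le_1: "T > 0 \<Longrightarrow> (t / T)\<^sup>2 \<le> 1 \<Longrightarrow> \<bar>t\<bar> \<le> (T :: real)"
  by (simp add: abs_square_le_1 abs_divide)

lemma E2_bounds:
  assumes "(k, l) \<in> E2 U V" "U > 0" "V > 0"
  shows "\<bar>real_of_int k\<bar> \<le> U" "\<bar>real_of_int l\<bar> \<le> V"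
proof -
  have "(k / U)\<^sup>2 + (l / V)\<^sup>2 \<le> 1" using assms by (simp add: E2_def)
  hence "(k / U)\<^sup>2 \<le> 1" "(l / V)\<^sup>2 \<le> 1" using zero_le_power2[of "k / U"] zero_le_power2[of "l / V"] by linarith+
  thus "\<bar>real_of_int k\<bar> \<le> U" "\<bar>real_of_int l\<bar> \<le> V" using assms square_quotient_le_1 by blast+
qed

lemma E2_empty: "U > 0 \<Longrightarrow> V > 0 \<Longrightarrow> U < 1 \<or> V < 1 \<Longrightarrow> E2 U V = {}"
proof -
  assume a: "U > 0" "V > 0" "U < 1 \<or> V < 1"
  have False if "(k, l) \<in> E2 U V" for k l
  proof -
    have "\<bar>k\<bar> \<ge> 1" "\<bar>l\<bar> \<ge> 1" using that by (auto simp: E2_def)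
    hence "\<bar>real_of_int k\<bar> \<ge> 1" "\<bar>real_of_int l\<bar> \<ge> 1" by linarith+
    thus False using E2_bounds[OF that a(1,2)] a(3) by linarith
  qed
  thus ?thesis by auto
qed

lemma count_E2:
  assumes U: "U \<ge> 1" and V: "V \<ge> 1"
  shows "finite (E2 U V)" "\<bar>real (card (E2 U V)) - pi * U * V\<bar> \<le> 9 * (U + V)"
proof -
  let ?Z = "{(k :: int, l :: int). (k / U)\<^sup>2 + (l / V)\<^sup>2 \<le> 1}"
  let ?a = "(\<lambda>l. (0 :: int, l)) ` {l :: int. \<bar>real_of_int l\<bar> \<le> V}" and ?b = "(\<lambda>k. (k, 0 :: int)) ` {k :: int. \<bar>real_of_int k\<bar> \<le> U}"
  note C = count_ellipse[OF U V]
  have sub: "E2 U V \<subseteq> ?Z" by (auto simp: E2_def)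
  show fin: "finite (E2 U V)" using finite_subset[OF sub C(1)] .
  have "?Z \<subseteq> E2 U V \<union> (?a \<union> ?b)"
    using U V square_quotient_le_1[of U] square_quotient_le_1[of V] by (auto simp: E2_def image_iff)
  moreover have "finite (E2 U V \<union> (?a \<union> ?b))"
    using fin card_int_abs_le(1)[OF U] card_int_abs_le(1)[OF V] by blast
  ultimately have "card ?Z \<le> card (E2 U V \<union> (?a \<union> ?b))" by (intro card_mono)
  also have "\<dots> \<le> card (E2 U V) + (card ?a + card ?b)"
    using card_Un_le[of "E2 U V" "?a \<union> ?b"] card_Un_le[of ?a ?b] by linarith
  finally have 1: "card ?Z \<le> card (E2 U V) + (card ?a + card ?b)" .
  have "card ?a \<le> card {l :: int. \<bar>real_of_int l\<bar> \<le> V}" "card ?b \<le> card {l :: int. \<bar>real_of_int l\<bar> \<le> U}"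
    by (intro card_image_le card_int_abs_le U V)+
  hence ab: "real (card ?a) \<le> 3 * V" "real (card ?b) \<le> 3 * U"
    using card_int_abs_le(2)[OF U] card_int_abs_le(2)[OF V] by linarith+
  have up: "real (card ?Z) \<le> real (card (E2 U V)) + (real (card ?a) + real (card ?b))"
    using 1 by (simp only: of_nat_add[symmetric] of_nat_le_iff)
  have lo: "real (card (E2 U V)) \<le> real (card ?Z)" using card_mono[OF C(1) sub] by simp
  have "\<bar>e - w\<bar> \<le> 9 * (U + V)"
    if "e \<le> z" "z \<le> e + (a + b)" "a \<le> 3 * V" "b \<le> 3 * U" "\<bar>z - w\<bar> \<le> 6 * (U + V)" for e z a b w :: real
  proof -
    have "z - w \<le> 6 * U + 6 * V" "w - z \<le> 6 * U + 6 * V" using that(5) by (auto simp: abs_le_iff)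
    hence "e - w \<le> 9 * U + 9 * V" "w - e \<le> 9 * U + 9 * V" using that(1-4) U V by linarith+
    thus ?thesis by (simp add: abs_le_iff)
  qed
  from this[OF lo up ab C(2)] show "\<bar>real (card (E2 U V)) - pi * U * V\<bar> \<le> 9 * (U + V)" .
qed

definition PE2 :: "real \<Rightarrow> real \<Rightarrow> (int \<times> int) set" where
  "PE2 U V = {(k, l) \<in> E2 U V. gcd k l = 1}"

lemma zeta_2_bounds: "1 \<le> zeta 2" "zeta 2 \<le> 2"
  using zeta_ge_1[of 2] zeta_tail(2)[of 2 0] by simp_all

lemma zeta_3_bounds: "1 \<le> zeta 3" "zeta 3 \<le> 2"
  using zeta_ge_1[of 3] zeta_tail(2)[of 3 0] by simp_all

lemma floor_half:
  assumes "t \<ge> (1 :: real)"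
  shows "nat \<lfloor>t\<rfloor> \<ge> 1" "real (nat \<lfloor>t\<rfloor>) \<le> t" "t \<le> 2 * real (nat \<lfloor>t\<rfloor>)" "real n \<le> t \<Longrightarrow> n \<le> nat \<lfloor>t\<rfloor>"
proof -
  have f: "\<lfloor>t\<rfloor> \<ge> 1" using assms by (simp add: le_floor_iff)
  hence r: "real (nat \<lfloor>t\<rfloor>) = real_of_int \<lfloor>t\<rfloor>" by simp
  show "nat \<lfloor>t\<rfloor> \<ge> 1" using f by linarith
  show "real (nat \<lfloor>t\<rfloor>) \<le> t" unfolding r by simp
  show "t \<le> 2 * real (nat \<lfloor>t\<rfloor>)" unfolding r using f by linarith
  show "n \<le> nat \<lfloor>t\<rfloor>" if "real n \<le> t" using that by (simp add: le_nat_floor)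
qed

text \<open>Vectors divisible by \<open>d\<close> correspond to vectors in the ellipse shrunk by \<open>d\<close>, whose count has error
\<open>O((U + V)/d)\<close>; summing over \<open>d\<close> gives the logarithm. The Moebius sum is cut off at the length \<open>D\<close> of
the shorter semi-axis, and the resulting error in \<open>1/\<zeta>(2)\<close> is \<open>O(U V (log D)/D) = O((U + V) log D)\<close>.\<close>

lemma count_PE2:
  assumes U: "U \<ge> 1" and V: "V \<ge> 1"
  shows "\<bar>real (card (PE2 U V)) - pi * U * V / zeta 2\<bar> \<le> 25 * (U + V) * (1 + ln U)"
proof -
  define D where "D = nat \<lfloor>min U V\<rfloor>"
  have m: "min U V \<ge> 1" using U V by simp
  note D = floor_half(1-3)[OF m, folded D_def]
  define g :: "int \<times> int \<Rightarrow> nat" where "g = (\<lambda>(k, l). nat (gcd k l))"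
  have UV: "U > 0" "V > 0" using U V by auto
  have g: "0 < g z \<and> g z \<le> D" if z: "z \<in> E2 U V" for z
  proof -
    obtain k l where kl: "z = (k, l)" by (cases z)
    have nz: "k \<noteq> 0" "l \<noteq> 0" using z by (auto simp: kl E2_def)
    have "gcd k l \<le> \<bar>k\<bar>" "gcd k l \<le> \<bar>l\<bar>" using nz by (auto intro: zdvd_imp_le simp: gcd_le1_int gcd_le2_int)
    hence "real_of_int (gcd k l) \<le> \<bar>real_of_int k\<bar>" "real_of_int (gcd k l) \<le> \<bar>real_of_int l\<bar>" by linarith+
    hence "real_of_int (gcd k l) \<le> min U V" using E2_bounds[of k l U V] z UV kl by auto
    hence "real (nat (gcd k l)) \<le> min U V" by simp
    thus ?thesis using floor_half(4)[OF m] nz by (simp add: g_def kl D_def gcd_pos_int)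
  qed
  have scale: "card {z \<in> E2 U V. d dvd g z} = card (E2 (U / d) (V / d))" if d: "d \<in> {1..D}" for d
  proof -
    have "{z \<in> E2 U V. d dvd g z} = (\<lambda>(k, l). (int d * k, int d * l)) ` E2 (U / d) (V / d)"
    proof (intro equalityI subsetI)
      fix z assume z: "z \<in> {z \<in> E2 U V. d dvd g z}"
      obtain k l where kl: "z = (k, l)" by (cases z)
      have "int d dvd gcd k l" using z by (simp add: kl g_def nat_dvd_iff int_dvd_int_iff[symmetric] del: int_dvd_int_iff)
      hence "int d dvd k" "int d dvd l" by auto
      then obtain k' l' where kl': "k = int d * k'" "l = int d * l'" by (auto simp: dvd_def)
      have "(k', l') \<in> E2 (U / d) (V / d)" using z by (auto simp: kl kl' E2_def mult.commute)
      thus "z \<in> (\<lambda>(k, l). (int d * k, int d * l)) ` E2 (U / d) (V / d)" by (auto simp: kl kl' image_iff intro!: bexI[of _ "(k', l')"])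
    next
      fix z assume "z \<in> (\<lambda>(k, l). (int d * k, int d * l)) ` E2 (U / d) (V / d)"
      then obtain k l where kl: "z = (int d * k, int d * l)" "(k, l) \<in> E2 (U / d) (V / d)" by auto
      have "int d dvd gcd (int d * k) (int d * l)" by simp
      hence "d dvd g z" by (simp add: kl g_def nat_dvd_iff int_dvd_int_iff[symmetric] del: int_dvd_int_iff)
      moreover have "z \<in> E2 U V" using kl d by (auto simp: E2_def mult.commute)
      ultimately show "z \<in> {z \<in> E2 U V. d dvd g z}" by simp
    qed
    moreover have "inj_on (\<lambda>(k, l). (int d * k, int d * l)) (E2 (U / d) (V / d))" using d by (auto simp: inj_on_def)
    ultimately show ?thesis by (simp add: card_image)
  qed
  have PE2: "PE2 U V = {z \<in> E2 U V. g z = 1}" by (auto simp: PE2_def g_def)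
  define M where "M = (\<Sum>d=1..D. mu d / real d ^ 2)"
  have "real (card (PE2 U V)) = (\<Sum>d=1..D. mu d * real (card (E2 (U / d) (V / d))))"
    unfolding PE2 using card_primitive_moebius[OF count_E2(1)[OF U V] g] scale by simp
  moreover have "pi * U * V * M = (\<Sum>d=1..D. mu d * (pi * (U / d) * (V / d)))"
    unfolding M_def sum_distrib_left by (intro sum.cong) (auto simp: power2_eq_square)
  ultimately have "\<bar>real (card (PE2 U V)) - pi * U * V * M\<bar>
      = \<bar>\<Sum>d=1..D. mu d * (real (card (E2 (U / d) (V / d))) - pi * (U / d) * (V / d))\<bar>"
    by (simp add: sum_subtractf right_diff_distrib)
  also have "\<dots> \<le> (\<Sum>d=1..D. 9 * (U + V) * (1 / real d))"
  proof (rule order_trans[OF sum_abs sum_mono])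
    fix d assume d: "d \<in> {1..D}"
    have "real d \<le> real D" using d by simp
    hence "real d \<le> min U V" using D by linarith
    hence "U / d \<ge> 1" "V / d \<ge> 1" using d by auto
    hence "\<bar>real (card (E2 (U / d) (V / d))) - pi * (U / d) * (V / d)\<bar> \<le> 9 * (U / d + V / d)" by (rule count_E2(2))
    hence "\<bar>mu d\<bar> * \<bar>real (card (E2 (U / d) (V / d))) - pi * (U / d) * (V / d)\<bar> \<le> 1 * (9 * (U / d + V / d))"
      using abs_mu_le by (intro mult_mono) auto
    thus "\<bar>mu d * (real (card (E2 (U / d) (V / d))) - pi * (U / d) * (V / d))\<bar> \<le> 9 * (U + V) * (1 / real d)"
      by (simp add: abs_mult add_divide_distrib)
  qed
  also have "\<dots> = 9 * (U + V) * (\<Sum>d=1..D. 1 / real d)" by (simp only: sum_distrib_left)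
  also have "\<dots> \<le> 9 * (U + V) * (1 + ln (real D))"
    using sum_inverse_le_ln[OF D(1)] U V by (intro mult_left_mono) auto
  finally have 1: "\<bar>real (card (PE2 U V)) - pi * U * V * M\<bar> \<le> 9 * (U + V) * (1 + ln (real D))" .
  have ln0: "0 \<le> 1 + ln (real D)" using D(1) by simp
  have "\<bar>M - 1 / zeta 2\<bar> \<le> 2 * (1 + ln (real D)) / real D ^ (2 - 1)"
    unfolding M_def using sum_mu_power_approx[of 2 D] D(1) by simp
  hence "pi * U * V * \<bar>M - 1 / zeta 2\<bar> \<le> pi * U * V * (2 * (1 + ln (real D)) / real D)"
    using U V by (intro mult_left_mono) auto
  also have "\<dots> = pi * (2 * (1 + ln (real D))) * (U * V / real D)" by simp
  also have "U * V / real D \<le> 2 * (U + V)"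
  proof -
    have "U * V = min U V * max U V" by (simp add: min_def max_def)
    also have "\<dots> \<le> (2 * real D) * (U + V)" using D U V by (intro mult_mono) auto
    finally show ?thesis using D(1) by (simp add: divide_le_eq mult_ac)
  qed
  hence "pi * (2 * (1 + ln (real D))) * (U * V / real D) \<le> 4 * (2 * (1 + ln (real D))) * (2 * (U + V))"
    using pi_less_4 ln0 U V by (intro mult_mono) auto
  finally have "pi * U * V * \<bar>M - 1 / zeta 2\<bar> \<le> 16 * (U + V) * (1 + ln (real D))" by (simp add: algebra_simps)
  moreover have "\<bar>pi * U * V * M - pi * U * V / zeta 2\<bar> = pi * U * V * \<bar>M - 1 / zeta 2\<bar>"
  proof -
    have "pi * U * V * M - pi * U * V / zeta 2 = pi * U * V * (M - 1 / zeta 2)" by (simp add: right_diff_distrib)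
    thus ?thesis using U V by (simp add: abs_mult)
  qed
  ultimately have "\<bar>real (card (PE2 U V)) - pi * U * V / zeta 2\<bar> \<le> 25 * (U + V) * (1 + ln (real D))"
    using 1 by (simp add: distrib_right)
  also have "\<dots> \<le> 25 * (U + V) * (1 + ln U)"
    using D U V by (intro mult_left_mono add_left_mono) (auto simp: min_def split: if_splits)
  finally show ?thesis .
qed

lemma PE2_empty: "U > 0 \<Longrightarrow> V > 0 \<Longrightarrow> U < 1 \<or> V < 1 \<Longrightarrow> PE2 U V = {}"
  using E2_empty by (auto simp: PE2_def)

section \<open>Primitive vectors in ellipsoids\<close>

text \<open>The correlation \<open>c\<close> of the mixed term stays bounded by \<open>1/2\<close> in the application, so the ellipsoids
below are uniformly close to balls and all error constants are absolute.\<close>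

lemma form_ge:
  fixes c r s :: real
  assumes "\<bar>c\<bar> \<le> 1/2"
  shows "(r\<^sup>2 + s\<^sup>2) / 2 \<le> r\<^sup>2 + s\<^sup>2 + 2 * c * (r * s)"
proof -
  have "\<bar>2 * c * (r * s)\<bar> = \<bar>2 * c\<bar> * \<bar>r * s\<bar>" by (simp add: abs_mult)
  also have "\<dots> \<le> 1 * \<bar>r * s\<bar>" using assms by (intro mult_right_mono) auto
  finally have 1: "\<bar>2 * c * (r * s)\<bar> \<le> \<bar>r * s\<bar>" by simp
  have "0 \<le> (\<bar>r\<bar> - \<bar>s\<bar>)\<^sup>2" by simp
  also have "\<dots> = r\<^sup>2 + s\<^sup>2 - 2 * \<bar>r * s\<bar>" by (simp add: power2_diff abs_mult)
  finally have "2 * \<bar>r * s\<bar> \<le> r\<^sup>2 + s\<^sup>2" by simp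
  thus ?thesis using 1 by (simp add: abs_le_iff)
qed

text \<open>The volume of \<open>k\<^sup>2 + r\<^sup>2 + s\<^sup>2 + 2 c r s \<le> 1\<close>, a form of determinant \<open>1 - c\<^sup>2\<close>.\<close>

definition ellipsoid_vol :: "real \<Rightarrow> real" where
  "ellipsoid_vol c = 4 / 3 * pi / sqrt (1 - c\<^sup>2)"

lemma one_minus_square_ge:
  fixes c :: real
  assumes "\<bar>c\<bar> \<le> 1/2"
  shows "3 / 4 \<le> 1 - c\<^sup>2"
proof -
  have "\<bar>c\<bar> \<le> \<bar>1/2 :: real\<bar>" using assms by simp
  hence "c\<^sup>2 \<le> (1/2)\<^sup>2" by (simp only: abs_le_square_iff)
  thus ?thesis by (simp add: power2_eq_square)
qed

lemma ellipsoid_vol_bounds: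
  assumes "\<bar>c\<bar> \<le> 1/2"
  shows "0 \<le> ellipsoid_vol c" "ellipsoid_vol c \<le> 8"
proof -
  have 1: "3 / 4 \<le> 1 - c\<^sup>2" using assms by (rule one_minus_square_ge)
  have "(3 / 4 :: real) = sqrt ((3 / 4)\<^sup>2)" by simp
  also have "\<dots> \<le> sqrt (1 - c\<^sup>2)" using 1 by (intro real_sqrt_le_mono) (simp add: power2_eq_square)
  finally have s: "3 / 4 \<le> sqrt (1 - c\<^sup>2)" .
  show "0 \<le> ellipsoid_vol c" unfolding ellipsoid_vol_def using s 1 by (intro divide_nonneg_nonneg mult_nonneg_nonneg) auto
  have "ellipsoid_vol c \<le> (4 / 3 * pi) / (3 / 4)"
    unfolding ellipsoid_vol_def using s 1 by (intro divide_left_mono) auto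
  also have "\<dots> \<le> 8" using pi_less_4 by simp
  finally show "ellipsoid_vol c \<le> 8" .
qed

lemma count_ellipsoid:
  fixes c R :: real
  assumes c: "\<bar>c\<bar> \<le> 1/2" and R: "R \<ge> 1"
  defines "Z \<equiv> {(k :: int, r :: int, s :: int). (real_of_int k)\<^sup>2 + (real_of_int r)\<^sup>2 + (real_of_int s)\<^sup>2 + 2 * c * (real_of_int r * real_of_int s) \<le> R\<^sup>2}"
  shows "finite Z" and "\<bar>real (card Z) - ellipsoid_vol c * R ^ 3\<bar> \<le> 56 * R\<^sup>2"
proof -
  define d where "d = sqrt (1 - c\<^sup>2)"
  have c2: "3 / 4 \<le> 1 - c\<^sup>2" using c by (rule one_minus_square_ge)
  have d0: "d > 0" using c2 by (simp add: d_def)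
  have d2: "d\<^sup>2 = 1 - c\<^sup>2" using c2 by (simp add: d_def)
  \<comment> \<open>a square root of the form: \<open>r\<^sup>2 + s\<^sup>2 + 2 c r s = (r + c s)\<^sup>2 + (1 - c\<^sup>2) s\<^sup>2\<close>\<close>
  define A :: "real ^ 3 ^ 3" where "A = vector [vector [1, 0, 0], vector [0, 1, c], vector [0, 0, d]]"
  have det: "det A = d" by (simp add: A_def det_3)
  hence det0: "det A \<noteq> 0" using d0 by simp
  have Av: "norm (A *v v) \<le> r \<longleftrightarrow> (v $ 1)\<^sup>2 + (v $ 2)\<^sup>2 + (v $ 3)\<^sup>2 + 2 * c * (v $ 2 * v $ 3) \<le> r\<^sup>2"
    if "r \<ge> 0" for v :: "real ^ 3" and r
  proof -
    have "(\<Sum>i\<in>UNIV. ((A *v v) $ i)\<^sup>2) = (v $ 1)\<^sup>2 + (v $ 2 + c * v $ 3)\<^sup>2 + d\<^sup>2 * (v $ 3)\<^sup>2"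
      by (simp add: A_def matrix_vector_mult_def sum_3 power_mult_distrib)
    also have "\<dots> = (v $ 1)\<^sup>2 + (v $ 2)\<^sup>2 + (v $ 3)\<^sup>2 + 2 * c * (v $ 2 * v $ 3)"
      unfolding d2 by (simp add: power2_eq_square algebra_simps)
    finally show ?thesis by (simp only: norm_le_iff_sum_squares[OF that])
  qed
  have cube: "norm (A *v u) \<le> 1" if u: "\<And>i. \<bar>u $ i\<bar> \<le> 1/2" for u :: "real ^ 3"
  proof -
    have sq: "t\<^sup>2 \<le> 1 / 4" if "\<bar>t\<bar> \<le> 1/2" for t :: real
    proof -
      have "\<bar>t\<bar> \<le> \<bar>1/2 :: real\<bar>" using that by simp
      hence "t\<^sup>2 \<le> (1/2)\<^sup>2" by (simp only: abs_le_square_iff)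
      thus ?thesis by (simp add: power2_eq_square)
    qed
    have "\<bar>2 * c * (u $ 2 * u $ 3)\<bar> = (2 * \<bar>c\<bar>) * (\<bar>u $ 2\<bar> * \<bar>u $ 3\<bar>)" by (simp add: abs_mult)
    also have "\<dots> \<le> 1 * (1/2 * (1/2))" using c u[of 2] u[of 3] by (intro mult_mono) auto
    finally have "2 * c * (u $ 2 * u $ 3) \<le> 1 / 4" by (simp add: abs_le_iff)
    hence "(u $ 1)\<^sup>2 + (u $ 2)\<^sup>2 + (u $ 3)\<^sup>2 + 2 * c * (u $ 2 * u $ 3) \<le> 1\<^sup>2"
      using sq[OF u[of 1]] sq[OF u[of 2]] sq[OF u[of 3]] by simp
    thus ?thesis using Av[of 1 u] by simp
  qed
  define v :: "int ^ 3 \<Rightarrow> int \<times> int \<times> int" where "v z = (z $ 1, z $ 2, z $ 3)" for z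
  let ?Z = "{z :: int ^ 3. norm (A *v realv z) \<le> R}"
  have R0: "R \<ge> 0" using R by simp
  have inj: "inj_on v ?Z" by (auto simp: inj_on_def v_def vec_eq_iff forall_3)
  have im: "v ` ?Z = Z"
  proof (intro equalityI subsetI)
    fix p assume pZ: "p \<in> Z"
    obtain k r s where p: "p = (k, r, s)" by (cases p) auto
    have "vector [k, r, s] \<in> ?Z" using pZ by (simp add: Av[OF R0] p Z_def)
    moreover have "p = v (vector [k, r, s])" by (simp add: p v_def)
    ultimately show "p \<in> v ` ?Z" by blast
  qed (auto simp: Av[OF R0] v_def Z_def)
  note L = lattice_points_ellipsoid[OF det0 cube R0]
  show "finite Z" using L(1) im by (metis finite_imageI)
  have card: "card Z = card ?Z" using card_image[OF inj] im by simp
  define w where "w = ellipsoid_vol c"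
  have vol: "unit_ball_vol (real CARD(3)) / \<bar>det A\<bar> = w"
    using d0 by (simp add: det unit_ball_vol_3 w_def ellipsoid_vol_def d_def[symmetric])
  have up: "real (card Z) \<le> w * (R + 1) ^ 3" using L(2)[unfolded vol] by (simp add: card)
  have lo: "w * (R - 1) ^ 3 \<le> real (card Z)" using L(3)[unfolded vol] R by (simp add: card)
  have w: "0 \<le> w" "w \<le> 8" using ellipsoid_vol_bounds[OF c] by (simp_all add: w_def)
  have RR: "1 \<le> R\<^sup>2" "R \<le> R\<^sup>2" using R by (simp_all add: power2_eq_square mult_ge1_I)
  have "(R + 1) ^ 3 - R ^ 3 = 3 * R\<^sup>2 + 3 * R + 1" "R ^ 3 - (R - 1) ^ 3 = 3 * R\<^sup>2 - 3 * R + 1"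
    by (simp_all add: power3_eq_cube power2_eq_square algebra_simps)
  hence H: "(R + 1) ^ 3 - R ^ 3 \<le> 7 * R\<^sup>2" "R ^ 3 - (R - 1) ^ 3 \<le> 7 * R\<^sup>2" using RR R by linarith+
  hence "w * ((R + 1) ^ 3 - R ^ 3) \<le> 8 * (7 * R\<^sup>2)" "w * (R ^ 3 - (R - 1) ^ 3) \<le> 8 * (7 * R\<^sup>2)"
    using R by (intro mult_mono[OF w(2) H(1)] mult_mono[OF w(2) H(2)]; simp add: power_mono)+
  hence "w * (R + 1) ^ 3 \<le> w * R ^ 3 + 56 * R\<^sup>2" "w * R ^ 3 \<le> w * (R - 1) ^ 3 + 56 * R\<^sup>2"
    by (simp_all add: right_diff_distrib)
  thus "\<bar>real (card Z) - ellipsoid_vol c * R ^ 3\<bar> \<le> 56 * R\<^sup>2"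
    using up lo unfolding w_def[symmetric] by (simp add: abs_le_iff)
qed

text \<open>Vectors with \<open>k = 0\<close> are left out because they correspond to points with \<open>t\<^sub>0 = t\<^sub>1 = 0\<close>, which are not
normal.\<close>

definition E3 :: "real \<Rightarrow> real \<Rightarrow> (int \<times> int \<times> int) set" where
  "E3 c R = {(k, r, s). k \<noteq> 0 \<and> (real_of_int k)\<^sup>2 + (real_of_int r)\<^sup>2 + (real_of_int s)\<^sup>2 + 2 * c * (real_of_int r * real_of_int s) \<le> R\<^sup>2}"

lemma E3_bound:
  assumes "(k, r, s) \<in> E3 c R" "\<bar>c\<bar> \<le> 1/2" "R \<ge> 0"
  shows "\<bar>real_of_int k\<bar> \<le> R"
proof -
  have "0 \<le> ((real_of_int r)\<^sup>2 + (real_of_int s)\<^sup>2) / 2" by simp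
  also have "\<dots> \<le> (real_of_int r)\<^sup>2 + (real_of_int s)\<^sup>2 + 2 * c * (real_of_int r * real_of_int s)" using form_ge[OF assms(2)] by simp
  finally have "(real_of_int k)\<^sup>2 \<le> R\<^sup>2" using assms(1) by (simp add: E3_def)
  thus ?thesis using assms(3) abs_le_square_iff[of "real_of_int k" R] by simp
qed

lemma E3_empty:
  assumes "\<bar>c\<bar> \<le> 1/2" "0 \<le> R" "R < 1"
  shows "E3 c R = {}"
proof -
  have False if "(k, r, s) \<in> E3 c R" for k r s
  proof -
    have "\<bar>k\<bar> \<ge> 1" using that by (auto simp: E3_def)
    hence "\<bar>real_of_int k\<bar> \<ge> 1" by linarith
    thus False using E3_bound[OF that assms(1,2)] assms(3) by linarith
  qed
  thus ?thesis by auto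
qed

text \<open>The lattice points with \<open>k = 0\<close> lie in a square of side \<open>4 R\<close> and are absorbed by the error term.\<close>

lemma count_E3:
  assumes c: "\<bar>c\<bar> \<le> 1/2" and R: "R \<ge> 1"
  shows "finite (E3 c R)" "\<bar>real (card (E3 c R)) - ellipsoid_vol c * R ^ 3\<bar> \<le> 92 * R\<^sup>2"
proof -
  let ?Z = "{(k :: int, r :: int, s :: int). (real_of_int k)\<^sup>2 + (real_of_int r)\<^sup>2 + (real_of_int s)\<^sup>2 + 2 * c * (real_of_int r * real_of_int s) \<le> R\<^sup>2}"
  let ?I = "{l :: int. \<bar>real_of_int l\<bar> \<le> 2 * R}"
  let ?a = "(\<lambda>q. (0 :: int, q)) ` (?I \<times> ?I)"
  note C = count_ellipsoid[OF c R]
  have sub: "E3 c R \<subseteq> ?Z" by (auto simp: E3_def)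
  show fin: "finite (E3 c R)" using finite_subset[OF sub C(1)] .
  have R2: "2 * R \<ge> 1" using R by simp
  note I = card_int_abs_le[OF R2]
  have "?Z \<subseteq> E3 c R \<union> ?a"
  proof
    fix z assume z: "z \<in> ?Z"
    obtain k r s where k: "z = (k, r, s)" by (cases z) auto
    show "z \<in> E3 c R \<union> ?a"
    proof (cases "k = 0")
      case False
      thus ?thesis using z by (simp add: k E3_def)
    next
      case True
      have "((real_of_int r)\<^sup>2 + (real_of_int s)\<^sup>2) / 2 \<le> R\<^sup>2"
        using form_ge[OF c, of "real_of_int r" "real_of_int s"] z True by (simp add: k)
      hence *: "(real_of_int r)\<^sup>2 + (real_of_int s)\<^sup>2 \<le> 2 * R\<^sup>2" by simp
      have "(real_of_int r)\<^sup>2 \<le> 4 * R\<^sup>2"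
        using * zero_le_power2[of "real_of_int s"] zero_le_power2[of R] by linarith
      moreover have "(real_of_int s)\<^sup>2 \<le> 4 * R\<^sup>2"
        using * zero_le_power2[of "real_of_int r"] zero_le_power2[of R] by linarith
      ultimately have "(real_of_int r)\<^sup>2 \<le> (2 * R)\<^sup>2" "(real_of_int s)\<^sup>2 \<le> (2 * R)\<^sup>2"
        by (simp_all add: power_mult_distrib)
      hence "\<bar>real_of_int r\<bar> \<le> 2 * R" "\<bar>real_of_int s\<bar> \<le> 2 * R"
        using R abs_le_square_iff[of _ "2 * R"] by simp_all
      thus ?thesis using True by (simp add: k)
    qed
  qed
  moreover have "finite (E3 c R \<union> ?a)" using fin I(1) by blast
  ultimately have "card ?Z \<le> card (E3 c R \<union> ?a)" by (intro card_mono)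
  also have "\<dots> \<le> card (E3 c R) + card ?a" by (rule card_Un_le)
  finally have up: "real (card ?Z) \<le> real (card (E3 c R)) + real (card ?a)"
    by (simp only: of_nat_add[symmetric] of_nat_le_iff)
  have "card ?a = card ?I * card ?I" by (subst card_image) (auto simp: inj_on_def card_cartesian_product)
  hence "real (card ?a) = real (card ?I) * real (card ?I)" by simp
  also have "\<dots> \<le> (3 * (2 * R)) * (3 * (2 * R))" using I(2) R by (intro mult_mono) auto
  finally have a: "real (card ?a) \<le> 36 * R\<^sup>2" by (simp add: power2_eq_square)
  have lo: "real (card (E3 c R)) \<le> real (card ?Z)" using card_mono[OF C(1) sub] by simp
  have "\<bar>e - w\<bar> \<le> 92 * t"
    if "e \<le> z" "z \<le> e + a" "a \<le> 36 * t" "\<bar>z - w\<bar> \<le> 56 * t" "0 \<le> t" for e z a w t :: real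
  proof -
    have "z - w \<le> 56 * t" "w - z \<le> 56 * t" using that(4) by (auto simp: abs_le_iff)
    hence "e - w \<le> 92 * t" "w - e \<le> 92 * t" using that(1-3,5) by linarith+
    thus ?thesis by (simp add: abs_le_iff)
  qed
  from this[OF lo up a C(2)] show "\<bar>real (card (E3 c R)) - ellipsoid_vol c * R ^ 3\<bar> \<le> 92 * R\<^sup>2" by simp
qed

definition PE3 :: "real \<Rightarrow> real \<Rightarrow> (int \<times> int \<times> int) set" where
  "PE3 c R = {(k, r, s) \<in> E3 c R. gcd k (gcd r s) = 1}"

lemma PE3_empty: "\<bar>c\<bar> \<le> 1/2 \<Longrightarrow> 0 \<le> R \<Longrightarrow> R < 1 \<Longrightarrow> PE3 c R = {}"
  using E3_empty by (auto simp: PE3_def)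

text \<open>As for ellipses, but now the errors \<open>O((R/d)\<^sup>2)\<close> have a convergent sum over \<open>d\<close>, so no logarithm arises.\<close>

lemma count_PE3:
  assumes c: "\<bar>c\<bar> \<le> 1/2" and R: "R \<ge> 1"
  shows "\<bar>real (card (PE3 c R)) - ellipsoid_vol c * R ^ 3 / zeta 3\<bar> \<le> 250 * R\<^sup>2"
proof -
  define D where "D = nat \<lfloor>R\<rfloor>"
  note D = floor_half(1-3)[OF R, folded D_def]
  define w where "w = ellipsoid_vol c"
  have w: "0 \<le> w" "w \<le> 8" using ellipsoid_vol_bounds[OF c] by (simp_all add: w_def)
  define g :: "int \<times> int \<times> int \<Rightarrow> nat" where "g = (\<lambda>(k, r, s). nat (gcd k (gcd r s)))"
  have R0: "R \<ge> 0" using R by simp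
  have g: "0 < g z \<and> g z \<le> D" if z: "z \<in> E3 c R" for z
  proof -
    obtain k r s where k: "z = (k, r, s)" by (cases z) auto
    have nz: "k \<noteq> 0" using z by (auto simp: k E3_def)
    have "gcd k (gcd r s) \<le> \<bar>k\<bar>" using nz by (auto intro: zdvd_imp_le)
    hence "real_of_int (gcd k (gcd r s)) \<le> \<bar>real_of_int k\<bar>" by linarith
    hence "real_of_int (gcd k (gcd r s)) \<le> R" using E3_bound[of k r s c R] z c R0 k by auto
    hence "real (nat (gcd k (gcd r s))) \<le> R" by simp
    thus ?thesis using floor_half(4)[OF R] nz by (simp add: g_def k D_def gcd_pos_int)
  qed
  have scale: "card {z \<in> E3 c R. d dvd g z} = card (E3 c (R / d))" if d: "d \<in> {1..D}" for d
  proof -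
    let ?m = "\<lambda>(k, r, s). (int d * k, int d * r, int d * s)"
    have form: "(real_of_int (int d * k))\<^sup>2 + (real_of_int (int d * r))\<^sup>2 + (real_of_int (int d * s))\<^sup>2 + 2 * c * (real_of_int (int d * r) * real_of_int (int d * s)) \<le> R\<^sup>2
      \<longleftrightarrow> (real_of_int k)\<^sup>2 + (real_of_int r)\<^sup>2 + (real_of_int s)\<^sup>2 + 2 * c * (real_of_int r * real_of_int s) \<le> (R / d)\<^sup>2" for k r s :: int
    proof -
      have "(real_of_int (int d * k))\<^sup>2 + (real_of_int (int d * r))\<^sup>2 + (real_of_int (int d * s))\<^sup>2 + 2 * c * (real_of_int (int d * r) * real_of_int (int d * s))
        = ((real_of_int k)\<^sup>2 + (real_of_int r)\<^sup>2 + (real_of_int s)\<^sup>2 + 2 * c * (real_of_int r * real_of_int s)) * (real d)\<^sup>2"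
        by (simp add: power2_eq_square algebra_simps)
      moreover have "(real d)\<^sup>2 > 0" using d by simp
      ultimately show ?thesis by (simp add: power_divide pos_le_divide_eq)
    qed
    have "{z \<in> E3 c R. d dvd g z} = ?m ` E3 c (R / d)"
    proof (intro equalityI subsetI)
      fix z assume z: "z \<in> {z \<in> E3 c R. d dvd g z}"
      obtain k r s where k: "z = (k, r, s)" by (cases z) auto
      have "int d dvd gcd k (gcd r s)" using z by (simp add: k g_def nat_dvd_iff int_dvd_int_iff[symmetric] del: int_dvd_int_iff)
      hence "int d dvd k" "int d dvd r" "int d dvd s" by auto
      then obtain k' r' s' where k': "k = int d * k'" "r = int d * r'" "s = int d * s'" by (auto simp: dvd_def)
      have "(k', r', s') \<in> E3 c (R / d)" using z form[of k' r' s'] by (simp add: k k' E3_def)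
      hence "?m (k', r', s') \<in> ?m ` E3 c (R / d)" by (rule imageI)
      thus "z \<in> ?m ` E3 c (R / d)" by (simp add: k k')
    next
      fix z assume "z \<in> ?m ` E3 c (R / d)"
      then obtain k r s where k: "z = (int d * k, int d * r, int d * s)" "(k, r, s) \<in> E3 c (R / d)" by auto
      have "int d dvd gcd (int d * k) (gcd (int d * r) (int d * s))" by simp
      hence "d dvd g z" by (simp add: k g_def nat_dvd_iff int_dvd_int_iff[symmetric] del: int_dvd_int_iff)
      moreover have "z \<in> E3 c R" using k d form[of k r s] by (simp add: E3_def)
      ultimately show "z \<in> {z \<in> E3 c R. d dvd g z}" by simp
    qed
    moreover have "inj_on ?m (E3 c (R / d))" using d by (auto simp: inj_on_def)
    ultimately show ?thesis by (simp add: card_image)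
  qed
  have PE3: "PE3 c R = {z \<in> E3 c R. g z = 1}" by (auto simp: PE3_def g_def)
  define M where "M = (\<Sum>d=1..D. mu d / real d ^ 3)"
  have "real (card (PE3 c R)) = (\<Sum>d=1..D. mu d * real (card (E3 c (R / d))))"
    unfolding PE3 using card_primitive_moebius[OF count_E3(1)[OF c R] g] scale by simp
  moreover have "w * R ^ 3 * M = (\<Sum>d=1..D. mu d * (w * (R / d) ^ 3))"
    unfolding M_def sum_distrib_left by (intro sum.cong) (auto simp: power_divide)
  ultimately have "\<bar>real (card (PE3 c R)) - w * R ^ 3 * M\<bar>
      = \<bar>\<Sum>d=1..D. mu d * (real (card (E3 c (R / d))) - w * (R / d) ^ 3)\<bar>"
    by (simp add: sum_subtractf right_diff_distrib)
  also have "\<dots> \<le> (\<Sum>d=1..D. 92 * R\<^sup>2 * (1 / real d ^ 2))"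
  proof (rule order_trans[OF sum_abs sum_mono])
    fix d assume d: "d \<in> {1..D}"
    have "real d \<le> real D" using d by simp
    hence "real d \<le> R" using D by linarith
    hence "R / d \<ge> 1" using d by auto
    hence "\<bar>real (card (E3 c (R / d))) - w * (R / d) ^ 3\<bar> \<le> 92 * (R / d)\<^sup>2" unfolding w_def by (rule count_E3(2)[OF c])
    hence "\<bar>mu d\<bar> * \<bar>real (card (E3 c (R / d))) - w * (R / d) ^ 3\<bar> \<le> 1 * (92 * (R / d)\<^sup>2)"
      using abs_mu_le by (intro mult_mono) auto
    thus "\<bar>mu d * (real (card (E3 c (R / d))) - w * (R / d) ^ 3)\<bar> \<le> 92 * R\<^sup>2 * (1 / real d ^ 2)"
      by (simp add: abs_mult power_divide)
  qed
  also have "\<dots> = 92 * R\<^sup>2 * (\<Sum>d=1..D. 1 / real d ^ 2)" by (simp only: sum_distrib_left)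
  also have "\<dots> \<le> 92 * R\<^sup>2 * 2"
    using zeta_tail(1)[of 2 D] zeta_2_bounds(2) by (intro mult_left_mono) auto
  finally have 1: "\<bar>real (card (PE3 c R)) - w * R ^ 3 * M\<bar> \<le> 184 * R\<^sup>2" by simp
  have "\<bar>M - 1 / zeta 3\<bar> \<le> 2 * (1 + ln (real D)) / real D ^ (3 - 1)"
    unfolding M_def using sum_mu_power_approx[of 3 D] D(1) by simp
  also have "\<dots> = 2 * (1 + ln (real D)) / real D ^ 2" by simp
  also have "\<dots> \<le> 2 * real D / real D ^ 2"
    using D(1) ln_le_minus_one[of "real D"] by (intro divide_right_mono) auto
  also have "\<dots> = 2 / real D" using D(1) by (simp add: power2_eq_square)
  finally have "w * R ^ 3 * \<bar>M - 1 / zeta 3\<bar> \<le> w * R ^ 3 * (2 / real D)"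
    using w R by (intro mult_left_mono) auto
  also have "\<dots> = 2 * w * R\<^sup>2 * (R / real D)" by (simp add: power2_eq_square power3_eq_cube)
  also have "\<dots> \<le> 2 * 8 * R\<^sup>2 * 2"
    using w D R by (intro mult_mono) (auto simp: divide_le_eq)
  finally have 2: "w * R ^ 3 * \<bar>M - 1 / zeta 3\<bar> \<le> 32 * R\<^sup>2" by simp
  have "w * R ^ 3 * M - w * R ^ 3 / zeta 3 = w * R ^ 3 * (M - 1 / zeta 3)" by (simp add: right_diff_distrib)
  hence "\<bar>w * R ^ 3 * M - w * R ^ 3 / zeta 3\<bar> = w * R ^ 3 * \<bar>M - 1 / zeta 3\<bar>" using w R by (simp add: abs_mult)
  hence 3: "\<bar>w * R ^ 3 * M - w * R ^ 3 / zeta 3\<bar> \<le> 32 * R\<^sup>2" using 2 by simp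
  have "\<bar>real (card (PE3 c R)) - w * R ^ 3 / zeta 3\<bar> \<le> \<bar>real (card (PE3 c R)) - w * R ^ 3 * M\<bar> + \<bar>w * R ^ 3 * M - w * R ^ 3 / zeta 3\<bar>"
    using abs_triangle_ineq[of "real (card (PE3 c R)) - w * R ^ 3 * M" "w * R ^ 3 * M - w * R ^ 3 / zeta 3"] by simp
  also have "\<dots> \<le> 184 * R\<^sup>2 + 32 * R\<^sup>2" using 1 3 by (rule add_mono)
  also have "\<dots> \<le> 250 * R\<^sup>2" by simp
  finally show ?thesis unfolding w_def .
qed

section \<open>Sums over integral points arranged by the maximum norm\<close>

definition max_norm :: "int \<times> int \<Rightarrow> nat" where
  "max_norm p = nat (max \<bar>fst p\<bar> \<bar>snd p\<bar>)"

lemma max_norm_le_iff: "max_norm p \<le> j \<longleftrightarrow> p \<in> {- int j..int j} \<times> {- int j..int j}"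
  by (cases p) (auto simp: max_norm_def nat_le_iff abs_le_iff)

lemma finite_max_norm_le: "finite {p. max_norm p \<le> j}"
  by (simp add: max_norm_le_iff)

lemma card_max_norm_le: "card {p. max_norm p \<le> j} = (2 * j + 1) ^ 2"
proof -
  have "{p. max_norm p \<le> j} = {- int j..int j} \<times> {- int j..int j}" by (auto simp: max_norm_le_iff)
  thus ?thesis by (simp add: card_cartesian_product power2_eq_square nat_add_distrib nat_mult_distrib)
qed

lemma card_shell:
  assumes "j \<ge> 1"
  shows "card {p. max_norm p = j} = 8 * j"
proof -
  obtain i where j: "j = Suc i" using assms by (cases j) auto
  have "{p. max_norm p \<le> j} = {p. max_norm p \<le> i} \<union> {p. max_norm p = j}" by (auto simp: j)
  moreover have "finite {p. max_norm p = j}" by (rule finite_subset[OF _ finite_max_norm_le[of j]]) auto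
  ultimately have "card {p. max_norm p \<le> j} = card {p. max_norm p \<le> i} + card {p. max_norm p = j}"
    using finite_max_norm_le[of i] by (simp add: card_Un_disjoint j disjoint_iff)
  thus ?thesis by (simp add: card_max_norm_le j power2_eq_square)
qed

lemma sum_shells:
  fixes f :: "nat \<Rightarrow> real"
  shows "(\<Sum>p | I < max_norm p \<and> max_norm p \<le> J. f (max_norm p)) = (\<Sum>j\<in>{I<..J}. 8 * real j * f j)"
proof -
  let ?S = "{p. I < max_norm p \<and> max_norm p \<le> J}"
  have fin: "finite ?S" by (rule finite_subset[OF _ finite_max_norm_le[of J]]) auto
  have "(\<Sum>p\<in>?S. f (max_norm p)) = (\<Sum>j\<in>{I<..J}. \<Sum>p | p \<in> ?S \<and> max_norm p = j. f (max_norm p))"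
    by (rule sum.group[symmetric, OF fin]) auto
  also have "\<dots> = (\<Sum>j\<in>{I<..J}. 8 * real j * f j)"
  proof (rule sum.cong[OF refl])
    fix j assume j: "j \<in> {I<..J}"
    hence "{p. p \<in> ?S \<and> max_norm p = j} = {p. max_norm p = j}" by auto
    hence "(\<Sum>p | p \<in> ?S \<and> max_norm p = j. f (max_norm p)) = (\<Sum>p | max_norm p = j. f j)" by (intro sum.cong) auto
    also have "\<dots> = 8 * real j * f j" using j card_shell[of j] by simp
    finally show "(\<Sum>p | p \<in> ?S \<and> max_norm p = j. f (max_norm p)) = 8 * real j * f j" .
  qed
  finally show ?thesis .
qed

lemma sum_shells_1: "(\<Sum>p | 0 < max_norm p \<and> max_norm p \<le> J. 1 / real (max_norm p)) = 8 * real J"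
proof -
  have "(\<Sum>j\<in>{0<..J}. 8 * real j * (1 / real j)) = (\<Sum>j\<in>{0<..J}. 8)" by (intro sum.cong) auto
  thus ?thesis by (subst sum_shells) simp
qed

lemma sum_shells_2:
  assumes "J \<ge> 1"
  shows "(\<Sum>p | 0 < max_norm p \<and> max_norm p \<le> J. 1 / real (max_norm p) ^ 2) \<le> 8 * (1 + ln (real J))"
proof -
  have "(\<Sum>j\<in>{0<..J}. 8 * real j * (1 / real j ^ 2)) = 8 * (\<Sum>j=1..J. 1 / real j)"
    unfolding sum_distrib_left by (intro sum.cong) (auto simp: power2_eq_square)
  thus ?thesis using sum_inverse_le_ln[OF assms] by (subst sum_shells) simp
qed

lemma sum_shells_3: "(\<Sum>p | I < max_norm p \<and> max_norm p \<le> J. 1 / real (max_norm p) ^ 3) \<le> 16 / real (Suc I)"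
proof (cases "I \<le> J")
  case True
  have "(\<Sum>j\<in>{I<..J}. 8 * real j * (1 / real j ^ 3)) = 8 * (\<Sum>j\<in>{I<..J}. 1 / real j ^ 2)"
    unfolding sum_distrib_left by (intro sum.cong) (auto simp: power2_eq_square power3_eq_cube)
  also have "(\<Sum>j\<in>{I<..J}. 1 / real j ^ 2) = (\<Sum>j=1..J. 1 / real j ^ 2) - (\<Sum>j=1..I. 1 / real j ^ 2)"
  proof -
    have "{1..J} = {1..I} \<union> {I<..J}" using True by auto
    moreover have "(\<Sum>j\<in>{1..I} \<union> {I<..J}. 1 / real j ^ 2) = (\<Sum>j=1..I. 1 / real j ^ 2) + (\<Sum>j\<in>{I<..J}. 1 / real j ^ 2)"
      by (rule sum.union_disjoint) auto
    ultimately show ?thesis by simp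
  qed
  also have "8 * \<dots> \<le> 8 * (2 / real (Suc I))"
    using zeta_tail(2)[of 2 I] zeta_tail(1)[of 2 J] by (intro mult_left_mono) auto
  finally show ?thesis by (subst sum_shells) simp
next
  case False
  hence "{p. I < max_norm p \<and> max_norm p \<le> J} = {}" by auto
  thus ?thesis by (simp only: sum.empty) simp
qed

text \<open>There are \<open>8 j\<close> vectors of norm \<open>j\<close>, so the terms of norm greater than \<open>J\<close> contribute at most
the sum of \<open>8 C/j\<^sup>2\<close> over \<open>j > J\<close>.\<close>

lemma shell_tail:
  fixes g :: "int \<times> int \<Rightarrow> real"
  assumes A: "\<And>p. p \<in> A \<Longrightarrow> 0 < max_norm p" and g: "\<And>p. p \<in> A \<Longrightarrow> 0 \<le> g p \<and> g p \<le> C / real (max_norm p) ^ 3" and C: "C \<ge> 0"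
  shows "g summable_on A"
    and "\<bar>(\<Sum>\<^sub>\<infinity>p\<in>A. g p) - (\<Sum>p\<in>{p \<in> A. max_norm p \<le> J}. g p)\<bar> \<le> 16 * C / real (Suc J)"
proof -
  have fs: "sum g F \<le> 16 * C / real (Suc I)" if F: "finite F" "F \<subseteq> {p \<in> A. I < max_norm p}" for F I
  proof -
    define K where "K = Max (insert 0 (max_norm ` F))"
    have K: "max_norm p \<le> K" if "p \<in> F" for p unfolding K_def using F(1) that by (intro Max_ge) auto
    have "sum g F \<le> (\<Sum>p\<in>F. C * (1 / real (max_norm p) ^ 3))" using F g by (intro sum_mono) auto
    also have "\<dots> \<le> (\<Sum>p | I < max_norm p \<and> max_norm p \<le> K. C * (1 / real (max_norm p) ^ 3))"
    proof (rule sum_mono2)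
      show "finite {p. I < max_norm p \<and> max_norm p \<le> K}" by (rule finite_subset[OF _ finite_max_norm_le[of K]]) auto
      show "F \<subseteq> {p. I < max_norm p \<and> max_norm p \<le> K}" using F K by auto
    qed (use C in auto)
    also have "\<dots> = C * (\<Sum>p | I < max_norm p \<and> max_norm p \<le> K. 1 / real (max_norm p) ^ 3)" by (simp only: sum_distrib_left)
    also have "\<dots> \<le> C * (16 / real (Suc I))" using C sum_shells_3 by (intro mult_left_mono)
    finally show ?thesis by (simp add: mult.commute)
  qed
  show sm: "g summable_on A"
  proof (rule nonneg_bdd_above_summable_on)
    show "0 \<le> g p" if "p \<in> A" for p using g that by blast
    show "bdd_above (sum g ` {F. F \<subseteq> A \<and> finite F})"
    proof (rule bdd_aboveI2)
      fix F assume F: "F \<in> {F. F \<subseteq> A \<and> finite F}"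
      hence "F \<subseteq> {p \<in> A. 0 < max_norm p}" using A by auto
      thus "sum g F \<le> 16 * C / real (Suc 0)" using F by (intro fs) auto
    qed
  qed
  let ?B = "{p \<in> A. max_norm p \<le> J}" and ?T = "{p \<in> A. J < max_norm p}"
  have finB: "finite ?B" by (rule finite_subset[OF _ finite_max_norm_le[of J]]) auto
  have smT: "g summable_on ?T" by (rule summable_on_subset_banach[OF sm]) auto
  have "A = ?B \<union> ?T" by auto
  hence "(\<Sum>\<^sub>\<infinity>p\<in>A. g p) = (\<Sum>\<^sub>\<infinity>p\<in>?B \<union> ?T. g p)" by simp
  also have "\<dots> = (\<Sum>\<^sub>\<infinity>p\<in>?B. g p) + (\<Sum>\<^sub>\<infinity>p\<in>?T. g p)"
    using finB smT by (intro infsum_Un_disjoint) (auto intro: summable_on_finite)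
  finally have "(\<Sum>\<^sub>\<infinity>p\<in>A. g p) - (\<Sum>p\<in>?B. g p) = (\<Sum>\<^sub>\<infinity>p\<in>?T. g p)" using finB by simp
  moreover have "0 \<le> (\<Sum>\<^sub>\<infinity>p\<in>?T. g p)" using g by (intro infsum_nonneg) auto
  moreover have "(\<Sum>\<^sub>\<infinity>p\<in>?T. g p) \<le> 16 * C / real (Suc J)"
    by (rule infsum_le_finite_sums[OF smT]) (rule fs)
  ultimately show "\<bar>(\<Sum>\<^sub>\<infinity>p\<in>A. g p) - (\<Sum>p\<in>?B. g p)\<bar> \<le> 16 * C / real (Suc J)" by simp
qed

lemma sum_approx_infsum:
  fixes g P E :: "int \<times> int \<Rightarrow> real"
  assumes A: "\<And>p. p \<in> A \<Longrightarrow> 0 < max_norm p" and g: "\<And>p. p \<in> A \<Longrightarrow> 0 \<le> g p \<and> g p \<le> C / real (max_norm p) ^ 3" and C: "C \<ge> 0"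
    and K: "K \<ge> 0" and P: "\<And>p. p \<in> A \<Longrightarrow> max_norm p \<le> J \<Longrightarrow> \<bar>P p - K * g p\<bar> \<le> E p"
  shows "\<bar>(\<Sum>p\<in>{p \<in> A. max_norm p \<le> J}. P p) - K * (\<Sum>\<^sub>\<infinity>p\<in>A. g p)\<bar>
    \<le> (\<Sum>p\<in>{p \<in> A. max_norm p \<le> J}. E p) + K * (16 * C / real (Suc J))"
proof -
  let ?B = "{p \<in> A. max_norm p \<le> J}"
  have "\<bar>(\<Sum>p\<in>?B. P p) - K * (\<Sum>p\<in>?B. g p)\<bar> = \<bar>\<Sum>p\<in>?B. P p - K * g p\<bar>"
    by (simp only: sum_distrib_left sum_subtractf)
  also have "\<dots> \<le> (\<Sum>p\<in>?B. E p)" by (rule order_trans[OF sum_abs sum_mono]) (use P in auto)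
  finally have 1: "\<bar>(\<Sum>p\<in>?B. P p) - K * (\<Sum>p\<in>?B. g p)\<bar> \<le> (\<Sum>p\<in>?B. E p)" .
  have "\<bar>K * (\<Sum>p\<in>?B. g p) - K * (\<Sum>\<^sub>\<infinity>p\<in>A. g p)\<bar> = K * \<bar>(\<Sum>\<^sub>\<infinity>p\<in>A. g p) - (\<Sum>p\<in>?B. g p)\<bar>"
    using K by (simp add: right_diff_distrib[symmetric] abs_mult abs_minus_commute)
  also have "\<dots> \<le> K * (16 * C / real (Suc J))"
    using K shell_tail(2)[of A g C J, OF A g C] by (intro mult_left_mono)
  finally have "\<bar>K * (\<Sum>p\<in>?B. g p) - K * (\<Sum>\<^sub>\<infinity>p\<in>A. g p)\<bar> \<le> K * (16 * C / real (Suc J))" .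
  thus ?thesis using 1 by linarith
qed

section \<open>Summation over the lattices\<close>

lemma max_norm_pos: "p \<in> prim2 \<Longrightarrow> 0 < max_norm p"
  by (auto simp: prim2_def max_norm_def)

lemma max_norm_square_le:
  "real (max_norm (m, l)) ^ 2 \<le> real_of_int (m\<^sup>2 + l\<^sup>2)"
proof -
  have "real (max_norm (m, l)) = \<bar>real_of_int m\<bar> \<or> real (max_norm (m, l)) = \<bar>real_of_int l\<bar>"
    by (auto simp: max_norm_def max_def)
  thus ?thesis by auto
qed

lemma card_fibres:
  assumes "\<And>p. p \<in> prim2 \<Longrightarrow> finite (S p)" "\<And>p. p \<in> prim2 \<Longrightarrow> S p \<noteq> {} \<Longrightarrow> max_norm p \<le> J"
  shows "card {(p, q). p \<in> prim2 \<and> q \<in> S p} = (\<Sum>p\<in>{p \<in> prim2. max_norm p \<le> J}. card (S p))"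
proof -
  have "{(p, q). p \<in> prim2 \<and> q \<in> S p} = Sigma {p \<in> prim2. max_norm p \<le> J} S" using assms(2) by auto
  moreover have "finite {p \<in> prim2. max_norm p \<le> J}" by (rule finite_subset[OF _ finite_max_norm_le[of J]]) auto
  ultimately show ?thesis using assms(1) by (simp add: card_SigmaI)
qed

text \<open>Passing to \<open>k \<noteq> 0\<close> restores the symmetry of the ellipsoids; it doubles the count of solutions with \<open>k > 0\<close>.\<close>

lemma card_pos_half:
  fixes S :: "(int \<times> 'b) set"
  assumes fin: "finite S" and nz: "\<And>k q. (k, q) \<in> S \<Longrightarrow> k \<noteq> 0" and sym: "\<And>k q. (k, q) \<in> S \<Longrightarrow> (- k, q) \<in> S"
  shows "card S = 2 * card {(k, q) \<in> S. k > 0}"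
proof -
  let ?P = "{(k, q) \<in> S. k > 0}"
  let ?n = "\<lambda>(k, q). (- k, q) :: int \<times> 'b"
  have "S = ?P \<union> ?n ` ?P"
  proof (intro equalityI subsetI)
    fix z assume z: "z \<in> S"
    obtain k q where k: "z = (k, q)" by (cases z)
    show "z \<in> ?P \<union> ?n ` ?P"
    proof (cases "k > 0")
      case False
      hence "(- k, q) \<in> ?P" using nz sym z k by fastforce
      hence "?n (- k, q) \<in> ?n ` ?P" by (rule imageI)
      thus ?thesis by (simp add: k)
    qed (use z k in auto)
  qed (use sym in auto)
  moreover have "card (?P \<union> ?n ` ?P) = card ?P + card (?n ` ?P)"
  proof (rule card_Un_disjoint)
    show "finite ?P" by (rule finite_subset[OF _ fin]) auto
    thus "finite (?n ` ?P)" by simp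
  qed auto
  moreover have "card (?n ` ?P) = card ?P" by (intro card_image) (auto simp: inj_on_def)
  ultimately show ?thesis by simp
qed

section \<open>The threefold\<close>

text \<open>For \<open>p = (\<mu>, \<lambda>)\<close> the height form of the threefold is \<open>nn p \<cdot> (k\<^sup>2 + r\<^sup>2 + s\<^sup>2 + 2 \<cdot> cc p \<cdot> r s)\<close>, and
\<open>\<bar>cc p\<bar> \<le> 1/2\<close> by the inequality of arithmetic and geometric means.\<close>

definition nn :: "int \<times> int \<Rightarrow> real" where "nn p = real_of_int ((fst p)\<^sup>2 + (snd p)\<^sup>2)"
definition cc :: "int \<times> int \<Rightarrow> real" where "cc p = real_of_int (fst p) * real_of_int (snd p) / nn p"

lemma nn_ge: "real (max_norm p) ^ 2 \<le> nn p"
  by (cases p) (use max_norm_square_le in \<open>simp add: nn_def\<close>)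

lemma nn_pos: "p \<in> prim2 \<Longrightarrow> 1 \<le> nn p"
proof -
  assume "p \<in> prim2"
  hence "1 \<le> max_norm p" using max_norm_pos[of p] by simp
  hence "1\<^sup>2 \<le> real (max_norm p) ^ 2" by (intro power_mono) auto
  thus ?thesis using nn_ge[of p] by simp
qed

lemma cc_le: "p \<in> prim2 \<Longrightarrow> \<bar>cc p\<bar> \<le> 1/2"
proof -
  assume p: "p \<in> prim2"
  let ?m = "\<bar>real_of_int (fst p)\<bar>" and ?l = "\<bar>real_of_int (snd p)\<bar>"
  have "0 \<le> (?m - ?l)\<^sup>2" by simp
  also have "\<dots> = nn p - 2 * (?m * ?l)" by (simp add: nn_def power2_diff)
  finally have "?m * ?l \<le> nn p / 2" by simp
  thus ?thesis using nn_pos[OF p] by (simp add: cc_def abs_mult divide_le_eq)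
qed

lemma f2_eq: "real_of_int (f2 (fst p) (snd p)) = nn p * ((nn p)\<^sup>2 - (real_of_int (fst p) * real_of_int (snd p))\<^sup>2)"
  by (simp add: f2_def nn_def power2_eq_square algebra_simps numeral_eq_Suc)

lemma S2_eq_PE3:
  assumes p: "p \<in> prim2" and B: "B > 0"
  shows "{(k, r, s). k \<noteq> 0 \<and> gcd k (gcd r s) = 1 \<and>
       real_of_int (k\<^sup>2 * ((fst p)\<^sup>2 + (snd p)\<^sup>2) + q2 (fst p) (snd p) r s) \<le> B\<^sup>2} = PE3 (cc p) (B / sqrt (nn p))"
proof -
  have n: "nn p > 0" using nn_pos[OF p] by simp
  have "real_of_int (k\<^sup>2 * ((fst p)\<^sup>2 + (snd p)\<^sup>2) + q2 (fst p) (snd p) r s) \<le> B\<^sup>2 \<longleftrightarrow>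
     (real_of_int k)\<^sup>2 + (real_of_int r)\<^sup>2 + (real_of_int s)\<^sup>2 + 2 * cc p * (real_of_int r * real_of_int s) \<le> (B / sqrt (nn p))\<^sup>2" for k r s
  proof -
    have "cc p * nn p = real_of_int (fst p) * real_of_int (snd p)" using n by (simp add: cc_def)
    hence c2: "2 * cc p * (real_of_int r * real_of_int s) * nn p
        = 2 * (real_of_int (fst p) * real_of_int (snd p)) * (real_of_int r * real_of_int s)"
      by (metis mult.assoc mult.commute)
    have "real_of_int (k\<^sup>2 * ((fst p)\<^sup>2 + (snd p)\<^sup>2) + q2 (fst p) (snd p) r s)
       = ((real_of_int k)\<^sup>2 + (real_of_int r)\<^sup>2 + (real_of_int s)\<^sup>2 + 2 * cc p * (real_of_int r * real_of_int s)) * nn p"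
      unfolding distrib_right c2 by (simp add: q2_def nn_def algebra_simps)
    moreover have "(B / sqrt (nn p))\<^sup>2 = B\<^sup>2 / nn p" using n by (simp add: power_divide)
    ultimately show ?thesis using n by (simp add: pos_le_divide_eq)
  qed
  thus ?thesis unfolding PE3_def E3_def by auto
qed

lemma N_W2_eq_sum:
  assumes B: "B \<ge> 1"
  shows "4 * real (N_norm W2 B) = (\<Sum>p\<in>{p \<in> prim2. max_norm p \<le> nat \<lfloor>B\<rfloor>}. real (card (PE3 (cc p) (B / sqrt (nn p)))))"
proof -
  define S where "S p = {(k, r, s). k \<noteq> 0 \<and> gcd k (gcd r s) = 1 \<and>
       real_of_int (k\<^sup>2 * ((fst p)\<^sup>2 + (snd p)\<^sup>2) + q2 (fst p) (snd p) r s) \<le> B\<^sup>2}" for p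
  have S: "S p = PE3 (cc p) (B / sqrt (nn p))" if "p \<in> prim2" for p
    unfolding S_def using S2_eq_PE3[OF that] B by simp
  have R0: "B / sqrt (nn p) \<ge> 0" if "p \<in> prim2" for p using B nn_pos[OF that] by simp
  have fin: "finite (S p)" if "p \<in> prim2" for p
  proof (cases "B / sqrt (nn p) \<ge> 1")
    case True
    have "PE3 (cc p) (B / sqrt (nn p)) \<subseteq> E3 (cc p) (B / sqrt (nn p))" by (auto simp: PE3_def)
    thus ?thesis using count_E3(1)[OF cc_le[OF that] True] S[OF that] by (simp add: finite_subset)
  next
    case False
    thus ?thesis using PE3_empty[OF cc_le[OF that] R0[OF that]] S[OF that] by simp
  qed
  have sup: "max_norm p \<le> nat \<lfloor>B\<rfloor>" if p: "p \<in> prim2" and ne: "S p \<noteq> {}" for p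
  proof -
    have "B / sqrt (nn p) \<ge> 1" using PE3_empty[OF cc_le[OF p] R0[OF p]] ne S[OF p] by force
    hence "sqrt (nn p) \<le> B" using nn_pos[OF p] by (simp add: le_divide_eq)
    moreover have "real (max_norm p) \<le> sqrt (nn p)" using nn_ge[of p] by (simp add: real_le_rsqrt)
    ultimately have "real (max_norm p) \<le> B" by linarith
    thus ?thesis by (rule le_nat_floor)
  qed
  have half: "card (S p) = 2 * card {(k, q) \<in> S p. k > 0}" if "p \<in> prim2" for p
    by (rule card_pos_half[OF fin[OF that]]) (auto simp: S_def)
  have "{((m, l), (k, r, s)). (m, l) \<in> prim2 \<and> k > 0 \<and> gcd k (gcd r s) = 1 \<and>
     real_of_int (k\<^sup>2 * (m\<^sup>2 + l\<^sup>2) + q2 m l r s) \<le> B\<^sup>2} = {(p, q). p \<in> prim2 \<and> q \<in> {(k, q) \<in> S p. k > 0}}"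
    by (auto simp: S_def)
  hence "2 * N_norm W2 B = card {(p, q). p \<in> prim2 \<and> q \<in> {(k, q) \<in> S p. k > 0}}"
    using card_W2_pos[of B] B by simp
  also have "\<dots> = (\<Sum>p\<in>{p \<in> prim2. max_norm p \<le> nat \<lfloor>B\<rfloor>}. card {(k, q) \<in> S p. k > 0})"
  proof (rule card_fibres)
    show "finite {(k, q) \<in> S p. k > 0}" if "p \<in> prim2" for p by (rule finite_subset[OF _ fin[OF that]]) auto
    show "max_norm p \<le> nat \<lfloor>B\<rfloor>" if "p \<in> prim2" "{(k, q) \<in> S p. k > 0} \<noteq> {}" for p
      using sup[OF that(1)] that(2) by auto
  qed
  finally have "4 * N_norm W2 B = (\<Sum>p\<in>{p \<in> prim2. max_norm p \<le> nat \<lfloor>B\<rfloor>}. 2 * card {(k, q) \<in> S p. k > 0})"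
    by (simp only: sum_distrib_left[symmetric])
  also have "\<dots> = (\<Sum>p\<in>{p \<in> prim2. max_norm p \<le> nat \<lfloor>B\<rfloor>}. card (PE3 (cc p) (B / sqrt (nn p))))"
    using half S by (intro sum.cong) auto
  finally have "real (4 * N_norm W2 B) = real (\<Sum>p\<in>{p \<in> prim2. max_norm p \<le> nat \<lfloor>B\<rfloor>}. card (PE3 (cc p) (B / sqrt (nn p))))"
    by (simp only:)
  thus ?thesis by simp
qed

definition g2 :: "int \<times> int \<Rightarrow> real" where "g2 p = 1 / sqrt (real_of_int (f2 (fst p) (snd p)))"

lemma f2_ge:
  assumes p: "p \<in> prim2"
  shows "3 / 4 * nn p ^ 3 \<le> real_of_int (f2 (fst p) (snd p))"
proof -
  have n: "nn p > 0" using nn_pos[OF p] by simp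
  have "real_of_int (fst p) * real_of_int (snd p) = cc p * nn p" using n by (simp add: cc_def)
  hence "real_of_int (f2 (fst p) (snd p)) = nn p ^ 3 * (1 - (cc p)\<^sup>2)"
    unfolding f2_eq by (simp add: power_mult_distrib) (simp add: power2_eq_square power3_eq_cube algebra_simps)
  moreover have "nn p ^ 3 * (3 / 4) \<le> nn p ^ 3 * (1 - (cc p)\<^sup>2)"
    using one_minus_square_ge[OF cc_le[OF p]] n by (intro mult_left_mono) auto
  ultimately show ?thesis by simp
qed

lemma g2_bounds:
  assumes p: "p \<in> prim2"
  shows "0 \<le> g2 p \<and> g2 p \<le> 2 / real (max_norm p) ^ 3"
proof -
  have s: "real (max_norm p) > 0" using max_norm_pos[OF p] by simp
  have "(real (max_norm p) ^ 3 / 2)\<^sup>2 = (real (max_norm p) ^ 2) ^ 3 / 4" by (simp add: power_divide power_mult[symmetric])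
  also have "\<dots> \<le> nn p ^ 3 / 4" using nn_ge[of p] by (intro divide_right_mono power_mono) auto
  also have "\<dots> \<le> 3 / 4 * nn p ^ 3" using nn_pos[OF p] by simp
  also have "\<dots> \<le> real_of_int (f2 (fst p) (snd p))" by (rule f2_ge[OF p])
  finally have le: "real (max_norm p) ^ 3 / 2 \<le> sqrt (real_of_int (f2 (fst p) (snd p)))" by (rule real_le_rsqrt)
  moreover have pos: "0 < real (max_norm p) ^ 3 / 2" using s by simp
  ultimately have "g2 p \<le> 1 / (real (max_norm p) ^ 3 / 2)"
    unfolding g2_def using less_le_trans[OF pos le] by (intro divide_left_mono mult_pos_pos) auto
  moreover have "0 \<le> g2 p" using less_le_trans[OF pos le] by (simp add: g2_def)
  ultimately show ?thesis by simp
qed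

lemma PE3_main_term:
  assumes p: "p \<in> prim2" and B: "B \<ge> 1"
  shows "ellipsoid_vol (cc p) * (B / sqrt (nn p)) ^ 3 / zeta 3 = (4 / 3 * pi * B ^ 3 / zeta 3) * g2 p"
proof -
  define n where "n = nn p"
  have n: "n > 0" using nn_pos[OF p] by (simp add: n_def)
  have "real_of_int (fst p) * real_of_int (snd p) = cc p * n" using n by (simp add: cc_def n_def)
  hence "real_of_int (f2 (fst p) (snd p)) = n ^ 3 * (1 - (cc p)\<^sup>2)"
    unfolding f2_eq n_def[symmetric] by (simp add: power_mult_distrib) (simp add: power2_eq_square power3_eq_cube algebra_simps)
  hence "sqrt (real_of_int (f2 (fst p) (snd p))) = sqrt n ^ 3 * sqrt (1 - (cc p)\<^sup>2)"
    by (simp add: real_sqrt_mult real_sqrt_power)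
  thus ?thesis by (simp add: g2_def ellipsoid_vol_def power_divide n_def)
qed

text \<open>When the radius is at least \<open>1\<close> this is the lattice point count. Otherwise no point is counted, and the
main term itself is smaller than the error term.\<close>

lemma PE3_error:
  assumes p: "p \<in> prim2" and B: "B \<ge> 1"
  shows "\<bar>real (card (PE3 (cc p) (B / sqrt (nn p)))) - (4 / 3 * pi * B ^ 3 / zeta 3) * g2 p\<bar>
    \<le> 250 * B\<^sup>2 * (1 / real (max_norm p) ^ 2)"
proof -
  define R where "R = B / sqrt (nn p)"
  have n: "nn p > 0" using nn_pos[OF p] by simp
  have R0: "R \<ge> 0" using B n by (simp add: R_def)
  have "R\<^sup>2 = B\<^sup>2 / nn p" using n by (simp add: R_def power_divide)
  also have "\<dots> \<le> B\<^sup>2 / real (max_norm p) ^ 2"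
    using nn_ge[of p] max_norm_pos[OF p] n by (intro divide_left_mono) auto
  finally have R2: "R\<^sup>2 \<le> B\<^sup>2 * (1 / real (max_norm p) ^ 2)" by simp
  have "\<bar>real (card (PE3 (cc p) R)) - ellipsoid_vol (cc p) * R ^ 3 / zeta 3\<bar> \<le> 250 * R\<^sup>2"
  proof (cases "R \<ge> 1")
    case True
    thus ?thesis by (rule count_PE3[OF cc_le[OF p]])
  next
    case False
    have w: "0 \<le> ellipsoid_vol (cc p)" "ellipsoid_vol (cc p) \<le> 8" using ellipsoid_vol_bounds[OF cc_le[OF p]] by auto
    have "ellipsoid_vol (cc p) * R ^ 3 / zeta 3 \<le> ellipsoid_vol (cc p) * R ^ 3 / 1"
      using zeta_3_bounds w R0 by (intro divide_left_mono) auto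
    also have "\<dots> \<le> 8 * R ^ 2"
      using w R0 False by (simp add: power3_eq_cube power2_eq_square) (intro mult_mono mult_left_le, auto)
    finally have "ellipsoid_vol (cc p) * R ^ 3 / zeta 3 \<le> 8 * R ^ 2" .
    moreover have "0 \<le> ellipsoid_vol (cc p) * R ^ 3 / zeta 3" using w R0 zeta_3_bounds by simp
    moreover have "0 \<le> R\<^sup>2" by simp
    moreover have "PE3 (cc p) R = {}" using PE3_empty[OF cc_le[OF p] R0] False by simp
    ultimately show ?thesis by simp
  qed
  thus ?thesis using R2 PE3_main_term[OF p B] unfolding R_def by simp
qed

text \<open>Four times the number of points is counted: both signs of the solution vector and both signs of \<open>k\<close>.
The errors \<open>O(B\<^sup>2/j\<^sup>2)\<close> add up to \<open>O(B\<^sup>2 log B)\<close> over norms \<open>j \<le> B\<close>, and the tail of the series,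
multiplied by \<open>B\<^sup>3\<close>, is \<open>O(B\<^sup>2)\<close>.\<close>

lemma W2_estimate:
  assumes B: "B \<ge> 1"
  shows "\<bar>4 * real (N_norm W2 B) - (4 / 3 * pi * B ^ 3 / zeta 3) * (\<Sum>\<^sub>\<infinity>p\<in>prim2. g2 p)\<bar> \<le> 2200 * B\<^sup>2 * (1 + ln B)"
proof -
  define J where "J = nat \<lfloor>B\<rfloor>"
  note J = floor_half(1-3)[OF B, folded J_def]
  have JB: "B \<le> real (Suc J)" unfolding J_def using B by linarith
  let ?K = "4 / 3 * pi * B ^ 3 / zeta 3"
  have K: "0 \<le> ?K" "?K \<le> 6 * B ^ 3"
  proof -
    show "0 \<le> ?K" using B zeta_3_bounds by simp
    have "?K \<le> 4 / 3 * pi * B ^ 3 / 1" using zeta_3_bounds B by (intro divide_left_mono) auto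
    also have "\<dots> \<le> 6 * B ^ 3" using pi_less_4 B by (simp add: mult_right_mono)
    finally show "?K \<le> 6 * B ^ 3" .
  qed
  have "\<bar>4 * real (N_norm W2 B) - ?K * (\<Sum>\<^sub>\<infinity>p\<in>prim2. g2 p)\<bar>
    \<le> (\<Sum>p\<in>{p \<in> prim2. max_norm p \<le> J}. 250 * B\<^sup>2 * (1 / real (max_norm p) ^ 2)) + ?K * (16 * 2 / real (Suc J))"
    unfolding N_W2_eq_sum[OF B] J_def[symmetric]
    by (rule sum_approx_infsum[OF max_norm_pos g2_bounds _ K(1) PE3_error[OF _ B]]) auto
  also have "(\<Sum>p\<in>{p \<in> prim2. max_norm p \<le> J}. 250 * B\<^sup>2 * (1 / real (max_norm p) ^ 2))
      \<le> (\<Sum>p | 0 < max_norm p \<and> max_norm p \<le> J. 250 * B\<^sup>2 * (1 / real (max_norm p) ^ 2))"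
  proof (rule sum_mono2)
    show "finite {p. 0 < max_norm p \<and> max_norm p \<le> J}" by (rule finite_subset[OF _ finite_max_norm_le[of J]]) auto
  qed (auto simp: max_norm_pos)
  also have "\<dots> = 250 * B\<^sup>2 * (\<Sum>p | 0 < max_norm p \<and> max_norm p \<le> J. 1 / real (max_norm p) ^ 2)" by (simp only: sum_distrib_left)
  also have "\<dots> \<le> 250 * B\<^sup>2 * (8 * (1 + ln (real J)))" using sum_shells_2[OF J(1)] by (intro mult_left_mono) auto
  also have "\<dots> \<le> 250 * B\<^sup>2 * (8 * (1 + ln B))" using J B by (intro mult_left_mono add_left_mono) auto
  also have "?K * (16 * 2 / real (Suc J)) \<le> 6 * B ^ 3 * (32 / B)"
    using K JB B by (intro mult_mono) (auto intro!: divide_left_mono)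
  also have "6 * B ^ 3 * (32 / B) = 192 * B\<^sup>2" using B by (simp add: power2_eq_square power3_eq_cube)
  also have "250 * B\<^sup>2 * (8 * (1 + ln B)) + 192 * B\<^sup>2 \<le> 2200 * B\<^sup>2 * (1 + ln B)"
  proof -
    have "B\<^sup>2 * 1 \<le> B\<^sup>2 * (1 + ln B)" using B by (intro mult_left_mono) auto
    thus ?thesis by (simp add: algebra_simps)
  qed
  finally show ?thesis by simp
qed

theorem W2_asymptotics:
  "(\<lambda>(m, l). 1 / sqrt (real_of_int (f2 m l))) summable_on prim2 \<and>
      (\<lambda>B::real. real (N_norm W2 B) -
          pi * B ^ 3 / (3 * zeta 3) *
            (\<Sum>\<^sub>\<infinity>(m, l)\<in>prim2. 1 / sqrt (real_of_int (f2 m l))))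
        \<in> O[at_top](\<lambda>B. B\<^sup>2 * ln B)"
proof
  have g2: "(\<lambda>(m, l). 1 / sqrt (real_of_int (f2 m l))) = g2" by (auto simp: g2_def fun_eq_iff)
  show "(\<lambda>(m, l). 1 / sqrt (real_of_int (f2 m l))) summable_on prim2"
    unfolding g2 by (rule shell_tail(1)[of _ _ 2]) (auto simp: max_norm_pos g2_bounds)
  show "(\<lambda>B::real. real (N_norm W2 B) - pi * B ^ 3 / (3 * zeta 3) *
            (\<Sum>\<^sub>\<infinity>(m, l)\<in>prim2. 1 / sqrt (real_of_int (f2 m l)))) \<in> O[at_top](\<lambda>B. B\<^sup>2 * ln B)"
    unfolding g2
  proof (rule bigoI[of _ 1100], rule eventually_at_top_linorderI[of "exp 1"])
    fix B :: real assume B: "exp 1 \<le> B"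
    have B1: "B \<ge> 1" using B exp_ge_add_one_self[of 1] by linarith
    have l1: "ln B \<ge> 1" using B B1 ln_le_cancel_iff[of "exp 1" B] by simp
    let ?\<Sigma> = "\<Sum>\<^sub>\<infinity>p\<in>prim2. g2 p"
    have "4 * (real (N_norm W2 B) - pi * B ^ 3 / (3 * zeta 3) * ?\<Sigma>) = 4 * real (N_norm W2 B) - (4 / 3 * pi * B ^ 3 / zeta 3) * ?\<Sigma>"
      by (simp add: right_diff_distrib)
    hence "4 * \<bar>real (N_norm W2 B) - pi * B ^ 3 / (3 * zeta 3) * ?\<Sigma>\<bar> \<le> 2200 * B\<^sup>2 * (1 + ln B)"
      using W2_estimate[OF B1] by (metis abs_mult abs_numeral)
    also have "\<dots> \<le> 2200 * B\<^sup>2 * (2 * ln B)" using l1 by (intro mult_left_mono) auto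
    finally have "\<bar>real (N_norm W2 B) - pi * B ^ 3 / (3 * zeta 3) * ?\<Sigma>\<bar> \<le> 1100 * (B\<^sup>2 * ln B)" by (simp add: mult_ac)
    thus "norm (real (N_norm W2 B) - pi * B ^ 3 / (3 * zeta 3) * ?\<Sigma>) \<le> 1100 * norm (B\<^sup>2 * ln B)"
      using l1 by simp
  qed
qed

section \<open>The surface\<close>

text \<open>For \<open>p = (\<mu>, \<lambda>)\<close> the height form on the lattice of the surface is \<open>nn p \<cdot> k\<^sup>2 + qq a p \<cdot> h\<^sup>2\<close>.\<close>

definition qq :: "int \<Rightarrow> int \<times> int \<Rightarrow> real" where "qq a p = real_of_int (q1 a (fst p) (snd p))"

text \<open>With \<open>x = \<mu>\<^sup>2\<close> and \<open>y = \<lambda>\<^sup>2\<close> the form is \<open>(\<mu>\<^sup>2 + a \<lambda>\<^sup>2)\<^sup>2 + \<mu>\<^sup>2 \<lambda>\<^sup>2\<close>. If \<open>x\<close> and \<open>y\<close> are comparable up to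
the factor \<open>2 \<bar>a\<bar>\<close>, the term \<open>x y\<close> suffices; otherwise one of the summands in \<open>x + a y\<close> dominates. For
\<open>a < 0\<close> the square may be small, but only where \<open>x\<close> and \<open>y\<close> are comparable.\<close>

lemma quartic_form_lower_bound:
  fixes x y a :: real
  assumes x: "0 \<le> x" and y: "0 \<le> y" and a: "1 \<le> \<bar>a\<bar>"
  shows "(max x y)\<^sup>2 \<le> 4 * \<bar>a\<bar> * ((x + a * y)\<^sup>2 + x * y)"
proof -
  have half: "t\<^sup>2 \<le> 4 * \<bar>a\<bar> * ((x + a * y)\<^sup>2 + x * y)" if t: "0 \<le> t" "t / 2 \<le> \<bar>x + a * y\<bar>" for t
  proof -
    have "\<bar>t / 2\<bar> \<le> \<bar>x + a * y\<bar>" using t by simp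
    hence "(t / 2)\<^sup>2 \<le> (x + a * y)\<^sup>2" by (simp only: abs_le_square_iff)
    hence "t\<^sup>2 \<le> 4 * (x + a * y)\<^sup>2" by (simp add: power_divide)
    also have "\<dots> \<le> 4 * ((x + a * y)\<^sup>2 + x * y)" using x y by simp
    also have "\<dots> \<le> \<bar>a\<bar> * (4 * ((x + a * y)\<^sup>2 + x * y))" using mult_right_mono[OF a, of "4 * ((x + a * y)\<^sup>2 + x * y)"] x y by simp
    finally show ?thesis by (simp add: mult_ac)
  qed
  have prod: "t\<^sup>2 \<le> 4 * \<bar>a\<bar> * ((x + a * y)\<^sup>2 + x * y)" if "t\<^sup>2 \<le> 4 * \<bar>a\<bar> * (x * y)" for t
  proof -
    have "4 * \<bar>a\<bar> * (x * y) \<le> 4 * \<bar>a\<bar> * ((x + a * y)\<^sup>2 + x * y)" by (intro mult_left_mono) auto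
    thus ?thesis using that by linarith
  qed
  have ay: "\<bar>a * y\<bar> = \<bar>a\<bar> * y" using y by (simp add: abs_mult)
  show ?thesis
  proof (cases "y \<le> x")
    case True
    have "x\<^sup>2 \<le> 4 * \<bar>a\<bar> * ((x + a * y)\<^sup>2 + x * y)"
    proof (cases "x \<le> 2 * (\<bar>a\<bar> * y)")
      case True
      hence "x * x \<le> x * (2 * (\<bar>a\<bar> * y))" using x by (intro mult_left_mono)
      moreover have "0 \<le> x * (\<bar>a\<bar> * y)" using x y by simp
      ultimately have "x\<^sup>2 \<le> 4 * \<bar>a\<bar> * (x * y)" by (simp add: power2_eq_square mult_ac)
      thus ?thesis by (rule prod)
    next
      case False
      hence "x / 2 \<le> \<bar>x + a * y\<bar>" using ay by linarith
      thus ?thesis using x by (intro half)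
    qed
    thus ?thesis using True by (simp add: max_def)
  next
    case False
    have yb: "y \<le> \<bar>a\<bar> * y" using mult_right_mono[OF a y] by simp
    have "y\<^sup>2 \<le> 4 * \<bar>a\<bar> * ((x + a * y)\<^sup>2 + x * y)"
    proof (cases "y \<le> 2 * x")
      case True
      hence "y * y \<le> (2 * x) * (\<bar>a\<bar> * y)" using y yb x by (intro mult_mono) auto
      moreover have "0 \<le> x * (\<bar>a\<bar> * y)" using x y by simp
      ultimately have "y\<^sup>2 \<le> 4 * \<bar>a\<bar> * (x * y)" by (simp add: power2_eq_square mult_ac)
      thus ?thesis by (rule prod)
    next
      case False
      hence "y / 2 \<le> \<bar>x + a * y\<bar>" using ay yb x by linarith
      thus ?thesis using y by (intro half)
    qed
    thus ?thesis using False by (simp add: max_def)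
  qed
qed

lemma finite_PE2: "U > 0 \<Longrightarrow> V > 0 \<Longrightarrow> finite (PE2 U V)"
proof -
  assume "U > 0" "V > 0"
  have "finite (E2 U V)"
  proof (cases "U \<ge> 1 \<and> V \<ge> 1")
    case True
    thus ?thesis using count_E2(1) by blast
  next
    case False
    thus ?thesis using E2_empty[OF \<open>U > 0\<close> \<open>V > 0\<close>] by (metis finite.emptyI not_less)
  qed
  thus ?thesis by (rule finite_subset[rotated]) (auto simp: PE2_def)
qed

lemma prim2_axis: "{p \<in> prim2. fst p = 0} = {(0, 1), (0, - 1)}" "{p \<in> prim2. snd p = 0} = {(1, 0), (- 1, 0)}"
proof -
  have "l = 1 \<or> l = -1" if "\<bar>l\<bar> = 1" for l :: int using that by linarith
  thus "{p \<in> prim2. fst p = 0} = {(0, 1), (0, - 1)}" "{p \<in> prim2. snd p = 0} = {(1, 0), (- 1, 0)}"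
    by (auto simp: prim2_def)
qed

text \<open>The summand \<open>4\<close> counts the primitive vectors on the two axes, which \<open>PE2\<close> omits.\<close>

lemma card_prim2_disc:
  assumes B: "B \<ge> 1"
  shows "card {p \<in> prim2. nn p \<le> B\<^sup>2} = card (PE2 B B) + 4"
proof -
  have B2: "1 \<le> B\<^sup>2" using B by simp
  have iff: "(k / B)\<^sup>2 + (h / B)\<^sup>2 \<le> 1 \<longleftrightarrow> nn (k, h) \<le> B\<^sup>2" for k h :: int
  proof -
    have "(k / B)\<^sup>2 + (h / B)\<^sup>2 = nn (k, h) / B\<^sup>2" by (simp add: nn_def power_divide add_divide_distrib)
    thus ?thesis using B by (simp add: divide_le_eq)
  qed
  have "{p \<in> prim2. nn p \<le> B\<^sup>2} = PE2 B B \<union> ({p \<in> prim2. fst p = 0} \<union> {p \<in> prim2. snd p = 0})"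
  proof (intro equalityI subsetI)
    fix z assume z: "z \<in> {p \<in> prim2. nn p \<le> B\<^sup>2}"
    obtain k h where k: "z = (k, h)" by (cases z)
    show "z \<in> PE2 B B \<union> ({p \<in> prim2. fst p = 0} \<union> {p \<in> prim2. snd p = 0})"
      using z iff[of k h] by (auto simp: k PE2_def E2_def prim2_def)
  next
    fix z assume z: "z \<in> PE2 B B \<union> ({p \<in> prim2. fst p = 0} \<union> {p \<in> prim2. snd p = 0})"
    obtain k h where k: "z = (k, h)" by (cases z)
    show "z \<in> {p \<in> prim2. nn p \<le> B\<^sup>2}"
    proof (cases "z \<in> PE2 B B")
      case True
      thus ?thesis using iff[of k h] by (auto simp: k PE2_def E2_def prim2_def)
    next
      case False
      hence "z \<in> {(0, 1), (0, - 1)} \<union> {(1, 0), (- 1, 0)}" using z unfolding prim2_axis by blast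
      thus ?thesis using B2 by (auto simp: nn_def prim2_def)
    qed
  qed
  moreover have "card (PE2 B B \<union> ({(0, 1), (0, - 1)} \<union> {(1, 0), (- 1, 0)})) = card (PE2 B B) + card ({(0, 1), (0, - 1)} \<union> {(1, 0), (- 1, 0)} :: (int \<times> int) set)"
    using finite_PE2[of B B] B by (intro card_Un_disjoint) (auto simp: PE2_def E2_def)
  moreover have "card ({(0, 1), (0, - 1)} \<union> {(1, 0), (- 1, 0)} :: (int \<times> int) set) = 4" by simp
  ultimately show ?thesis unfolding prim2_axis by simp
qed

lemma combine_errors:
  fixes N S t k G d e :: real
  assumes N: "N = S + 2 * t + 2 * (t + 4)" and S: "\<bar>S - k * G\<bar> \<le> d" and t: "\<bar>t - k\<bar> \<le> e"
  shows "\<bar>N - k * (4 + G)\<bar> \<le> d + 4 * e + 8"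
proof -
  have e: "N - k * (4 + G) = (S - k * G) + 4 * (t - k) + 8" unfolding N by (simp add: algebra_simps)
  have "\<bar>x + 4 * y + 8\<bar> \<le> d + 4 * e + 8" if "\<bar>x\<bar> \<le> d" "\<bar>y\<bar> \<le> e" for x y
    using that by linarith
  from this[OF S t] show ?thesis unfolding e .
qed

context
  fixes a :: int
  assumes a: "a \<noteq> 0"
begin

lemma qq_times_gcd:
  assumes p: "p \<in> prim2"
  shows "qq a p * (real_of_int (gcd a (fst p)))\<^sup>2
    = ((real_of_int (fst p))\<^sup>2 + real_of_int a * (real_of_int (snd p))\<^sup>2)\<^sup>2 + (real_of_int (fst p))\<^sup>2 * (real_of_int (snd p))\<^sup>2"
proof -
  obtain m l where p': "p = (m, l)" by (cases p)
  have ml: "gcd m l = 1" using p by (simp add: p' prim2_def)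
  have "q1 a m l * (gcd a m)\<^sup>2 = (gcd a m * v1 a m l)\<^sup>2 + (gcd a m * u1 a m l)\<^sup>2"
    by (simp add: q1_def power_mult_distrib algebra_simps)
  also have "\<dots> = (m\<^sup>2 + a * l\<^sup>2)\<^sup>2 + (m * l)\<^sup>2"
    unfolding line_coeffs(1)[OF a ml, symmetric] line_coeffs(2)[OF a ml, symmetric] ..
  finally have "q1 a m l * (gcd a m)\<^sup>2 = (m\<^sup>2 + a * l\<^sup>2)\<^sup>2 + (m * l)\<^sup>2" .
  from arg_cong[OF this, of real_of_int] show ?thesis
    by (simp add: qq_def p' power_mult_distrib)
qed

lemma qq_ge_1:
  assumes p: "p \<in> prim2"
  shows "1 \<le> qq a p"
proof -
  obtain m l where p': "p = (m, l)" by (cases p)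
  have ml: "gcd m l = 1" using p by (simp add: p' prim2_def)
  have "u1 a m l \<noteq> 0 \<or> v1 a m l \<noteq> 0" using line_coeffs(3)[OF a ml] by auto
  hence "q1 a m l > 0" unfolding q1_def by (simp add: sum_power2_gt_zero_iff)
  thus ?thesis by (simp add: qq_def p')
qed

lemma qq_lower:
  assumes p: "p \<in> prim2"
  shows "real (max_norm p) ^ 2 / (2 * (real_of_int a)\<^sup>2) \<le> sqrt (qq a p)"
proof -
  define m where "m = real_of_int (fst p)"
  define l where "l = real_of_int (snd p)"
  define \<alpha> where "\<alpha> = \<bar>real_of_int a\<bar>"
  have \<alpha>: "1 \<le> \<alpha>" using a by (simp add: \<alpha>_def)
  have aa: "(real_of_int a)\<^sup>2 = \<alpha>\<^sup>2" by (simp add: \<alpha>_def)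
  have "real (max_norm p) = max \<bar>m\<bar> \<bar>l\<bar>" by (auto simp: max_norm_def m_def l_def max_def)
  hence s: "real (max_norm p) ^ 2 = max (m\<^sup>2) (l\<^sup>2)"
    using abs_le_square_iff[of m l] abs_le_square_iff[of l m] by (auto simp: max_def)
  have "(real (max_norm p) ^ 2)\<^sup>2 \<le> 4 * \<alpha> * ((m\<^sup>2 + real_of_int a * l\<^sup>2)\<^sup>2 + m\<^sup>2 * l\<^sup>2)"
    unfolding s \<alpha>_def by (rule quartic_form_lower_bound) (use \<alpha> in \<open>auto simp: \<alpha>_def\<close>)
  also have "\<dots> = 4 * \<alpha> * (qq a p * (real_of_int (gcd a (fst p)))\<^sup>2)"
    using qq_times_gcd[OF p] by (simp add: m_def l_def)
  also have "\<dots> \<le> 4 * \<alpha>\<^sup>2 * (qq a p * \<alpha>\<^sup>2)"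
  proof (rule mult_mono)
    show "4 * \<alpha> \<le> 4 * \<alpha>\<^sup>2" using \<alpha> by (simp add: power2_eq_square)
    have "gcd a (fst p) \<le> \<bar>a\<bar>" using a by (auto intro: zdvd_imp_le)
    hence "real_of_int (gcd a (fst p)) \<le> \<alpha>" unfolding \<alpha>_def by linarith
    moreover have "0 \<le> real_of_int (gcd a (fst p))" by simp
    ultimately show "qq a p * (real_of_int (gcd a (fst p)))\<^sup>2 \<le> qq a p * \<alpha>\<^sup>2"
      using qq_ge_1[OF p] by (intro mult_left_mono power_mono) auto
  qed (use \<alpha> qq_ge_1[OF p] in auto)
  also have "\<dots> = (2 * \<alpha>\<^sup>2)\<^sup>2 * qq a p" by (simp add: power2_eq_square)
  finally have "(real (max_norm p) ^ 2)\<^sup>2 / (2 * \<alpha>\<^sup>2)\<^sup>2 \<le> qq a p" using \<alpha> by (simp add: divide_le_eq mult_ac)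
  hence "(real (max_norm p) ^ 2 / (2 * \<alpha>\<^sup>2))\<^sup>2 \<le> qq a p" by (simp only: power_divide)
  thus ?thesis unfolding aa by (rule real_le_rsqrt)
qed

definition g1 :: "int \<times> int \<Rightarrow> real" where
  "g1 p = real_of_int (gcd a (fst p)) / sqrt (real_of_int (f1 a (fst p) (snd p)))"

lemma g1_eq:
  assumes p: "p \<in> prim2"
  shows "g1 p = 1 / (sqrt (nn p) * sqrt (qq a p))"
proof -
  let ?g = "real_of_int (gcd a (fst p))"
  have g: "?g > 0" using a by simp
  have "real_of_int (f1 a (fst p) (snd p)) = nn p * (qq a p * ?g\<^sup>2)"
    unfolding qq_times_gcd[OF p] by (simp add: f1_def nn_def algebra_simps)
  hence "sqrt (real_of_int (f1 a (fst p) (snd p))) = sqrt (nn p) * sqrt (qq a p) * ?g"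
    using g by (simp add: real_sqrt_mult)
  thus ?thesis using g by (simp add: g1_def)
qed

text \<open>The ellipse of \<open>p\<close> has semi-axes \<open>O(B/s)\<close> and \<open>O(B/s\<^sup>2)\<close>, where \<open>s\<close> is the maximum norm of \<open>p\<close>.\<close>

lemma semiaxes:
  assumes p: "p \<in> prim2" and B: "B \<ge> 1"
  defines "s \<equiv> real (max_norm p)"
  shows "0 < B / sqrt (nn p)" "B / sqrt (nn p) \<le> B" "B / sqrt (nn p) \<le> B / s"
    "0 < B / sqrt (qq a p)" "B / sqrt (qq a p) \<le> 2 * (real_of_int a)\<^sup>2 * B / s\<^sup>2" "s \<ge> 1"
proof -
  have n: "1 \<le> nn p" by (rule nn_pos[OF p])
  have q: "1 \<le> qq a p" by (rule qq_ge_1[OF p])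
  show s1: "s \<ge> 1" using max_norm_pos[OF p] by (simp add: s_def)
  have sn: "s \<le> sqrt (nn p)" unfolding s_def by (rule real_le_rsqrt[OF nn_ge])
  show "0 < B / sqrt (nn p)" "0 < B / sqrt (qq a p)" using n q B by auto
  have "B / sqrt (nn p) \<le> B / 1" using n B by (intro divide_left_mono) auto
  thus "B / sqrt (nn p) \<le> B" by simp
  show "B / sqrt (nn p) \<le> B / s" using sn s1 B n by (intro divide_left_mono) auto
  have "0 < s\<^sup>2 / (2 * (real_of_int a)\<^sup>2)" using s1 a by simp
  hence "B / sqrt (qq a p) \<le> B / (s\<^sup>2 / (2 * (real_of_int a)\<^sup>2))"
    using qq_lower[OF p] B q unfolding s_def by (intro divide_left_mono mult_pos_pos) auto
  thus "B / sqrt (qq a p) \<le> 2 * (real_of_int a)\<^sup>2 * B / s\<^sup>2" by (simp add: mult_ac)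
qed

lemma g1_bounds:
  assumes p: "p \<in> prim2"
  shows "0 \<le> g1 p \<and> g1 p \<le> 2 * (real_of_int a)\<^sup>2 / real (max_norm p) ^ 3"
proof -
  note S = semiaxes[OF p order_refl]
  have "g1 p = (1 / sqrt (nn p)) * (1 / sqrt (qq a p))" by (simp add: g1_eq[OF p])
  also have "\<dots> \<le> (1 / real (max_norm p)) * (2 * (real_of_int a)\<^sup>2 * 1 / real (max_norm p) ^ 2)"
    using S by (intro mult_mono) auto
  finally have "g1 p \<le> 2 * (real_of_int a)\<^sup>2 / real (max_norm p) ^ 3" by (simp add: power3_eq_cube power2_eq_square)
  moreover have "0 \<le> g1 p" using nn_pos[OF p] qq_ge_1[OF p] by (simp add: g1_eq[OF p])
  ultimately show ?thesis by simp
qed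

abbreviation "P1 B p \<equiv> PE2 (B / sqrt (nn p)) (B / sqrt (qq a p))"

text \<open>Since points on the axes are excluded, both semi-axes must have length at least \<open>1\<close>. The second one
forces the norm of \<open>p\<close> to be \<open>O(\<surd>B)\<close>, which is what brings the exponent of the error down to \<open>3/2\<close>.\<close>

lemma P1_nonempty:
  assumes p: "p \<in> prim2" and B: "B \<ge> 1" and ne: "P1 B p \<noteq> {}"
  shows "real (max_norm p) \<le> 2 * \<bar>real_of_int a\<bar> * sqrt B" "real (max_norm p) \<le> B"
proof -
  note S = semiaxes[OF p B]
  have UV: "B / sqrt (nn p) \<ge> 1" "B / sqrt (qq a p) \<ge> 1" using PE2_empty[OF S(1,4)] ne by (meson not_less)+
  have "1 \<le> 2 * (real_of_int a)\<^sup>2 * B / real (max_norm p) ^ 2" using UV(2) S(5) by linarith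
  hence "real (max_norm p) ^ 2 \<le> 2 * (real_of_int a)\<^sup>2 * B" using S(6) by (simp add: le_divide_eq split: if_splits)
  also have "\<dots> \<le> 4 * (real_of_int a)\<^sup>2 * B" using B by (intro mult_right_mono) auto
  also have "\<dots> = (2 * \<bar>real_of_int a\<bar> * sqrt B)\<^sup>2" using B by (simp add: power_mult_distrib)
  finally show "real (max_norm p) \<le> 2 * \<bar>real_of_int a\<bar> * sqrt B" by (rule power2_le_imp_le) (use B in simp)
  have "1 \<le> B / real (max_norm p)" using UV(1) S(3) by linarith
  thus "real (max_norm p) \<le> B" using S(6) by (simp add: le_divide_eq)
qed

text \<open>If a semi-axis is shorter than \<open>1\<close> the set is empty, and the main term is at most a constant times
\<open>U V \<le> U + V\<close>, which is within the error.\<close>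

lemma P1_error:
  assumes p: "p \<in> prim2" and B: "B \<ge> 1"
  shows "\<bar>real (card (P1 B p)) - (pi * B\<^sup>2 / zeta 2) * g1 p\<bar>
    \<le> 25 * (1 + 2 * (real_of_int a)\<^sup>2) * B * (1 + ln B) * (1 / real (max_norm p))"
proof -
  define U where "U = B / sqrt (nn p)"
  define V where "V = B / sqrt (qq a p)"
  define s where "s = real (max_norm p)"
  note S = semiaxes[OF p B, folded U_def V_def s_def]
  have main: "(pi * B\<^sup>2 / zeta 2) * g1 p = pi * U * V / zeta 2"
    by (simp add: g1_eq[OF p] U_def V_def power2_eq_square mult_ac)
  have "2 * (real_of_int a)\<^sup>2 * B / s\<^sup>2 \<le> 2 * (real_of_int a)\<^sup>2 * B / s"
    using S(6) B by (intro divide_left_mono) (auto simp: power2_eq_square)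
  hence UV: "U + V \<le> (1 + 2 * (real_of_int a)\<^sup>2) * B * (1 / s)"
    using S(3,5) by (simp add: distrib_right add_divide_distrib)
  have lnB: "0 \<le> ln B" using B by simp
  have "\<bar>real (card (PE2 U V)) - pi * U * V / zeta 2\<bar> \<le> 25 * (U + V) * (1 + ln B)"
  proof (cases "U \<ge> 1 \<and> V \<ge> 1")
    case True
    have "\<bar>real (card (PE2 U V)) - pi * U * V / zeta 2\<bar> \<le> 25 * (U + V) * (1 + ln U)"
      using True by (intro count_PE2) auto
    also have "\<dots> \<le> 25 * (U + V) * (1 + ln B)" using True S(2) by (intro mult_left_mono add_left_mono) auto
    finally show ?thesis .
  next
    case False
    have "PE2 U V = {}" using PE2_empty[OF S(1,4)] False by (meson not_less)
    moreover have "0 \<le> pi * U * V / zeta 2" using S(1,4) zeta_2_bounds by simp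
    moreover have "pi * U * V / zeta 2 \<le> 25 * (U + V) * (1 + ln B)"
    proof -
      have "U * V \<le> U + V"
      proof (cases "U < 1")
        case True
        have "U * V \<le> 1 * V" using True S(4) by (intro mult_right_mono) auto
        thus ?thesis using S(1) by simp
      next
        case f: False
        have "U * V \<le> U * 1" using f False S(1) by (intro mult_left_mono) auto
        thus ?thesis using S(4) by simp
      qed
      hence uv: "pi * (U * V) \<le> 4 * (U + V)" using pi_less_4 S(1,4) by (intro mult_mono) auto
      have "pi * U * V / zeta 2 \<le> pi * U * V / 1" using zeta_2_bounds S(1,4) by (intro divide_left_mono) auto
      also have "\<dots> \<le> 4 * (U + V)" using uv by simp
      also have "\<dots> \<le> 25 * (U + V)" using S(1,4) by simp
      also have "\<dots> \<le> 25 * (U + V) * (1 + ln B)"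
        using mult_left_mono[of 1 "1 + ln B" "25 * (U + V)"] lnB S(1,4) by simp
      finally show ?thesis .
    qed
    ultimately show ?thesis by simp
  qed
  also have "\<dots> \<le> 25 * ((1 + 2 * (real_of_int a)\<^sup>2) * B * (1 / s)) * (1 + ln B)"
    using UV lnB by (intro mult_right_mono mult_left_mono) auto
  also have "\<dots> = 25 * (1 + 2 * (real_of_int a)\<^sup>2) * B * (1 + ln B) * (1 / s)" by (simp only: mult_ac)
  finally show ?thesis unfolding main by (simp only: U_def V_def s_def)
qed

text \<open>The coprime vectors with \<open>h = 0\<close> are \<open>(1, 0)\<close> and \<open>(- 1, 0)\<close>. They give the points on the line
\<open>t\<^sub>2 = t\<^sub>3 = 0\<close>.\<close>

lemma S1_split:
  assumes p: "p \<in> prim2" and B: "B \<ge> 1"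
  shows "{(k, h). k \<noteq> 0 \<and> gcd k h = 1 \<and>
       real_of_int (k\<^sup>2 * ((fst p)\<^sup>2 + (snd p)\<^sup>2) + h\<^sup>2 * q1 a (fst p) (snd p)) \<le> B\<^sup>2}
    = P1 B p \<union> (if nn p \<le> B\<^sup>2 then {(1, 0), (- 1, 0)} else {})"
proof -
  have n: "nn p > 0" and q: "qq a p > 0" using nn_pos[OF p] qq_ge_1[OF p] by auto
  have form: "real_of_int (k\<^sup>2 * ((fst p)\<^sup>2 + (snd p)\<^sup>2) + h\<^sup>2 * q1 a (fst p) (snd p)) = (real_of_int k)\<^sup>2 * nn p + (real_of_int h)\<^sup>2 * qq a p" for k h
    by (simp add: nn_def qq_def)
  have iff: "(real_of_int k)\<^sup>2 * nn p + (real_of_int h)\<^sup>2 * qq a p \<le> B\<^sup>2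
     \<longleftrightarrow> (k / (B / sqrt (nn p)))\<^sup>2 + (h / (B / sqrt (qq a p)))\<^sup>2 \<le> 1" for k h
  proof -
    have "(k / (B / sqrt (nn p)))\<^sup>2 + (h / (B / sqrt (qq a p)))\<^sup>2 = ((real_of_int k)\<^sup>2 * nn p + (real_of_int h)\<^sup>2 * qq a p) / B\<^sup>2"
      using n q by (simp add: power_divide power_mult_distrib add_divide_distrib)
    thus ?thesis using B by (simp add: divide_le_eq)
  qed
  show ?thesis
  proof (intro equalityI subsetI)
    fix z assume z: "z \<in> {(k, h). k \<noteq> 0 \<and> gcd k h = 1 \<and>
       real_of_int (k\<^sup>2 * ((fst p)\<^sup>2 + (snd p)\<^sup>2) + h\<^sup>2 * q1 a (fst p) (snd p)) \<le> B\<^sup>2}"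
    obtain k h where k: "z = (k, h)" by (cases z)
    have z': "k \<noteq> 0" "gcd k h = 1" "(real_of_int k)\<^sup>2 * nn p + (real_of_int h)\<^sup>2 * qq a p \<le> B\<^sup>2"
      using z unfolding k form by simp_all
    show "z \<in> P1 B p \<union> (if nn p \<le> B\<^sup>2 then {(1, 0), (- 1, 0)} else {})"
    proof (cases "h = 0")
      case True
      have k1: "\<bar>k\<bar> = 1" using z'(2) True by simp
      hence "k = 1 \<or> k = -1" by linarith
      moreover have "(real_of_int k)\<^sup>2 = 1" using k1 by (metis of_int_1 of_int_abs one_power2 power2_abs)
      ultimately show ?thesis using z'(3) True by (auto simp: k)
    next
      case False
      thus ?thesis using z' iff[of k h] by (simp add: k PE2_def E2_def)
    qed
  next
    fix z assume z: "z \<in> P1 B p \<union> (if nn p \<le> B\<^sup>2 then {(1, 0), (- 1, 0)} else {})"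
    obtain k h where k: "z = (k, h)" by (cases z)
    have "k \<noteq> 0 \<and> gcd k h = 1 \<and> (real_of_int k)\<^sup>2 * nn p + (real_of_int h)\<^sup>2 * qq a p \<le> B\<^sup>2"
    proof (cases "z \<in> P1 B p")
      case True
      thus ?thesis unfolding iff by (simp add: k PE2_def E2_def)
    next
      case False
      hence "nn p \<le> B\<^sup>2" "k = 1 \<or> k = -1" "h = 0" using z by (auto simp: k split: if_splits)
      thus ?thesis by auto
    qed
    thus "z \<in> {(k, h). k \<noteq> 0 \<and> gcd k h = 1 \<and>
       real_of_int (k\<^sup>2 * ((fst p)\<^sup>2 + (snd p)\<^sup>2) + h\<^sup>2 * q1 a (fst p) (snd p)) \<le> B\<^sup>2}"
      unfolding k form[symmetric] by simp
  qed
qed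

lemma N_W1_eq_sum:
  assumes B: "B \<ge> 1" and J: "B \<le> real J"
  shows "4 * real (N_norm (W1 a) B) = (\<Sum>p\<in>{p \<in> prim2. max_norm p \<le> J}. real (card (P1 B p))) + 2 * real (card {p \<in> prim2. nn p \<le> B\<^sup>2})"
proof -
  define S where "S p = {(k, h). k \<noteq> 0 \<and> gcd k h = 1 \<and>
       real_of_int (k\<^sup>2 * ((fst p)\<^sup>2 + (snd p)\<^sup>2) + h\<^sup>2 * q1 a (fst p) (snd p)) \<le> B\<^sup>2}" for p
  have S: "S p = P1 B p \<union> (if nn p \<le> B\<^sup>2 then {(1, 0), (- 1, 0)} else {})" if "p \<in> prim2" for p
    unfolding S_def by (rule S1_split[OF that B])
  have finP: "finite (P1 B p)" if "p \<in> prim2" for p using semiaxes[OF that B] by (intro finite_PE2)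
  have fin: "finite (S p)" if "p \<in> prim2" for p using finP[OF that] S[OF that] by simp
  have card: "card (S p) = card (P1 B p) + (if nn p \<le> B\<^sup>2 then 2 else 0)" if "p \<in> prim2" for p
    unfolding S[OF that] using finP[OF that] by (subst card_Un_disjoint) (auto simp: PE2_def E2_def)
  have sn: "max_norm p \<le> J" if "nn p \<le> B\<^sup>2" for p
  proof -
    have "real (max_norm p) ^ 2 \<le> B\<^sup>2" using nn_ge[of p] that by linarith
    hence "real (max_norm p) \<le> B" by (rule power2_le_imp_le) (use B in simp)
    thus ?thesis using J by linarith
  qed
  have sup: "max_norm p \<le> J" if p: "p \<in> prim2" and ne: "S p \<noteq> {}" for p
  proof (cases "nn p \<le> B\<^sup>2")
    case False
    hence "P1 B p \<noteq> {}" using ne S[OF p] by simp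
    hence "real (max_norm p) \<le> real J" using P1_nonempty(2)[OF p B] J by linarith
    thus ?thesis by simp
  qed (rule sn)
  have half: "card (S p) = 2 * card {(k, q) \<in> S p. k > 0}" if "p \<in> prim2" for p
    by (rule card_pos_half[OF fin[OF that]]) (auto simp: S_def)
  have "{((m, l), (k, h)). (m, l) \<in> prim2 \<and> k > 0 \<and> gcd k h = 1 \<and>
     real_of_int (k\<^sup>2 * (m\<^sup>2 + l\<^sup>2) + h\<^sup>2 * q1 a m l) \<le> B\<^sup>2} = {(p, q). p \<in> prim2 \<and> q \<in> {(k, q) \<in> S p. k > 0}}"
    by (auto simp: S_def)
  hence "2 * N_norm (W1 a) B = card {(p, q). p \<in> prim2 \<and> q \<in> {(k, q) \<in> S p. k > 0}}"
    using card_W1_pos[OF a, of B] B by simp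
  also have "\<dots> = (\<Sum>p\<in>{p \<in> prim2. max_norm p \<le> J}. card {(k, q) \<in> S p. k > 0})"
  proof (rule card_fibres)
    show "finite {(k, q) \<in> S p. k > 0}" if "p \<in> prim2" for p by (rule finite_subset[OF _ fin[OF that]]) auto
    show "max_norm p \<le> J" if "p \<in> prim2" "{(k, q) \<in> S p. k > 0} \<noteq> {}" for p
      using sup[OF that(1)] that(2) by auto
  qed
  finally have "4 * N_norm (W1 a) B = (\<Sum>p\<in>{p \<in> prim2. max_norm p \<le> J}. 2 * card {(k, q) \<in> S p. k > 0})"
    by (simp only: sum_distrib_left[symmetric])
  also have "\<dots> = (\<Sum>p\<in>{p \<in> prim2. max_norm p \<le> J}. card (P1 B p) + (if nn p \<le> B\<^sup>2 then 2 else 0))"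
    using half card by (intro sum.cong) auto
  also have "\<dots> = (\<Sum>p\<in>{p \<in> prim2. max_norm p \<le> J}. card (P1 B p)) + (\<Sum>p\<in>{p \<in> prim2. max_norm p \<le> J}. if nn p \<le> B\<^sup>2 then 2 else 0)"
    by (rule sum.distrib)
  also have "(\<Sum>p\<in>{p \<in> prim2. max_norm p \<le> J}. if nn p \<le> B\<^sup>2 then 2 else 0) = (\<Sum>p\<in>{p \<in> prim2. nn p \<le> B\<^sup>2}. 2 :: nat)"
  proof (rule sum.mono_neutral_cong_right)
    show "finite {p \<in> prim2. max_norm p \<le> J}" by (rule finite_subset[OF _ finite_max_norm_le[of J]]) auto
  qed (use sn in auto)
  finally have "real (4 * N_norm (W1 a) B) = real ((\<Sum>p\<in>{p \<in> prim2. max_norm p \<le> J}. card (P1 B p)) + (\<Sum>p\<in>{p \<in> prim2. nn p \<le> B\<^sup>2}. 2))"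
    by (simp only:)
  thus ?thesis by simp
qed

text \<open>For \<open>\<mu> = 0\<close> both coefficients of the height form are \<open>1\<close>.\<close>

lemma P1_axis:
  assumes "p \<in> {p \<in> prim2. fst p = 0}"
  shows "P1 B p = PE2 B B"
proof -
  have p: "p \<in> prim2" and f: "fst p = 0" using assms by auto
  have "p = (0, 1) \<or> p = (0, - 1)" using assms unfolding prim2_axis by blast
  hence l: "(snd p)\<^sup>2 = 1" by auto
  have n: "nn p = 1" using l f by (simp add: nn_def)
  have "(real_of_int (snd p))\<^sup>2 = 1" using l by (metis of_int_1 of_int_power)
  hence "qq a p * (real_of_int a)\<^sup>2 = (real_of_int a)\<^sup>2" using qq_times_gcd[OF p] f by simp
  hence "qq a p = 1" using a by simp
  thus ?thesis by (simp add: n)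
qed

text \<open>The fibres with \<open>\<mu> \<noteq> 0\<close> give the infinite series. Their error terms \<open>O((B/j) log B)\<close> are summed over
the norms \<open>j = O(\<surd>B)\<close> of the nonempty fibres, and over the same range the tail of the series multiplied
by \<open>B\<^sup>2\<close> is \<open>O(B\<^sup>3\<^sup>/\<^sup>2)\<close>.\<close>

lemma W1_estimate:
  "\<exists>C\<ge>0. \<forall>B\<ge>1. \<bar>4 * real (N_norm (W1 a) B) - (pi * B\<^sup>2 / zeta 2) * (4 + (\<Sum>\<^sub>\<infinity>p\<in>{p \<in> prim2. fst p \<noteq> 0}. g1 p))\<bar>
     \<le> C * (B * sqrt B * (1 + ln B))"
proof -
  define \<alpha> where "\<alpha> = \<bar>real_of_int a\<bar>"
  have \<alpha>: "1 \<le> \<alpha>" using a by (simp add: \<alpha>_def)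
  define C0 where "C0 = 25 * (1 + 2 * (real_of_int a)\<^sup>2)"
  have C0: "0 \<le> C0" by (simp add: C0_def)
  let ?A = "{p \<in> prim2. fst p \<noteq> 0}"
  have est: "\<bar>4 * real (N_norm (W1 a) B) - (pi * B\<^sup>2 / zeta 2) * (4 + (\<Sum>\<^sub>\<infinity>p\<in>?A. g1 p))\<bar>
     \<le> (16 * C0 * \<alpha> + 64 * \<alpha> + 208) * (B * sqrt B * (1 + ln B))" if B: "B \<ge> 1" for B
  proof -
    \<comment> \<open>fibres of norm beyond \<open>J0\<close> are empty; \<open>J\<close> also covers every primitive vector in the disc of radius \<open>B\<close>\<close>
    define J0 where "J0 = nat \<lfloor>2 * \<alpha> * sqrt B\<rfloor>"
    define J where "J = max J0 (nat \<lceil>B\<rceil>)"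
    have sB: "1 \<le> sqrt B" using B by simp
    have J0: "real J0 \<le> 2 * \<alpha> * sqrt B" "2 * \<alpha> * sqrt B \<le> real (Suc J0)"
    proof -
      have "0 \<le> 2 * \<alpha> * sqrt B" using \<alpha> sB by simp
      thus "real J0 \<le> 2 * \<alpha> * sqrt B" "2 * \<alpha> * sqrt B \<le> real (Suc J0)" unfolding J0_def by linarith+
    qed
    have JB: "B \<le> real J" unfolding J_def by linarith
    let ?K = "pi * B\<^sup>2 / zeta 2"
    let ?P = "\<lambda>p. real (card (P1 B p))"
    let ?L = "B * sqrt B * (1 + ln B)"
    have lnB: "0 \<le> ln B" using B by simp
    have "1 * (B * (1 + ln B)) \<le> sqrt B * (B * (1 + ln B))" using sB B lnB by (intro mult_right_mono) auto
    hence B_le: "B * (1 + ln B) \<le> ?L" by (simp only: mult_1 mult_ac)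
    have "B * sqrt B * 1 \<le> ?L" using B lnB by (intro mult_left_mono) auto
    hence BL: "B * sqrt B \<le> ?L" by (simp only: mult_1_right)
    have fin: "finite {p \<in> D. max_norm p \<le> j}" for D j by (rule finite_subset[OF _ finite_max_norm_le[of j]]) auto
    have K: "0 \<le> ?K" "?K \<le> 4 * B\<^sup>2"
    proof -
      show "0 \<le> ?K" using zeta_2_bounds by simp
      have "?K \<le> pi * B\<^sup>2 / 1" using zeta_2_bounds by (intro divide_left_mono) auto
      also have "\<dots> \<le> 4 * B\<^sup>2" using pi_less_4 by (simp add: mult_right_mono)
      finally show "?K \<le> 4 * B\<^sup>2" .
    qed
    \<comment> \<open>the fibres with \<open>\<mu> \<noteq> 0\<close>\<close>
    have empty: "P1 B p = {}" if p: "p \<in> prim2" and "max_norm p > J0" for p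
    proof (rule ccontr)
      assume "P1 B p \<noteq> {}"
      hence "real (max_norm p) \<le> 2 * \<alpha> * sqrt B" using P1_nonempty(1)[OF p B] by (simp add: \<alpha>_def)
      hence "max_norm p \<le> J0" unfolding J0_def by (rule le_nat_floor)
      thus False using that by simp
    qed
    have "(\<Sum>p\<in>{p \<in> ?A. max_norm p \<le> J}. ?P p) = (\<Sum>p\<in>{p \<in> ?A. max_norm p \<le> J0}. ?P p)"
    proof (rule sum.mono_neutral_right[OF fin])
      show "{p \<in> ?A. max_norm p \<le> J0} \<subseteq> {p \<in> ?A. max_norm p \<le> J}" by (auto simp: J_def)
      show "\<forall>p\<in>{p \<in> ?A. max_norm p \<le> J} - {p \<in> ?A. max_norm p \<le> J0}. ?P p = 0"
      proof
        fix p assume "p \<in> {p \<in> ?A. max_norm p \<le> J} - {p \<in> ?A. max_norm p \<le> J0}"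
        hence "p \<in> prim2" "max_norm p > J0" by auto
        hence "P1 B p = {}" by (rule empty)
        thus "?P p = 0" by simp
      qed
    qed
    moreover have "\<bar>(\<Sum>p\<in>{p \<in> ?A. max_norm p \<le> J0}. ?P p) - ?K * (\<Sum>\<^sub>\<infinity>p\<in>?A. g1 p)\<bar>
        \<le> (\<Sum>p\<in>{p \<in> ?A. max_norm p \<le> J0}. C0 * B * (1 + ln B) * (1 / real (max_norm p))) + ?K * (16 * (2 * (real_of_int a)\<^sup>2) / real (Suc J0))"
      unfolding C0_def
      by (rule sum_approx_infsum[OF _ _ _ K(1)]) (use max_norm_pos g1_bounds P1_error B in auto)
    moreover have "(\<Sum>p\<in>{p \<in> ?A. max_norm p \<le> J0}. C0 * B * (1 + ln B) * (1 / real (max_norm p))) \<le> 16 * C0 * \<alpha> * ?L"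
    proof -
      have "(\<Sum>p\<in>{p \<in> ?A. max_norm p \<le> J0}. C0 * B * (1 + ln B) * (1 / real (max_norm p)))
        \<le> (\<Sum>p | 0 < max_norm p \<and> max_norm p \<le> J0. C0 * B * (1 + ln B) * (1 / real (max_norm p)))"
      proof (rule sum_mono2)
        show "finite {p. 0 < max_norm p \<and> max_norm p \<le> J0}" by (rule finite_subset[OF _ finite_max_norm_le[of J0]]) auto
      qed (use max_norm_pos C0 B lnB in auto)
      also have "\<dots> = C0 * B * (1 + ln B) * (8 * real J0)" by (simp only: sum_distrib_left[symmetric] sum_shells_1)
      also have "\<dots> \<le> C0 * B * (1 + ln B) * (8 * (2 * \<alpha> * sqrt B))" using J0 C0 B lnB by (intro mult_left_mono) auto
      also have "\<dots> = 16 * C0 * \<alpha> * ?L" by (simp add: mult_ac)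
      finally show ?thesis .
    qed
    moreover have "?K * (16 * (2 * (real_of_int a)\<^sup>2) / real (Suc J0)) \<le> 64 * \<alpha> * ?L"
    proof -
      have "?K * (16 * (2 * (real_of_int a)\<^sup>2) / real (Suc J0)) \<le> (4 * B\<^sup>2) * (16 * (2 * (real_of_int a)\<^sup>2) / (2 * \<alpha> * sqrt B))"
        using K J0 \<alpha> sB by (intro mult_mono divide_left_mono) auto
      also have "\<dots> = 64 * \<alpha> * (B * (B / sqrt B))"
      proof -
        have "(real_of_int a)\<^sup>2 = \<alpha>\<^sup>2" by (simp add: \<alpha>_def)
        hence "16 * (2 * (real_of_int a)\<^sup>2) / (2 * \<alpha> * sqrt B) = 16 * \<alpha> / sqrt B"
          using \<alpha> by (simp add: power2_eq_square)
        thus ?thesis by (simp only:) (simp add: power2_eq_square)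
      qed
      also have "B / sqrt B = sqrt B" using B by (simp add: real_div_sqrt)
      also have "64 * \<alpha> * (B * sqrt B) \<le> 64 * \<alpha> * ?L"
        using BL \<alpha> by (intro mult_left_mono) auto
      finally show ?thesis .
    qed
    ultimately have 1: "\<bar>(\<Sum>p\<in>{p \<in> ?A. max_norm p \<le> J}. ?P p) - ?K * (\<Sum>\<^sub>\<infinity>p\<in>?A. g1 p)\<bar> \<le> 16 * C0 * \<alpha> * ?L + 64 * \<alpha> * ?L"
      by linarith
    \<comment> \<open>the line \<open>\<mu> = 0\<close> and the line \<open>h = 0\<close> each contribute twice the primitive vectors of a disc\<close>
    define T where "T = real (card (PE2 B B))"
    have "\<bar>T - pi * B * B / zeta 2\<bar> \<le> 25 * (B + B) * (1 + ln B)" unfolding T_def by (rule count_PE2[OF B B])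
    hence T: "\<bar>T - ?K\<bar> \<le> 50 * (B * (1 + ln B))" by (simp add: power2_eq_square mult_ac)
    have J1: "J \<ge> 1" using JB B by linarith
    have "{p \<in> prim2. max_norm p \<le> J} = {p \<in> ?A. max_norm p \<le> J} \<union> {p \<in> prim2. fst p = 0}"
    proof (intro equalityI subsetI)
      fix p assume "p \<in> {p \<in> ?A. max_norm p \<le> J} \<union> {p \<in> prim2. fst p = 0}"
      moreover have "max_norm p \<le> J" "p \<in> prim2" if "p \<in> {p \<in> prim2. fst p = 0}"
      proof -
        show "p \<in> prim2" using that by simp
        have "p = (0, 1) \<or> p = (0, - 1)" using that unfolding prim2_axis by blast
        thus "max_norm p \<le> J" using J1 by (auto simp: max_norm_def)
      qed
      ultimately show "p \<in> {p \<in> prim2. max_norm p \<le> J}" by blast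
    qed blast
    hence "(\<Sum>p\<in>{p \<in> prim2. max_norm p \<le> J}. ?P p) = (\<Sum>p\<in>{p \<in> ?A. max_norm p \<le> J} \<union> {p \<in> prim2. fst p = 0}. ?P p)"
      by (rule arg_cong[where f = "sum ?P"])
    also have "\<dots> = (\<Sum>p\<in>{p \<in> ?A. max_norm p \<le> J}. ?P p) + (\<Sum>p\<in>{p \<in> prim2. fst p = 0}. ?P p)"
    proof (rule sum.union_disjoint[OF fin])
      show "finite {p \<in> prim2. fst p = 0}" unfolding prim2_axis by simp
    qed blast
    also have "(\<Sum>p\<in>{p \<in> prim2. fst p = 0}. ?P p) = (\<Sum>p\<in>{p \<in> prim2. fst p = 0}. T)"
      by (intro sum.cong refl) (simp only: P1_axis T_def)
    also have "\<dots> = 2 * T" unfolding prim2_axis by simp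
    finally have total: "4 * real (N_norm (W1 a) B) = (\<Sum>p\<in>{p \<in> ?A. max_norm p \<le> J}. ?P p) + 2 * T + 2 * (T + 4)"
      unfolding N_W1_eq_sum[OF B JB] card_prim2_disc[OF B] by (simp add: T_def)
    have "1 \<le> B * (1 + ln B)" using mult_mono[of 1 B 1 "1 + ln B"] B lnB by simp
    hence L: "1 \<le> ?L" "50 * (B * (1 + ln B)) \<le> 50 * ?L" using B_le by linarith+
    have "\<bar>4 * real (N_norm (W1 a) B) - ?K * (4 + (\<Sum>\<^sub>\<infinity>p\<in>?A. g1 p))\<bar>
        \<le> (16 * C0 * \<alpha> * ?L + 64 * \<alpha> * ?L) + 4 * (50 * (B * (1 + ln B))) + 8"
      by (rule combine_errors[OF total 1 T])
    also have "\<dots> \<le> (16 * C0 * \<alpha> * ?L + 64 * \<alpha> * ?L) + 208 * ?L" using L by linarith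
    also have "\<dots> = (16 * C0 * \<alpha> + 64 * \<alpha> + 208) * ?L" by (simp only: distrib_right)
    finally show "\<bar>4 * real (N_norm (W1 a) B) - ?K * (4 + (\<Sum>\<^sub>\<infinity>p\<in>?A. g1 p))\<bar> \<le> (16 * C0 * \<alpha> + 64 * \<alpha> + 208) * ?L" .
  qed
  show ?thesis
    by (intro exI[of _ "16 * C0 * \<alpha> + 64 * \<alpha> + 208"] conjI allI impI est) (use C0 \<alpha> in auto)
qed

end

theorem W1_asymptotics:
  assumes a: "a \<noteq> 0"
  shows "(\<lambda>(m, l). real_of_int (gcd a m) / sqrt (real_of_int (f1 a m l)))
        summable_on {(m, l) \<in> prim2. m \<noteq> 0} \<and>
      (\<lambda>B::real. real (N_norm (W1 a) B) -
          pi * B\<^sup>2 / (4 * zeta 2) *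
            (4 + (\<Sum>\<^sub>\<infinity>(m, l)\<in>{(m, l) \<in> prim2. m \<noteq> 0}.
                    real_of_int (gcd a m) / sqrt (real_of_int (f1 a m l)))))
        \<in> O[at_top](\<lambda>B. B powr (3 / 2) * (ln B)\<^sup>2)"
proof
  have g1: "(\<lambda>(m, l). real_of_int (gcd a m) / sqrt (real_of_int (f1 a m l))) = g1 a"
    by (auto simp: g1_def[OF a] fun_eq_iff)
  have A: "{(m, l) \<in> prim2. m \<noteq> 0} = {p \<in> prim2. fst p \<noteq> 0}" by auto
  show "(\<lambda>(m, l). real_of_int (gcd a m) / sqrt (real_of_int (f1 a m l))) summable_on {(m, l) \<in> prim2. m \<noteq> 0}"
    unfolding g1 A by (rule shell_tail(1)[of _ _ "2 * (real_of_int a)\<^sup>2"]) (auto simp: max_norm_pos g1_bounds[OF a])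
  obtain C where C: "C \<ge> 0" and est: "\<And>B. B \<ge> 1 \<Longrightarrow>
     \<bar>4 * real (N_norm (W1 a) B) - (pi * B\<^sup>2 / zeta 2) * (4 + (\<Sum>\<^sub>\<infinity>p\<in>{p \<in> prim2. fst p \<noteq> 0}. g1 a p))\<bar>
     \<le> C * (B * sqrt B * (1 + ln B))"
    using W1_estimate[OF a] by blast
  show "(\<lambda>B::real. real (N_norm (W1 a) B) -
          pi * B\<^sup>2 / (4 * zeta 2) *
            (4 + (\<Sum>\<^sub>\<infinity>(m, l)\<in>{(m, l) \<in> prim2. m \<noteq> 0}.
                    real_of_int (gcd a m) / sqrt (real_of_int (f1 a m l)))))
        \<in> O[at_top](\<lambda>B. B powr (3 / 2) * (ln B)\<^sup>2)"
    unfolding g1 A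
  proof (rule bigoI[of _ C], rule eventually_at_top_linorderI[of "exp 1"])
    fix B :: real assume B: "exp 1 \<le> B"
    have B1: "B \<ge> 1" using B exp_ge_add_one_self[of 1] by linarith
    have l1: "ln B \<ge> 1" using B B1 ln_le_cancel_iff[of "exp 1" B] by simp
    let ?\<Sigma> = "4 + (\<Sum>\<^sub>\<infinity>p\<in>{p \<in> prim2. fst p \<noteq> 0}. g1 a p)"
    have pw: "B powr (3 / 2) = B * sqrt B"
    proof -
      have "B powr (3 / 2) = B powr (1 + 1 / 2)" by simp
      also have "\<dots> = B powr 1 * B powr (1 / 2)" by (rule powr_add)
      finally show ?thesis using B1 by (simp add: powr_half_sqrt)
    qed
    have scale: "4 * \<bar>x - y / (4 * z) * t\<bar> = \<bar>4 * x - y / z * t\<bar>" for x y z t :: real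
    proof -
      have "4 * x - y / z * t = 4 * (x - y / (4 * z) * t)" by (simp add: right_diff_distrib)
      thus ?thesis by (simp only: abs_mult abs_numeral)
    qed
    have "4 * \<bar>real (N_norm (W1 a) B) - pi * B\<^sup>2 / (4 * zeta 2) * ?\<Sigma>\<bar> \<le> C * (B * sqrt B * (1 + ln B))"
      unfolding scale by (rule est[OF B1])
    also have "\<dots> \<le> C * (B * sqrt B * (4 * (ln B)\<^sup>2))"
    proof -
      have "ln B * 1 \<le> ln B * ln B" using l1 by (intro mult_left_mono) auto
      hence "1 + ln B \<le> 4 * (ln B)\<^sup>2" using l1 unfolding power2_eq_square by linarith
      thus ?thesis using C B1 by (intro mult_left_mono) auto
    qed
    finally have fin: "4 * \<bar>real (N_norm (W1 a) B) - pi * B\<^sup>2 / (4 * zeta 2) * ?\<Sigma>\<bar> \<le> C * (B * sqrt B * (4 * (ln B)\<^sup>2))" .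
    have "\<bar>real (N_norm (W1 a) B) - pi * B\<^sup>2 / (4 * zeta 2) * ?\<Sigma>\<bar> \<le> C * (B powr (3 / 2) * (ln B)\<^sup>2)"
    proof -
      have "x \<le> C * (b * u)" if "4 * x \<le> C * (b * (4 * u))" for x b u :: real using that by (simp add: mult_ac)
      from this[OF fin] show ?thesis unfolding pw .
    qed
    thus "norm (real (N_norm (W1 a) B) - pi * B\<^sup>2 / (4 * zeta 2) * ?\<Sigma>) \<le> C * norm (B powr (3 / 2) * (ln B)\<^sup>2)"
      by (simp only: real_norm_def abs_mult abs_power2 abs_of_nonneg[OF powr_ge_zero])
  qed
qed

section \<open>The asymptotic formulas\<close>

theorem theorem1p1:
  shows "(\<forall>a::int. a \<noteq> 0 \<and> squarefree a \<longrightarrow>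
      (\<lambda>(m, l). real_of_int (gcd a m) / sqrt (real_of_int (f1 a m l)))
        summable_on {(m, l) \<in> prim2. m \<noteq> 0} \<and>
      (\<lambda>B::real. real (N_norm (W1 a) B) -
          pi * B\<^sup>2 / (4 * zeta 2) *
            (4 + (\<Sum>\<^sub>\<infinity>(m, l)\<in>{(m, l) \<in> prim2. m \<noteq> 0}.
                    real_of_int (gcd a m) / sqrt (real_of_int (f1 a m l)))))
        \<in> O[at_top](\<lambda>B. B powr (3 / 2) * (ln B)\<^sup>2))
    \<and> ((\<lambda>(m, l). 1 / sqrt (real_of_int (f2 m l))) summable_on prim2 \<and>
      (\<lambda>B::real. real (N_norm W2 B) -
          pi * B ^ 3 / (3 * zeta 3) *
            (\<Sum>\<^sub>\<infinity>(m, l)\<in>prim2. 1 / sqrt (real_of_int (f2 m l))))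
        \<in> O[at_top](\<lambda>B. B\<^sup>2 * ln B))"
  using W1_asymptotics W2_asymptotics by blast

end
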